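(* Let $\alpha,\beta$ be compositions of the same length $R$ and size $N$ with $\alpha\neq(1^R)$, and $\nu$ a partition of $N$. Suppose that $r_\alpha-r_\beta=s_\nu$, $\lambda(\alpha)=\lambda(\beta)$, $\lambda(\alpha^t)=\lambda(\beta^t)$, and $e(\alpha)\neq e(\beta)$. Then $\nu=ab1^d$ for some $a,b,d$ with $b\ge3$, and there exist $\tilde\alpha\in\{\alpha,\alpha^*\}$, $\tilde\beta\in\{\beta,\beta^*\}$ such that $(\tilde\alpha,\tilde\beta)$ is one of: (3) $\tilde\alpha=(1^{d+1},a,b-1)$, $\tilde\beta=(1^{d+1},b-1,a)$; (4) $\tilde\alpha=(1,a,1^d,b-1)$, $\tilde\beta=(1,b-1,1^d,a)$; (5) $\tilde\alpha=(b-1,1^d,b,a-b+1)$, $\tilde\beta=(b,1^d,b-1,a-b+1)$.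
   Context: A composition is a finite sequence of positive integers $\alpha=\alpha_1\cdots\alpha_R$; $j^m$ denotes $m$ consecutive parts equal to $j$; $\alpha^*$ is the reverse; $e(\alpha)$ is the multiset $\{\alpha_1,\alpha_R\}$; $\lambda(\alpha)$ is the partition obtained by sorting parts decreasingly. $ab1^d$ denotes the partition $(a,b,1,\dots,1)$ with $d$ ones. The ribbon diagram of $\alpha$ (English convention, rows from the top) has $\alpha_i$ cells in row $i$, with the rightmost cell of row $i+1$ directly below the leftmost cell of row $i$. The transpose $\alpha^t$ is the composition whose ribbon diagram is the reflection of that of $\alpha$ across the main diagonal. $r_\alpha=\sum_T\prod_m x_m^{\#\{m\text{'s in }T\}}$ over semistandard Young tableaux $T$ of ribbon shape $\alpha$ (rows weakly increasing, columns strictly increasing). $s_\nu$ is the Schur function. *)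

theory Defs
  imports Main "HOL-Library.Multiset"
begin

definition composition :: "nat list \<Rightarrow> bool" where
  "composition \<alpha> \<longleftrightarrow> (\<forall>x \<in> set \<alpha>. x > 0)"

definition is_partition :: "nat list \<Rightarrow> bool" where
  "is_partition \<nu> \<longleftrightarrow> composition \<nu> \<and> sorted_wrt (\<ge>) \<nu>"

definition part_sort :: "nat list \<Rightarrow> nat list" where
  "part_sort \<alpha> = rev (sort \<alpha>)"

definition ends :: "nat list \<Rightarrow> nat multiset" where
  "ends \<alpha> = {#hd \<alpha>, last \<alpha>#}"

text \<open>
  A cell is a pair (row, column), both counted from 0, with rows numbered downwards and
  columns from left to right.
\<close>

type_synonym diagram = "(nat \<times> nat) set"

definition young_diagram :: "nat list \<Rightarrow> diagram" where
  "young_diagram \<nu> = {(i, j). i < length \<nu> \<and> j < \<nu> ! i}"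

text \<open>
  The last row of a ribbon starts in column 0. Consecutive rows overlap in exactly one column
  (the rightmost cell of row \<open>i + 1\<close> is below the leftmost cell of row \<open>i\<close>), so every row \<open>k\<close>
  below row \<open>i\<close> moves the first column of row \<open>i\<close> to the right by \<open>\<alpha> ! k - 1\<close>.
\<close>

definition ribbon_diagram :: "nat list \<Rightarrow> diagram" where
  "ribbon_diagram \<alpha> = {(i, j). i < length \<alpha> \<and>
     (\<Sum>k \<in> {i<..<length \<alpha>}. \<alpha> ! k - 1) \<le> j \<and>
     j < (\<Sum>k \<in> {i<..<length \<alpha>}. \<alpha> ! k - 1) + \<alpha> ! i}"

text \<open>Existence and uniqueness of this composition are shown in \<open>ex1_transpose\<close> below.\<close>

definition comp_transpose :: "nat list \<Rightarrow> nat list" where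
  "comp_transpose \<alpha> =
     (THE \<gamma>. composition \<gamma> \<and> ribbon_diagram \<gamma> = prod.swap ` ribbon_diagram \<alpha>)"

text \<open>
  Entries are positive integers; a filling is 0 outside its diagram, so that distinct
  functions are distinct tableaux.
\<close>

definition semistandard :: "diagram \<Rightarrow> (nat \<times> nat \<Rightarrow> nat) \<Rightarrow> bool" where
  "semistandard D T \<longleftrightarrow>
     (\<forall>c. c \<in> D \<longrightarrow> T c > 0) \<and>
     (\<forall>c. c \<notin> D \<longrightarrow> T c = 0) \<and>
     (\<forall>i j j'. (i, j) \<in> D \<and> (i, j') \<in> D \<and> j < j' \<longrightarrow> T (i, j) \<le> T (i, j')) \<and>
     (\<forall>i i' j. (i, j) \<in> D \<and> (i', j) \<in> D \<and> i < i' \<longrightarrow> T (i, j) < T (i', j))"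

text \<open>
  A formal power series in the commuting variables \<open>x\<^sub>1, x\<^sub>2, \<dots>\<close> is given by its coefficients.
  A monomial is written as the finite multiset of the indices of its variables, so that
  \<open>{#1, 1, 3#}\<close> stands for \<open>x\<^sub>1\<^sup>2 x\<^sub>3\<close>. The coefficient of a monomial in the generating
  function of the tableaux of shape \<open>D\<close> is the number of tableaux with that multiset of entries;
  for finite \<open>D\<close> there are finitely many of them.
\<close>

type_synonym monomial = "nat multiset"
type_synonym power_series = "monomial \<Rightarrow> int"

definition tableau_series :: "diagram \<Rightarrow> power_series" where
  "tableau_series D = (\<lambda>M. int (card {T. semistandard D T \<and> image_mset T (mset_set D) = M}))"

definition ribbon_schur :: "nat list \<Rightarrow> power_series" where
  "ribbon_schur \<alpha> = tableau_series (ribbon_diagram \<alpha>)"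

definition schur :: "nat list \<Rightarrow> power_series" where
  "schur \<nu> = tableau_series (young_diagram \<nu>)"


lemma map_prod_Times: "map_prod f g ` (A \<times> B) = (f ` A) \<times> (g ` B)"
  by force

lemma ribbon_diagram_Nil [simp]: "ribbon_diagram [] = {}"
  by (simp add: ribbon_diagram_def)

lemma ribbon_diagram_Cons:
  "ribbon_diagram (a # \<alpha>) =
     {0} \<times> {(\<Sum>x\<leftarrow>\<alpha>. x - 1)..<(\<Sum>x\<leftarrow>\<alpha>. x - 1) + a} \<union> map_prod Suc id ` ribbon_diagram \<alpha>"
proof -
  have shift: "(\<Sum>k\<in>{Suc i<..<Suc (length \<alpha>)}. (a # \<alpha>) ! k - 1) =
      (\<Sum>k\<in>{i<..<length \<alpha>}. \<alpha> ! k - 1)" for i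
    by (rule sum.reindex_bij_witness[of _ Suc "\<lambda>k. k - 1"]) auto
  have first: "(\<Sum>k\<in>{0<..<Suc (length \<alpha>)}. (a # \<alpha>) ! k - 1) = (\<Sum>x\<leftarrow>\<alpha>. x - 1)"
    unfolding sum_list_sum_nth
    by (rule sum.reindex_bij_witness[of _ Suc "\<lambda>k. k - 1"]) auto
  have "(i, j) \<in> ribbon_diagram (a # \<alpha>) \<longleftrightarrow>
      (i, j) \<in> {0} \<times> {(\<Sum>x\<leftarrow>\<alpha>. x - 1)..<(\<Sum>x\<leftarrow>\<alpha>. x - 1) + a} \<union> map_prod Suc id ` ribbon_diagram \<alpha>"
    for i j
  proof (cases i)
    case 0
    then show ?thesis using first by (auto simp: ribbon_diagram_def)
  next
    case (Suc i')
    have "(Suc i', j) \<in> map_prod Suc id ` ribbon_diagram \<alpha> \<longleftrightarrow> (i', j) \<in> ribbon_diagram \<alpha>"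
      by force
    then show ?thesis using Suc shift[of i'] by (simp add: ribbon_diagram_def)
  qed
  then show ?thesis by auto
qed

lemma ribbon_diagram_grow_last:
  "ribbon_diagram (\<gamma> @ [Suc c]) =
     map_prod id Suc ` ribbon_diagram (\<gamma> @ [c]) \<union> {(length \<gamma>, 0)}" if "c > 0"
proof (induction \<gamma>)
  case Nil
  have "{0..<Suc c} = insert 0 (Suc ` {0..<c})"
    by (simp add: lessThan_Suc_eq_insert_0 flip: lessThan_atLeast0)
  then show ?case
    by (auto simp: ribbon_diagram_Cons map_prod_Times)
next
  case (Cons a \<gamma>)
  have "(\<Sum>x\<leftarrow>\<gamma> @ [Suc c]. x - 1) = Suc (\<Sum>x\<leftarrow>\<gamma> @ [c]. x - 1)"
    using that by simp
  moreover have "{0::nat} \<times> {Suc s..<Suc s + a} = map_prod id Suc ` ({0} \<times> {s..<s + a})" for s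
    by (simp add: map_prod_Times)
  moreover have "map_prod Suc id ` map_prod id Suc ` X = map_prod id Suc ` map_prod Suc id ` X"
    for X :: diagram by (simp add: image_image map_prod_def split_beta)
  ultimately show ?case
    by (simp only: append_Cons ribbon_diagram_Cons Cons.IH image_Un) auto
qed

lemma ribbon_diagram_append_ones:
  "ribbon_diagram (\<gamma> @ replicate m 1) =
     ribbon_diagram \<gamma> \<union> {length \<gamma>..<length \<gamma> + m} \<times> {0}"
proof (induction \<gamma>)
  case Nil
  show ?case
  proof (induction m)
    case (Suc m)
    have "map_prod Suc id ` ({0..<m} \<times> {0::nat}) = {Suc 0..<Suc m} \<times> {0}"
      by (simp add: map_prod_Times)
    with Suc show ?case by (auto simp: ribbon_diagram_Cons sum_list_replicate)
  qed simp
next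
  case (Cons a \<gamma>)
  have "map_prod Suc id ` ({n..<n + m} \<times> {0::nat}) = {Suc n..<Suc n + m} \<times> {0}" for n
    by (simp add: map_prod_Times)
  with Cons show ?case by (auto simp: ribbon_diagram_Cons sum_list_replicate image_Un)
qed

lemma ribbon_diagram_inj:
  assumes "composition \<alpha>" "composition \<beta>" "ribbon_diagram \<alpha> = ribbon_diagram \<beta>"
  shows "\<alpha> = \<beta>"
proof -
  have row: "{j. (i, j) \<in> ribbon_diagram \<gamma>} =
      {(\<Sum>k\<in>{i<..<length \<gamma>}. \<gamma> ! k - 1)..<(\<Sum>k\<in>{i<..<length \<gamma>}. \<gamma> ! k - 1) + \<gamma> ! i}"
    if "i < length \<gamma>" for i \<gamma>
    using that by (auto simp: ribbon_diagram_def)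
  have rows: "i < length \<gamma> \<longleftrightarrow> {j. (i, j) \<in> ribbon_diagram \<gamma>} \<noteq> {}" if "composition \<gamma>" for i \<gamma>
    using that row[of i \<gamma>] by (force simp: composition_def ribbon_diagram_def)
  have len: "i < length \<alpha> \<longleftrightarrow> i < length \<beta>" for i
    using rows assms by simp
  have "length \<alpha> = length \<beta>"
    using len[of "length \<alpha>"] len[of "length \<beta>"] by simp
  moreover have "\<alpha> ! i = \<beta> ! i" if "i < length \<alpha>" for i
    using arg_cong[OF row[of i \<alpha>], of card] arg_cong[OF row[of i \<beta>], of card] that len assms(3)
    by simp
  ultimately show ?thesis by (rule nth_equalityI)
qed

lemma ex_transpose:
  "composition \<alpha> \<Longrightarrow> \<alpha> \<noteq> [] \<Longrightarrow>
     \<exists>\<gamma>. composition \<gamma> \<and> \<gamma> \<noteq> [] \<and> length \<gamma> = Suc (\<Sum>x\<leftarrow>\<alpha>. x - 1) \<and>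
         ribbon_diagram \<gamma> = prod.swap ` ribbon_diagram \<alpha>"
proof (induction \<alpha>)
  case (Cons a \<alpha>)
  then have a: "a > 0" and comp: "composition \<alpha>" by (auto simp: composition_def)
  show ?case
  proof (cases "\<alpha> = []")
    case True
    have "ribbon_diagram (replicate a 1) = {0..<a} \<times> {0}"
      using ribbon_diagram_append_ones[of "[]" a] by simp
    moreover have "ribbon_diagram [a] = {0} \<times> {0..<a}"
      by (simp add: ribbon_diagram_Cons)
    ultimately have "ribbon_diagram (replicate a 1) = prod.swap ` ribbon_diagram [a]"
      by (simp only: product_swap)
    then show ?thesis using a True
      by (intro exI[of _ "replicate a 1"]) (auto simp: composition_def)
  next
    case False
    with Cons.IH comp obtain \<gamma> where \<gamma>: "composition \<gamma>" "\<gamma> \<noteq> []"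
        "length \<gamma> = Suc (\<Sum>x\<leftarrow>\<alpha>. x - 1)" "ribbon_diagram \<gamma> = prod.swap ` ribbon_diagram \<alpha>"
      by blast
    obtain \<delta> c where \<delta>: "\<gamma> = \<delta> @ [c]" using \<gamma>(2) by (metis rev_exhaust)
    have c: "c > 0" using \<gamma>(1) \<delta> by (simp add: composition_def)
    let ?s = "\<Sum>x\<leftarrow>\<alpha>. x - 1"
    let ?\<gamma> = "(\<delta> @ [Suc c]) @ replicate (a - 1) 1"
    have s: "length \<delta> = ?s" using \<gamma>(3) \<delta> by simp
    have "ribbon_diagram ?\<gamma> = map_prod id Suc ` ribbon_diagram \<gamma> \<union> {(?s, 0)} \<union>
        {Suc ?s..<Suc ?s + (a - 1)} \<times> {0}"
      unfolding ribbon_diagram_append_ones ribbon_diagram_grow_last[OF c]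
      using s \<delta> by simp
    also have "\<dots> = map_prod id Suc ` ribbon_diagram \<gamma> \<union> {?s..<?s + a} \<times> {0}"
      using a by auto
    also have "\<dots> = prod.swap ` ribbon_diagram (a # \<alpha>)"
    proof -
      have "map_prod id Suc ` prod.swap ` X = prod.swap ` map_prod Suc id ` X" for X :: diagram
        by (simp add: image_image map_prod_def split_beta)
      then show ?thesis
        unfolding ribbon_diagram_Cons \<gamma>(4) image_Un product_swap by auto
    qed
    finally have "ribbon_diagram ?\<gamma> = prod.swap ` ribbon_diagram (a # \<alpha>)" .
    moreover have "composition ?\<gamma>" using \<gamma>(1) \<delta> by (auto simp: composition_def)
    moreover have "length ?\<gamma> = Suc (\<Sum>x\<leftarrow>a # \<alpha>. x - 1)" using s by simp
    ultimately show ?thesis by blast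
  qed
qed simp

lemma ex1_transpose:
  assumes "composition \<alpha>"
  shows "\<exists>!\<gamma>. composition \<gamma> \<and> ribbon_diagram \<gamma> = prod.swap ` ribbon_diagram \<alpha>"
proof -
  have "\<exists>\<gamma>. composition \<gamma> \<and> ribbon_diagram \<gamma> = prod.swap ` ribbon_diagram \<alpha>"
  proof (cases "\<alpha> = []")
    case True
    then show ?thesis by (intro exI[of _ "[]"]) (simp add: composition_def)
  next
    case False
    then show ?thesis using ex_transpose assms by blast
  qed
  then show ?thesis by (metis ribbon_diagram_inj)
qed

end

theory Submission
  imports Defs "HOL-Computational_Algebra.Polynomial"
begin

text \<open>
  Superization turns the hypothesis into the same identity over alphabets with even letters (weakly
  increasing in rows, strictly in columns) and odd letters (the converse). Every such evaluation of
  a ribbon is determined by the evaluations \<open>H n\<close> of single rows through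
  \<open>r(n, m, \<dots>) = H n * r(m, \<dots>) - r(n + m, \<dots>)\<close>.

  For one odd letter of weight \<open>u\<close> and two even ones of weights 1 and 2, the row evaluations are
  \<open>(1 + y) 2^n - y\<close> with \<open>y = u + 1\<close>, and the ribbon evaluates to a product: \<open>y (1 + y)\<close> times \<open>2^k - 1\<close>
  for each end row \<open>k\<close> and \<open>y (2^k - 1) - 1\<close> for each inner row. A Schur function evaluates to 0 if
  its shape contains a 3 by 2 block, and to \<open>y (1 + y) (y - 1)^d (2^a - 2^(b - 1))\<close> for the shape
  \<open>ab1^d\<close>. As the row lengths agree, comparing the roots in \<open>y\<close> forces the shape to be \<open>ab1^d\<close>, all rows
  other than three to have length 1, and leaves two possibilities for those three. The column
  lengths then exclude \<open>b = 2\<close>.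

  To locate the two long inner rows, a second odd letter of weight 1 is added. The two top
  coefficients in \<open>u\<close> after the leading one decide between the remaining arrangements.
\<close>

section \<open>Tableaux over signed alphabets\<close>

text \<open>Even letters alone do not suffice: with two of them every shape that has a column of
  three cells evaluates to 0. An odd letter may repeat down a column, so long columns survive, and
  its weight is a free parameter whose values separate the inner rows. The row evaluations then
  combine just two geometric progressions, \<open>2^n\<close> and 1, which is why the ribbon
  recursion collapses to a product. The weights 1 and 2 express all factors through numbers
  \<open>2^k - 1\<close>, so that powers of 2 and residues modulo 4 can be compared.

  The product is symmetric in the inner rows, hence blind to their order. A further odd letter
  breaks this symmetry at the price of the factorization; therefore only a few coefficients are
  computed. The leading one in \<open>u\<close> is still a product over all rows and cancels in the
  difference. The next one sees whether a run of ones is empty, and the one after it tells a run of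
  a single 1 from a longer run.\<close>

definition row_le :: "(nat \<Rightarrow> bool) \<Rightarrow> nat \<Rightarrow> nat \<Rightarrow> bool" where
  "row_le E x y \<longleftrightarrow> x < y \<or> x = y \<and> E x"

definition col_le :: "(nat \<Rightarrow> bool) \<Rightarrow> nat \<Rightarrow> nat \<Rightarrow> bool" where
  "col_le E x y \<longleftrightarrow> x < y \<or> x = y \<and> \<not> E x"

definition supertab :: "(nat \<Rightarrow> bool) \<Rightarrow> diagram \<Rightarrow> (nat \<times> nat \<Rightarrow> nat) \<Rightarrow> bool" where
  "supertab E X T \<longleftrightarrow>
     (\<forall>c. c \<in> X \<longrightarrow> T c > 0) \<and>
     (\<forall>c. c \<notin> X \<longrightarrow> T c = 0) \<and>
     (\<forall>i j j'. (i, j) \<in> X \<and> (i, j') \<in> X \<and> j < j' \<longrightarrow> row_le E (T (i, j)) (T (i, j'))) \<and>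
     (\<forall>i i' j. (i, j) \<in> X \<and> (i', j) \<in> X \<and> i < i' \<longrightarrow> col_le E (T (i, j)) (T (i', j)))"

definition entries :: "diagram \<Rightarrow> (nat \<times> nat \<Rightarrow> nat) \<Rightarrow> nat multiset" where
  "entries X T = image_mset T (mset_set X)"

definition scount :: "(nat \<Rightarrow> bool) \<Rightarrow> diagram \<Rightarrow> nat multiset \<Rightarrow> int" where
  "scount E X M = int (card {T. supertab E X T \<and> entries X T = M})"

text \<open>The third fact is what drives the ribbon recursion: of any two letters \<open>x\<close>
  and \<open>y\<close>, the first may stand either to the left of the second or below it, and always
  exactly one of these is allowed.\<close>

lemma row_le_trans: "row_le E x y \<Longrightarrow> row_le E y z \<Longrightarrow> row_le E x z"
  and col_le_trans: "col_le E x y \<Longrightarrow> col_le E y z \<Longrightarrow> col_le E x z"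
  and not_row_le: "\<not> row_le E x y \<longleftrightarrow> col_le E y x"
  by (auto simp: row_le_def col_le_def)

lemma supertab_pos: "supertab E X T \<Longrightarrow> c \<in> X \<Longrightarrow> T c > 0"
  and supertab_outside: "supertab E X T \<Longrightarrow> c \<notin> X \<Longrightarrow> T c = 0"
  and supertab_row: "supertab E X T \<Longrightarrow> (i, j) \<in> X \<Longrightarrow> (i, j') \<in> X \<Longrightarrow> j < j' \<Longrightarrow>
    row_le E (T (i, j)) (T (i, j'))"
  and supertab_col: "supertab E X T \<Longrightarrow> (i, j) \<in> X \<Longrightarrow> (i', j) \<in> X \<Longrightarrow> i < i' \<Longrightarrow>
    col_le E (T (i, j)) (T (i', j))"
  unfolding supertab_def by blast+

lemma supertabI:
  assumes "\<And>c. c \<in> X \<Longrightarrow> T c > 0" "\<And>c. c \<notin> X \<Longrightarrow> T c = 0"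
    and "\<And>i j j'. (i, j) \<in> X \<Longrightarrow> (i, j') \<in> X \<Longrightarrow> j < j' \<Longrightarrow> row_le E (T (i, j)) (T (i, j'))"
    and "\<And>i i' j. (i, j) \<in> X \<Longrightarrow> (i', j) \<in> X \<Longrightarrow> i < i' \<Longrightarrow> col_le E (T (i, j)) (T (i', j))"
  shows "supertab E X T"
  unfolding supertab_def using assms by blast

lemma filter_replicate_mset:
  "filter_mset P (replicate_mset n x) = (if P x then replicate_mset n x else {#})"
  by (induction n) auto

lemma tableau_series_scount: "tableau_series X M = scount (\<lambda>_. True) X M"
proof -
  have "semistandard X T \<longleftrightarrow> supertab (\<lambda>_. True) X T" for T
    by (simp add: semistandard_def supertab_def row_le_def col_le_def le_less)
  then show ?thesis
    by (simp add: tableau_series_def scount_def entries_def)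
qed

lemma set_entries [simp]: "finite X \<Longrightarrow> set_mset (entries X T) = T ` X"
  by (simp add: entries_def)

lemma finite_fillings:
  assumes "finite X" "finite L"
  shows "finite {T. supertab E X T \<and> T ` X \<subseteq> L}"
proof (rule finite_subset)
  show "{T. supertab E X T \<and> T ` X \<subseteq> L} \<subseteq> {T. \<forall>c. (c \<in> X \<longrightarrow> T c \<in> L) \<and> (c \<notin> X \<longrightarrow> T c = 0)}"
    by (auto simp: supertab_def)
qed (rule finite_set_of_finite_funs[OF assms])

lemma finite_supertab_entries:
  assumes "finite X"
  shows "finite {T. supertab E X T \<and> entries X T = M}"
  using finite_fillings[OF assms, of "set_mset M" E]
  by (rule finite_subset[rotated]) (use assms in auto)

lemma scount_cong:
  assumes "finite X" "\<And>l. l \<in># M \<Longrightarrow> E l = E' l"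
  shows "scount E X M = scount E' X M"
proof -
  have "supertab E X T \<longleftrightarrow> supertab E' X T" if "entries X T = M" for T
  proof -
    have "T c \<in># M" if "c \<in> X" for c
      using \<open>entries X T = M\<close> that assms(1) by auto
    then have "E (T c) = E' (T c)" if "c \<in> X" for c
      using that assms(2) by blast
    then show ?thesis
      unfolding supertab_def
      by (intro conj_cong refl iff_allI imp_cong) (auto simp: row_le_def col_le_def)
  qed
  then show ?thesis unfolding scount_def by (metis (mono_tags, lifting) Collect_cong)
qed

text \<open>The value 0 marks the cells outside a diagram. Contents with a 0 therefore count
  nothing, and linear identities between counts hold for them trivially.\<close>

lemma scount_zero_letter:
  assumes "finite X" "0 \<in># M"
  shows "scount E X M = 0"
proof -
  have "entries X T \<noteq> M" if "supertab E X T" for T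
  proof
    assume "entries X T = M"
    then have "0 \<in> T ` X" using assms by auto
    then show False using supertab_pos[OF that] by fastforce
  qed
  then have "{T. supertab E X T \<and> entries X T = M} = {}" by blast
  then show ?thesis unfolding scount_def by (metis card.empty of_nat_0)
qed

text \<open>Only the order and the parity of the letters matter. The renaming serves to open a gap
  in the alphabet for a new letter; \<open>f 0 = 0\<close> preserves the value outside the
  diagram.\<close>

lemma scount_relabel:
  assumes X: "finite X" and f: "strict_mono f" "f 0 = 0" and E: "\<And>l. E' (f l) = E l"
  shows "scount E' X (image_mset f M) = scount E X M"
proof -
  have inj: "inj f" using f(1) by (rule strict_mono_imp_inj_on)
  have tab: "supertab E' X (f \<circ> T) \<longleftrightarrow> supertab E X T" for T
  proof -
    have pos: "0 < f l \<longleftrightarrow> 0 < l" for l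
      using strict_mono_less[OF f(1), of 0 l] f(2) by simp
    then have "f l = 0 \<longleftrightarrow> l = 0" for l
      by (metis gr0I less_irrefl)
    note pos this
    moreover have "row_le E' (f x) (f y) \<longleftrightarrow> row_le E x y" "col_le E' (f x) (f y) \<longleftrightarrow> col_le E x y" for x y
      using strict_mono_less[OF f(1)] inj E by (auto simp: row_le_def col_le_def inj_eq)
    ultimately show ?thesis unfolding supertab_def o_apply by presburger
  qed
  have cont: "entries X (f \<circ> T) = image_mset f (entries X T)" for T
    by (simp add: entries_def multiset.map_comp)
  have "bij_betw ((\<circ>) f) {T. supertab E X T \<and> entries X T = M}
      {T. supertab E' X T \<and> entries X T = image_mset f M}"
  proof (rule bij_betw_imageI)
    show "inj_on ((\<circ>) f) {T. supertab E X T \<and> entries X T = M}"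
      by (rule inj_on_subset[OF fun.inj_map[OF inj] subset_UNIV])
    show "(\<circ>) f ` {T. supertab E X T \<and> entries X T = M} =
        {T. supertab E' X T \<and> entries X T = image_mset f M}"
    proof (intro equalityI subsetI)
      fix T assume "T \<in> (\<circ>) f ` {T. supertab E X T \<and> entries X T = M}"
      then show "T \<in> {T. supertab E' X T \<and> entries X T = image_mset f M}"
        using tab cont by auto
    next
      fix T assume T: "T \<in> {T. supertab E' X T \<and> entries X T = image_mset f M}"
      have "T c \<in> range f" for c
      proof (cases "c \<in> X")
        case True
        then have "T c \<in># entries X T" using X by simp
        then show ?thesis using T by auto
      next
        case False
        then have "T c = f 0" using T f(2) supertab_outside by fastforce
        then show ?thesis by simp
      qed
      then have T': "T = f \<circ> (inv f \<circ> T)" by (auto simp: fun_eq_iff f_inv_into_f)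
      then have "supertab E X (inv f \<circ> T)" using T tab by (metis mem_Collect_eq)
      moreover have "entries X (inv f \<circ> T) = M"
      proof -
        have "image_mset (inv f) (entries X T) = M"
          using T inj by (simp add: multiset.map_comp)
        then show ?thesis by (simp add: entries_def multiset.map_comp)
      qed
      ultimately show "T \<in> (\<circ>) f ` {T. supertab E X T \<and> entries X T = M}"
        using T' by blast
    qed
  qed
  then show ?thesis by (simp add: scount_def bij_betw_same_card)
qed

section \<open>A sign-reversing involution on two consecutive letters of different parity\<close>

lemma entries_update:
  assumes "finite X" "c \<in> X"
  shows "entries X (T(c := v)) = entries X T - {#T c#} + {#v#}"
proof -
  have X: "mset_set X = add_mset c (mset_set (X - {c}))"
    using assms by (metis mset_set.remove)
  have "image_mset (T(c := v)) (mset_set (X - {c})) = image_mset T (mset_set (X - {c}))"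
    using assms by (intro image_mset_cong) auto
  then show ?thesis by (simp add: entries_def X)
qed

text \<open>In the topmost row that contains \<open>e\<close> or \<open>Suc e\<close>, these letters
  form a run of \<open>e\<close> closed by at most one \<open>Suc e\<close>. The last cell of the
  run may carry either letter: everything to its right is larger, everything above it is smaller
  than \<open>e\<close>, and everything below it is at least \<open>Suc e\<close>, which may repeat
  in a column.\<close>

lemma supertab_toggle:
  assumes T: "supertab E X T" and E: "E e" "\<not> E (Suc e)" "e > 0"
    and x: "(i0, j0) \<in> X" "T (i0, j0) \<in> {e, Suc e}" "v \<in> {e, Suc e}"
    and top: "\<And>i j. (i, j) \<in> X \<Longrightarrow> T (i, j) \<in> {e, Suc e} \<Longrightarrow> i0 \<le> i"
    and right: "\<And>j. (i0, j) \<in> X \<Longrightarrow> T (i0, j) \<in> {e, Suc e} \<Longrightarrow> j \<le> j0"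
  shows "supertab E X (T((i0, j0) := v))"
proof -
  let ?T = "T((i0, j0) := v)"
  have r: "row_le E (T (i, j)) (T (i, j'))" if "(i, j) \<in> X" "(i, j') \<in> X" "j < j'" for i j j'
    using supertab_row[OF T] that by blast
  have c: "col_le E (T (i, j)) (T (i', j))" if "(i, j) \<in> X" "(i', j) \<in> X" "i < i'" for i i' j
    using supertab_col[OF T] that by blast
  have "row_le E (?T (i, j)) (?T (i, j'))" if that: "(i, j) \<in> X" "(i, j') \<in> X" "j < j'" for i j j'
  proof -
    consider "(i, j) = (i0, j0)" | "(i, j') = (i0, j0)" | "(i, j) \<noteq> (i0, j0)" "(i, j') \<noteq> (i0, j0)"
      by blast
    then show ?thesis
    proof cases
      case 1
      then show ?thesis using r[OF that] right[of j'] that x(2,3) by (auto simp: row_le_def)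
    next
      case 2
      then show ?thesis using r[OF that] that x(2,3) E by (auto simp: row_le_def less_Suc_eq)
    next
      case 3
      then show ?thesis using r[OF that] by auto
    qed
  qed
  moreover have "col_le E (?T (i, j)) (?T (i', j))" if that: "(i, j) \<in> X" "(i', j) \<in> X" "i < i'" for i i' j
  proof -
    consider "(i, j) = (i0, j0)" | "(i', j) = (i0, j0)" | "(i, j) \<noteq> (i0, j0)" "(i', j) \<noteq> (i0, j0)"
      by blast
    then show ?thesis
    proof cases
      case 1
      then show ?thesis using c[OF that] that x(2,3) E by (auto simp: col_le_def Suc_lessI)
    next
      case 2
      then show ?thesis using c[OF that] top[of i j] that x(2,3) by (auto simp: col_le_def less_Suc_eq)
    next
      case 3
      then show ?thesis using c[OF that] by auto
    qed
  qed
  moreover have "?T c > 0" if "c \<in> X" for c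
    using supertab_pos[OF T that] E(3) x(3) by auto
  moreover have "?T c = 0" if "c \<notin> X" for c
    using supertab_outside[OF T that] that x(1) by auto
  ultimately show ?thesis by (intro supertabI)
qed

text \<open>The identity \<open>\<Sum>\<^sub>k (-1)^k h\<^sub>k e\<^sub>n\<^sub>-\<^sub>k = 0\<close>: the involution changes the rightmost entry of the
  topmost row that contains one of the two letters.\<close>

lemma scount_toggle_sum:
  assumes X: "finite X" and E: "E e" "\<not> E (Suc e)" "e > 0"
    and M: "e \<notin># M" "Suc e \<notin># M" and n: "n > 0"
  shows "(\<Sum>k\<le>n. (-1) ^ k * scount E X (M + replicate_mset k e + replicate_mset (n - k) (Suc e))) = 0"
proof -
  let ?M = "\<lambda>k. M + replicate_mset k e + replicate_mset (n - k) (Suc e)"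
  let ?A = "\<lambda>k. {T. supertab E X T \<and> entries X T = ?M k}"
  let ?S = "\<Union>k\<in>{..n}. ?A k"
  let ?sg = "\<lambda>T. (-1 :: int) ^ count (entries X T) e"
  define \<theta> where "\<theta> T = {c \<in> X. T c \<in> {e, Suc e}}" for T :: "nat \<times> nat \<Rightarrow> nat"
  define sel where "sel \<theta> = (let i = Min (fst ` \<theta>) in (i, Max {j. (i, j) \<in> \<theta>}))" for \<theta> :: diagram
  define tog where "tog T = T(sel (\<theta> T) := (if T (sel (\<theta> T)) = e then Suc e else e))" for T
  have cM: "count (?M k) e = k" "count (?M k) (Suc e) = n - k" for k
    using M by (auto simp: not_in_iff)
  have sel: "sel t \<in> t \<and> (\<forall>(i, j) \<in> t. fst (sel t) \<le> i) \<and> (\<forall>j. (fst (sel t), j) \<in> t \<longrightarrow> j \<le> snd (sel t))"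
    if t: "finite t" "t \<noteq> {}" for t
  proof -
    let ?i = "Min (fst ` t)"
    have "?i \<in> fst ` t" using t by simp
    then have ne: "{j. (?i, j) \<in> t} \<noteq> {}" by force
    have "{j. (?i, j) \<in> t} \<subseteq> snd ` t" by force
    then have fin: "finite {j. (?i, j) \<in> t}" using t(1) finite_surj by blast
    have "Max {j. (?i, j) \<in> t} \<in> {j. (?i, j) \<in> t}" using ne fin by (rule Max_in[rotated])
    moreover have "?i \<le> i" if "(i, j) \<in> t" for i j
      using t(1) that by (intro Min_le) force+
    ultimately show ?thesis using fin by (auto simp: sel_def Let_def)
  qed
  have ne: "\<theta> T \<noteq> {}" "finite (\<theta> T)" if T: "T \<in> ?S" for T
  proof -
    obtain k where k: "entries X T = ?M k" "k \<le> n" using T by blast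
    have "e \<in># ?M k \<or> Suc e \<in># ?M k"
      using cM[of k] n k(2) by (metis add.right_neutral count_eq_zero_iff diff_zero less_irrefl)
    then have "e \<in> T ` X \<or> Suc e \<in> T ` X" using k(1) X by (metis set_entries)
    then obtain c where "c \<in> X" "T c \<in> {e, Suc e}" by auto
    then show "\<theta> T \<noteq> {}" unfolding \<theta>_def by blast
    show "finite (\<theta> T)" using X by (simp add: \<theta>_def)
  qed
  have inS: "sel (\<theta> T) \<in> X" "T (sel (\<theta> T)) \<in> {e, Suc e}" if "T \<in> ?S" for T
    using sel[OF ne(2,1)[OF that]] by (auto simp: \<theta>_def)
  \<comment> \<open>The cells carrying one of the two letters stay the same, so a second application
    selects the same cell and undoes the first.\<close>
  have same: "\<theta> (tog T) = \<theta> T" if "T \<in> ?S" for T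
    using inS[OF that] by (auto simp: \<theta>_def tog_def)
  have tog2: "tog (tog T) = T" if "T \<in> ?S" for T
  proof -
    have "T (sel (\<theta> T)) = e \<or> T (sel (\<theta> T)) = Suc e" using inS(2)[OF that] by auto
    then show ?thesis unfolding tog_def[of "tog T"] same[OF that] by (auto simp: tog_def fun_eq_iff)
  qed
  have tab: "supertab E X (tog T)" if "T \<in> ?S" for T
  proof -
    obtain i0 j0 where s: "sel (\<theta> T) = (i0, j0)" by fastforce
    have "supertab E X T" using that by auto
    moreover have "i0 \<le> i" if "(i, j) \<in> X" "T (i, j) \<in> {e, Suc e}" for i j
      using sel[OF ne(2,1)[OF \<open>T \<in> ?S\<close>]] s that by (auto simp: \<theta>_def)
    moreover have "j \<le> j0" if "(i0, j) \<in> X" "T (i0, j) \<in> {e, Suc e}" for j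
      using sel[OF ne(2,1)[OF \<open>T \<in> ?S\<close>]] s that by (auto simp: \<theta>_def)
    ultimately show ?thesis
      unfolding tog_def s using supertab_toggle[OF _ E] inS[OF that] unfolding s by simp
  qed
  have togS: "tog T \<in> ?S \<and> ?sg (tog T) = - ?sg T" if T: "T \<in> ?S" for T
  proof -
    obtain k where k: "entries X T = ?M k" "k \<le> n" using T by blast
    have cu: "entries X (tog T) = ?M k - {#T (sel (\<theta> T))#} + {#if T (sel (\<theta> T)) = e then Suc e else e#}"
      unfolding tog_def using entries_update[OF X inS(1)[OF T]] k(1) by simp
    have mem: "T (sel (\<theta> T)) \<in># ?M k" using k(1) inS(1)[OF T] X by (metis image_eqI set_entries)
    show ?thesis
    proof (cases "T (sel (\<theta> T)) = e")
      case True
      then have "k > 0" using mem cM(1)[of k] by (metis count_greater_zero_iff)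
      then obtain k' where k': "k = Suc k'" by (cases k) auto
      have "entries X (tog T) = ?M k'"
        using True k(2) unfolding cu k' by (simp add: Suc_diff_Suc[symmetric])
      then show ?thesis using tab[OF T] k(1,2) k' cM by auto
    next
      case False
      then have Te: "T (sel (\<theta> T)) = Suc e" using inS(2)[OF T] by simp
      then have "n - k > 0" using mem cM(2)[of k] by (metis count_greater_zero_iff)
      then obtain m where m: "n - k = Suc m" by (cases "n - k") auto
      then have m': "n - Suc k = m" "Suc k \<le> n" by auto
      have cT: "entries X (tog T) = ?M (Suc k)"
        using Te unfolding cu m m' by simp
      then have "tog T \<in> ?S"
        using tab[OF T] m'(2) by (intro UN_I[of "Suc k"]) simp_all
      moreover have "?sg (tog T) = - ?sg T"
        unfolding cT k(1) cM by simp
      ultimately show ?thesis by blast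
    qed
  qed
  have bij: "bij_betw tog ?S ?S"
    by (rule bij_betw_byWitness[where f' = tog]) (use togS tog2 in auto)
  have "(\<Sum>T\<in>?S. ?sg T) = (\<Sum>T\<in>?S. ?sg (tog T))"
    using sum.reindex_bij_betw[OF bij, of ?sg] by simp
  also have "\<dots> = - (\<Sum>T\<in>?S. ?sg T)"
    unfolding sum_negf[symmetric] by (intro sum.cong refl) (use togS in blast)
  finally have zero: "(\<Sum>T\<in>?S. ?sg T) = 0" by simp
  have "(\<Sum>T\<in>?S. ?sg T) = (\<Sum>k\<le>n. \<Sum>T\<in>?A k. ?sg T)"
  proof (rule sum.UNION_disjoint)
    show "\<forall>k\<in>{..n}. finite (?A k)" using finite_supertab_entries[OF X] by blast
    show "\<forall>k\<in>{..n}. \<forall>k'\<in>{..n}. k \<noteq> k' \<longrightarrow> ?A k \<inter> ?A k' = {}"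
    proof (intro ballI impI equals0I)
      fix k k' T assume "k \<noteq> k'" "T \<in> ?A k \<inter> ?A k'"
      then have "entries X T = ?M k \<and> entries X T = ?M k'" by blast
      then have "entries X T = ?M k" "entries X T = ?M k'" by blast+
      then have "?M k = ?M k'" by (rule trans[OF sym])
      from arg_cong[OF this, of "\<lambda>M. count M e"] show False
        unfolding cM using \<open>k \<noteq> k'\<close> by simp
    qed
  qed simp
  also have "\<dots> = (\<Sum>k\<le>n. (-1) ^ k * scount E X (?M k))"
  proof (rule sum.cong[OF refl])
    fix k assume "k \<in> {..n}"
    have "(\<Sum>T\<in>?A k. ?sg T) = (\<Sum>T\<in>?A k. (-1) ^ k)"
      by (rule sum.cong[OF refl]) (use cM in auto)
    then show "(\<Sum>T\<in>?A k. ?sg T) = (-1) ^ k * scount E X (?M k)"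
      by (simp add: scount_def)
  qed
  finally show ?thesis using zero by simp
qed

text \<open>Superization: an odd letter with \<open>n\<close> copies is traded for an even letter and fewer copies
  of the odd one.\<close>

lemma scount_transfer:
  assumes fin: "finite X" "finite Y" "finite Z"
    and even: "\<And>M. scount (\<lambda>_. True) X M - scount (\<lambda>_. True) Y M = scount (\<lambda>_. True) Z M"
  shows "scount E X M - scount E Y M = scount E Z M"
proof -
  define D where "D E M = scount E X M - scount E Y M - scount E Z M" for E M
  have "D E M = 0"
  \<comment> \<open>The induction is on the number of odd entries in the content; the parity
    function has to vary, since each step changes the alphabet.\<close>
  proof (induction "size {#l \<in># M. \<not> E l#}" arbitrary: E M rule: less_induct)
    case less
    show ?case
    proof (cases "0 \<in># M \<or> (\<forall>l\<in>#M. E l)")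
      case True
      then show ?thesis
      proof
        assume "\<forall>l\<in>#M. E l"
        then have "scount E W M = scount (\<lambda>_. True) W M" if "finite W" for W
          using that by (intro scount_cong) auto
        then show ?thesis using fin even by (simp add: D_def)
      qed (simp add: D_def scount_zero_letter fin)
    next
      case False
      then obtain e where e: "e \<in># M" "\<not> E e" "e > 0" using gr0I by fastforce
      \<comment> \<open>Letters from \<open>e\<close> on move up by one. The value \<open>e\<close>
        becomes a new even letter directly before the old odd one, which is now
        \<open>Suc e\<close>.\<close>
      define f where "f x = (if x < e then x else Suc x)" for x :: nat
      define E' where "E' y = (if y < e then E y else if y = e then True else E (y - 1))" for y
      define n where "n = count M e"
      define M0 where "M0 = image_mset f {#l \<in># M. l \<noteq> e#}"
      let ?M = "\<lambda>k. M0 + replicate_mset k e + replicate_mset (n - k) (Suc e)"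
      have n: "n > 0" using e(1) by (simp add: n_def)
      have mono: "strict_mono f" by (auto simp: strict_mono_def f_def)
      have f0: "f 0 = 0" using e(3) by (simp add: f_def)
      have Ef: "E' (f l) = E l" for l by (simp add: E'_def f_def)
      have Mf: "image_mset f M = ?M 0"
      proof -
        have "M = {#l \<in># M. l \<noteq> e#} + replicate_mset n e"
          by (metis (full_types) filter_eq_replicate_mset multiset_partition n_def union_commute)
        then have "image_mset f M = M0 + replicate_mset n (f e)"
          by (metis M0_def image_mset_union image_replicate_mset)
        then show ?thesis by (simp add: f_def)
      qed
      have notin: "e \<notin># M0" "Suc e \<notin># M0"
        by (auto simp: M0_def f_def)
      have E'e: "E' e" "\<not> E' (Suc e)" using e by (auto simp: E'_def)
      have DM: "D E M = D E' (?M 0)"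
        unfolding Mf[symmetric] D_def using scount_relabel[OF _ mono f0, of _ E' E] fin Ef by simp
      have odd: "size {#l \<in># ?M k. \<not> E' l#} = size {#l \<in># M0. \<not> E' l#} + (n - k)" for k
        using E'e by (simp add: filter_replicate_mset)
      have size: "size {#l \<in># M. \<not> E l#} = size {#l \<in># ?M 0. \<not> E' l#}"
        unfolding Mf[symmetric] by (simp add: filter_mset_image_mset Ef)
      \<comment> \<open>For \<open>k > 0\<close> the content has \<open>k\<close> odd entries fewer,
        so the induction hypothesis applies, and the alternating sum leaves only the term
        \<open>k = 0\<close>, which is the claim.\<close>
      have rest: "D E' (?M k) = 0" if "k \<in> {1..n}" for k
        using that unfolding size by (intro less) (auto simp: filter_replicate_mset E'e size)
      have z: "(\<Sum>k\<le>n. (-1) ^ k * scount E' W (?M k)) = 0" if "finite W" for W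
        using scount_toggle_sum[OF that E'e e(3) notin n] .
      have "(\<Sum>k\<le>n. (-1) ^ k * D E' (?M k)) = 0"
        using z[OF fin(1)] z[OF fin(2)] z[OF fin(3)]
        by (simp add: D_def right_diff_distrib sum_subtractf)
      moreover have "(\<Sum>k\<le>n. (-1) ^ k * D E' (?M k)) = D E' (?M 0) + (\<Sum>k\<in>{1..n}. (-1) ^ k * D E' (?M k))"
        by (simp add: sum.atMost_shift sum.atLeast1_atMost_eq lessThan_atLeast0 atLeastLessThanSuc_atLeastAtMost flip: atLeast0LessThan)
      ultimately show ?thesis using DM rest by simp
    qed
  qed
  then show ?thesis by (simp add: D_def)
qed

section \<open>Evaluations and ribbons\<close>

definition tabs :: "(nat \<Rightarrow> bool) \<Rightarrow> nat set \<Rightarrow> diagram \<Rightarrow> (nat \<times> nat \<Rightarrow> nat) set" where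
  "tabs E L X = {T. supertab E X T \<and> T ` X \<subseteq> L}"

definition wt :: "(nat \<Rightarrow> 'a :: comm_ring_1) \<Rightarrow> diagram \<Rightarrow> (nat \<times> nat \<Rightarrow> nat) \<Rightarrow> 'a" where
  "wt x X T = (\<Prod>c\<in>X. x (T c))"

definition ev :: "(nat \<Rightarrow> bool) \<Rightarrow> nat set \<Rightarrow> (nat \<Rightarrow> 'a :: comm_ring_1) \<Rightarrow> diagram \<Rightarrow> 'a" where
  "ev E L x X = (\<Sum>T\<in>tabs E L X. wt x X T)"

text \<open>Ribbons are glued at a single pair of neighbouring cells, so the distribution of the
  letter in one cell is all that must be remembered of a part.\<close>

definition evat ::
  "(nat \<Rightarrow> bool) \<Rightarrow> nat set \<Rightarrow> (nat \<Rightarrow> 'a :: comm_ring_1) \<Rightarrow> diagram \<Rightarrow> nat \<times> nat \<Rightarrow> nat \<Rightarrow> 'a" where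
  "evat E L x X p v = (\<Sum>T\<in>tabs E L X. if T p = v then wt x X T else 0)"

lemma finite_tabs: "finite X \<Longrightarrow> finite L \<Longrightarrow> finite (tabs E L X)"
  unfolding tabs_def by (rule finite_fillings)

text \<open>The set \<open>C\<close> may exceed the contents that occur; this lets three diagrams be
  expanded over one common index set.\<close>

lemma ev_scount:
  assumes "finite X" "finite L" "finite C" "entries X ` tabs E L X \<subseteq> C" "\<And>M. M \<in> C \<Longrightarrow> set_mset M \<subseteq> L"
  shows "ev E L x X = (\<Sum>M\<in>C. of_int (scount E X M) * prod_mset (image_mset x M))"
proof -
  have "ev E L x X = (\<Sum>M\<in>C. \<Sum>T\<in>{T \<in> tabs E L X. entries X T = M}. wt x X T)"
    unfolding ev_def using sum.group[OF finite_tabs[OF assms(1,2)] assms(3,4), of "wt x X"] by simp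
  also have "\<dots> = (\<Sum>M\<in>C. of_int (scount E X M) * prod_mset (image_mset x M))"
  proof (rule sum.cong[OF refl])
    fix M assume M: "M \<in> C"
    have "{T \<in> tabs E L X. entries X T = M} = {T. supertab E X T \<and> entries X T = M}"
      using assms(5)[OF M] assms(1) by (auto simp: tabs_def)
    moreover have "wt x X T = prod_mset (image_mset x M)" if "entries X T = M" for T
      using that by (auto simp: wt_def entries_def prod_unfold_prod_mset multiset.map_comp o_def)
    ultimately show "(\<Sum>T\<in>{T \<in> tabs E L X. entries X T = M}. wt x X T) =
        of_int (scount E X M) * prod_mset (image_mset x M)"
      by (simp add: scount_def)
  qed
  finally show ?thesis .
qed

lemma ev_transfer:
  assumes fin: "finite X" "finite Y" "finite Z" "finite L"
    and diff: "\<And>M. tableau_series X M - tableau_series Y M = tableau_series Z M"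
  shows "ev E L x X - ev E L x Y = ev E L x Z"
proof -
  let ?C = "\<Union>W\<in>{X, Y, Z}. entries W ` tabs E L W"
  have C: "finite ?C" using fin by (auto intro: finite_tabs)
  have CL: "set_mset M \<subseteq> L" if "M \<in> ?C" for M
    using that fin by (auto simp: tabs_def)
  have e: "ev E L x W = (\<Sum>M\<in>?C. of_int (scount E W M) * prod_mset (image_mset x M))"
    if "W \<in> {X, Y, Z}" for W
    by (rule ev_scount) (use that fin C CL in auto)
  have "scount E X M - scount E Y M = scount E Z M" for M
    using scount_transfer[OF fin(1-3)] diff by (simp add: tableau_series_scount)
  then have "of_int (scount E Z M) = (of_int (scount E X M) - of_int (scount E Y M) :: 'a)" for M
    by (metis of_int_diff)
  then show ?thesis
    by (simp add: e left_diff_distrib sum_subtractf)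
qed

section \<open>Gluing tableaux on disjoint diagrams\<close>

lemma supertab_union_iff:
  assumes "X \<inter> Y = {}" "supertab E X T1" "supertab E Y T2"
  shows "supertab E (X \<union> Y) (\<lambda>c. T1 c + T2 c) \<longleftrightarrow>
    (\<forall>i j j'. (i, j) \<in> X \<longrightarrow> (i, j') \<in> Y \<longrightarrow>
      (j < j' \<longrightarrow> row_le E (T1 (i, j)) (T2 (i, j'))) \<and> (j' < j \<longrightarrow> row_le E (T2 (i, j')) (T1 (i, j)))) \<and>
    (\<forall>i i' j. (i, j) \<in> X \<longrightarrow> (i', j) \<in> Y \<longrightarrow>
      (i < i' \<longrightarrow> col_le E (T1 (i, j)) (T2 (i', j))) \<and> (i' < i \<longrightarrow> col_le E (T2 (i', j)) (T1 (i, j))))"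
    (is "?l \<longleftrightarrow> ?r")
proof -
  have X: "T1 c + T2 c = T1 c" if "c \<in> X" for c
    using supertab_outside[OF assms(3), of c] assms(1) that by auto
  have Y: "T1 c + T2 c = T2 c" if "c \<in> Y" for c
    using supertab_outside[OF assms(2), of c] assms(1) that by auto
  show ?thesis
  proof
    assume l: ?l
    show ?r
    proof (intro conjI allI impI)
      fix i j j' assume "(i, j) \<in> X" "(i, j') \<in> Y" "j < j'"
      then show "row_le E (T1 (i, j)) (T2 (i, j'))" using supertab_row[OF l, of i j j'] X Y by simp
    next
      fix i j j' assume "(i, j) \<in> X" "(i, j') \<in> Y" "j' < j"
      then show "row_le E (T2 (i, j')) (T1 (i, j))" using supertab_row[OF l, of i j' j] X Y by simp
    next
      fix i i' j assume "(i, j) \<in> X" "(i', j) \<in> Y" "i < i'"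
      then show "col_le E (T1 (i, j)) (T2 (i', j))" using supertab_col[OF l, of i j i'] X Y by simp
    next
      fix i i' j assume "(i, j) \<in> X" "(i', j) \<in> Y" "i' < i"
      then show "col_le E (T2 (i', j)) (T1 (i, j))" using supertab_col[OF l, of i' j i] X Y by simp
    qed
  next
    assume r: ?r
    show ?l
    proof (rule supertabI)
      fix c assume "c \<in> X \<union> Y"
      then show "0 < T1 c + T2 c"
        using supertab_pos[OF assms(2), of c] supertab_pos[OF assms(3), of c] by fastforce
    next
      fix c assume "c \<notin> X \<union> Y"
      then show "T1 c + T2 c = 0"
        using supertab_outside[OF assms(2), of c] supertab_outside[OF assms(3), of c] by auto
    next
      fix i j j' assume a: "(i, j) \<in> X \<union> Y" "(i, j') \<in> X \<union> Y" "j < j'"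
      show "row_le E (T1 (i, j) + T2 (i, j)) (T1 (i, j') + T2 (i, j'))"
        using a r X Y supertab_row[OF assms(2)] supertab_row[OF assms(3)] by (elim UnE) simp_all
    next
      fix i i' j assume a: "(i, j) \<in> X \<union> Y" "(i', j) \<in> X \<union> Y" "i < i'"
      show "col_le E (T1 (i, j) + T2 (i, j)) (T1 (i', j) + T2 (i', j))"
        using a r X Y supertab_col[OF assms(2)] supertab_col[OF assms(3)] by (elim UnE) simp_all
    qed
  qed
qed

text \<open>Fillings vanish outside their diagrams, so restriction to the two parts and pointwise
  addition are inverse to each other.\<close>

lemma sum_tabs_union:
  fixes x :: "nat \<Rightarrow> 'a :: comm_ring_1"
  assumes fin: "finite X" "finite Y" "finite L" and disj: "X \<inter> Y = {}"
  shows "(\<Sum>T\<in>tabs E L (X \<union> Y). wt x (X \<union> Y) T * F T) =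
    (\<Sum>T1\<in>tabs E L X. \<Sum>T2\<in>tabs E L Y.
      if supertab E (X \<union> Y) (\<lambda>c. T1 c + T2 c) then wt x X T1 * wt x Y T2 * F (\<lambda>c. T1 c + T2 c) else 0)"
proof -
  let ?S = "{p \<in> tabs E L X \<times> tabs E L Y. supertab E (X \<union> Y) (\<lambda>c. fst p c + snd p c)}"
  define res where "res W T c = (if c \<in> W then T c else 0)" for W :: diagram and T :: "nat \<times> nat \<Rightarrow> nat" and c
  have out: "T1 c = 0" if "T1 \<in> tabs E L W" "c \<notin> W" for T1 c W
    using that by (auto simp: tabs_def dest: supertab_outside)
  have res_tab: "res W T \<in> tabs E L W" if "T \<in> tabs E L (X \<union> Y)" "W \<subseteq> X \<union> Y" for W T
    using that unfolding tabs_def supertab_def res_def by (auto simp: subset_iff)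
  have res_sum: "(\<lambda>c. res X T c + res Y T c) = T" if "T \<in> tabs E L (X \<union> Y)" for T
    using that disj out[of T "X \<union> Y"] by (auto simp: res_def fun_eq_iff)
  have wt: "wt x (X \<union> Y) (\<lambda>c. T1 c + T2 c) = wt x X T1 * wt x Y T2"
    if "T1 \<in> tabs E L X" "T2 \<in> tabs E L Y" for T1 T2
  proof -
    have "wt x (X \<union> Y) (\<lambda>c. T1 c + T2 c) = wt x X (\<lambda>c. T1 c + T2 c) * wt x Y (\<lambda>c. T1 c + T2 c)"
      unfolding wt_def using fin disj by (intro prod.union_disjoint)
    also have "wt x X (\<lambda>c. T1 c + T2 c) = wt x X T1"
      unfolding wt_def using disj by (intro prod.cong refl) (metis (full_types) add_0_right disjoint_iff out that(2))
    also have "wt x Y (\<lambda>c. T1 c + T2 c) = wt x Y T2"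
      unfolding wt_def using disj by (intro prod.cong refl) (metis (full_types) add_0 disjoint_iff out that(1))
    finally show ?thesis .
  qed
  have "(\<Sum>T\<in>tabs E L (X \<union> Y). wt x (X \<union> Y) T * F T) =
      (\<Sum>p\<in>?S. wt x X (fst p) * wt x Y (snd p) * F (\<lambda>c. fst p c + snd p c))"
  proof (rule sum.reindex_bij_witness[of _ "\<lambda>p c. fst p c + snd p c" "\<lambda>T. (res X T, res Y T)"])
    fix T assume T: "T \<in> tabs E L (X \<union> Y)"
    show "(\<lambda>c. fst (res X T, res Y T) c + snd (res X T, res Y T) c) = T"
      using res_sum[OF T] by simp
    show "(res X T, res Y T) \<in> ?S"
      using res_tab[OF T] res_sum[OF T] T by (auto simp: tabs_def)
    show "wt x X (fst (res X T, res Y T)) * wt x Y (snd (res X T, res Y T)) *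
        F (\<lambda>c. fst (res X T, res Y T) c + snd (res X T, res Y T) c) = wt x (X \<union> Y) T * F T"
      using wt[OF res_tab[OF T] res_tab[OF T]] res_sum[OF T] by simp
  next
    fix p assume p: "p \<in> ?S"
    obtain T1 T2 where p': "p = (T1, T2)" by (cases p)
    have T: "T1 \<in> tabs E L X" "T2 \<in> tabs E L Y" using p p' by auto
    have "res X (\<lambda>c. T1 c + T2 c) c = T1 c" "res Y (\<lambda>c. T1 c + T2 c) c = T2 c" for c
      using out[OF T(1), of c] out[OF T(2), of c] disj by (auto simp: res_def)
    then have "res X (\<lambda>c. T1 c + T2 c) = T1" "res Y (\<lambda>c. T1 c + T2 c) = T2"
      by blast+
    then show "(res X (\<lambda>c. fst p c + snd p c), res Y (\<lambda>c. fst p c + snd p c)) = p"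
      by (simp add: p')
    have "T1 c + T2 c \<in> L" if "c \<in> X \<union> Y" for c
    proof (cases "c \<in> X")
      case True
      then have "T2 c = 0" using out[OF T(2)] disj by blast
      then show ?thesis using T(1) True by (auto simp: tabs_def)
    next
      case False
      then show ?thesis using T(2) that out[OF T(1), of c] by (auto simp: tabs_def)
    qed
    then show "(\<lambda>c. fst p c + snd p c) \<in> tabs E L (X \<union> Y)"
      using p by (auto simp: tabs_def p')
  qed
  also have "\<dots> = (\<Sum>p\<in>tabs E L X \<times> tabs E L Y. if supertab E (X \<union> Y) (\<lambda>c. fst p c + snd p c)
      then wt x X (fst p) * wt x Y (snd p) * F (\<lambda>c. fst p c + snd p c) else 0)"
    using fin by (intro sum.inter_filter) (auto intro: finite_tabs)
  also have "\<dots> = (\<Sum>T1\<in>tabs E L X. \<Sum>T2\<in>tabs E L Y.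
      if supertab E (X \<union> Y) (\<lambda>c. T1 c + T2 c) then wt x X T1 * wt x Y T2 * F (\<lambda>c. T1 c + T2 c) else 0)"
    by (simp add: sum.cartesian_product case_prod_unfold)
  finally show ?thesis .
qed

lemma sum_tabs_at:
  fixes x :: "nat \<Rightarrow> 'a :: comm_ring_1"
  assumes "finite X" "finite L" "p \<in> X"
  shows "(\<Sum>T\<in>tabs E L X. wt x X T * G (T p)) = (\<Sum>v\<in>L. evat E L x X p v * G v)"
proof -
  have "(\<Sum>v\<in>L. evat E L x X p v * G v) =
      (\<Sum>T\<in>tabs E L X. \<Sum>v\<in>L. if T p = v then wt x X T * G v else 0)"
    unfolding evat_def sum_distrib_right
    by (subst sum.swap) (intro sum.cong refl, simp)
  also have "\<dots> = (\<Sum>T\<in>tabs E L X. wt x X T * G (T p))"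
    using assms by (intro sum.cong refl) (auto simp: tabs_def sum.delta)
  finally show ?thesis ..
qed

lemma ev_evat:
  assumes "finite X" "finite L" "p \<in> X"
  shows "ev E L x X = (\<Sum>v\<in>L. evat E L x X p v)"
  using sum_tabs_at[OF assms, where G = "\<lambda>_. 1" and E = E and x = x] by (simp add: ev_def)

text \<open>If the parts interact through one pair of cells only, the sum is a bilinear form in the
  letter distributions at these cells. The factor \<open>G\<close> permits reading off the
  distribution at \<open>q\<close> in the union again, which inductions on the diagram need.\<close>

lemma sum_tabs_glue:
  fixes x :: "nat \<Rightarrow> 'a :: comm_ring_1"
  assumes fin: "finite X" "finite Y" "finite L" and disj: "X \<inter> Y = {}" and pq: "p \<in> X" "q \<in> Y"
    and R: "\<And>T1 T2. supertab E X T1 \<Longrightarrow> supertab E Y T2 \<Longrightarrow>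
      supertab E (X \<union> Y) (\<lambda>c. T1 c + T2 c) \<longleftrightarrow> R (T1 p) (T2 q)"
  shows "(\<Sum>T\<in>tabs E L (X \<union> Y). wt x (X \<union> Y) T * G (T q)) =
    (\<Sum>v\<in>L. \<Sum>v'\<in>L. if R v v' then evat E L x X p v * evat E L x Y q v' * G v' else 0)"
proof -
  have q: "T1 q + T2 q = T2 q" if "T1 \<in> tabs E L X" for T1 T2
    using that disj pq supertab_outside[of E X T1 q] by (auto simp: tabs_def)
  have "(\<Sum>T\<in>tabs E L (X \<union> Y). wt x (X \<union> Y) T * G (T q)) =
      (\<Sum>T1\<in>tabs E L X. wt x X T1 * (\<Sum>T2\<in>tabs E L Y. wt x Y T2 * (if R (T1 p) (T2 q) then G (T2 q) else 0)))"
    unfolding sum_tabs_union[OF fin disj] sum_distrib_left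
    by (intro sum.cong refl) (auto simp: tabs_def q R)
  also have "\<dots> = (\<Sum>T1\<in>tabs E L X. wt x X T1 *
      (\<Sum>v'\<in>L. evat E L x Y q v' * (if R (T1 p) v' then G v' else 0)))"
    by (intro sum.cong refl arg_cong2[of _ _ _ _ "(*)"] sum_tabs_at[OF fin(2,3) pq(2)])
  also have "\<dots> = (\<Sum>v\<in>L. evat E L x X p v * (\<Sum>v'\<in>L. evat E L x Y q v' * (if R v v' then G v' else 0)))"
    by (rule sum_tabs_at[OF fin(1,3) pq(1)])
  also have "\<dots> = (\<Sum>v\<in>L. \<Sum>v'\<in>L. if R v v' then evat E L x X p v * evat E L x Y q v' * G v' else 0)"
    unfolding sum_distrib_left by (intro sum.cong refl) (simp add: mult.assoc)
  finally show ?thesis .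
qed

text \<open>The conditions on tableaux refer only to the order of the coordinates. Two choices of
  \<open>F\<close> give translation invariance of \<open>ev\<close> and of
  \<open>evat\<close>.\<close>

lemma sum_tabs_map:
  fixes x :: "nat \<Rightarrow> 'a :: comm_ring_1"
  assumes f: "strict_mono f" and g: "strict_mono g"
  shows "(\<Sum>T\<in>tabs E L (map_prod f g ` X). wt x (map_prod f g ` X) T * F (T \<circ> map_prod f g)) =
    (\<Sum>T\<in>tabs E L X. wt x X T * F T)"
proof -
  let ?h = "map_prod f g"
  have inj: "inj ?h" using f g by (intro prod.inj_map strict_mono_imp_inj_on)
  have fl: "f i < f i' \<longleftrightarrow> i < i'" "f i = f i' \<longleftrightarrow> i = i'" for i i'
    using strict_mono_less[OF f] strict_mono_eq[OF f] by auto
  have gl: "g i < g i' \<longleftrightarrow> i < i'" "g i = g i' \<longleftrightarrow> i = i'" for i i'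
    using strict_mono_less[OF g] strict_mono_eq[OF g] by auto
  define ext where "ext T c = (if c \<in> ?h ` X then T (inv ?h c) else 0)" for T :: "nat \<times> nat \<Rightarrow> nat" and c
  have ext: "ext T (?h c) = T c" if "supertab E X T" for T c
    using supertab_outside[OF that] inj by (auto simp: ext_def inj_image_mem_iff)
  have hi: "(f i, g j) = ?h (i, j)" for i j by simp
  show ?thesis
  proof (rule sum.reindex_bij_witness[of _ ext "\<lambda>T. T \<circ> ?h"])
    fix T assume T: "T \<in> tabs E L (?h ` X)"
    then have s: "supertab E (?h ` X) T" by (simp add: tabs_def)
    have "ext (T \<circ> ?h) c = T c" for c
    proof (cases "c \<in> ?h ` X")
      case True
      then have "?h (inv ?h c) = c" by (intro f_inv_into_f) blast
      then show ?thesis using True by (simp add: ext_def)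
    qed (simp add: ext_def supertab_outside[OF s])
    then show "ext (T \<circ> ?h) = T" by blast
    have "supertab E X (T \<circ> ?h)"
    proof (rule supertabI)
      show "0 < (T \<circ> ?h) c" if "c \<in> X" for c using supertab_pos[OF s, of "?h c"] that by simp
      show "(T \<circ> ?h) c = 0" if "c \<notin> X" for c
        using supertab_outside[OF s, of "?h c"] that inj by (simp add: inj_image_mem_iff)
      show "row_le E ((T \<circ> ?h) (i, j)) ((T \<circ> ?h) (i, j'))" if "(i, j) \<in> X" "(i, j') \<in> X" "j < j'" for i j j'
        using supertab_row[OF s, of "f i" "g j" "g j'"] that gl by (force simp: hi simp del: map_prod_simp)
      show "col_le E ((T \<circ> ?h) (i, j)) ((T \<circ> ?h) (i', j))" if "(i, j) \<in> X" "(i', j) \<in> X" "i < i'" for i i' j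
        using supertab_col[OF s, of "f i" "g j" "f i'"] that fl by (force simp: hi simp del: map_prod_simp)
    qed
    then show "T \<circ> ?h \<in> tabs E L X" using T by (auto simp: tabs_def)
    show "wt x X (T \<circ> ?h) * F (T \<circ> ?h) = wt x (?h ` X) T * F (T \<circ> ?h)"
      unfolding wt_def by (subst prod.reindex) (auto intro: inj_on_subset[OF inj])
  next
    fix T assume T: "T \<in> tabs E L X"
    then have s: "supertab E X T" by (simp add: tabs_def)
    show "ext T \<circ> ?h = T" using ext[OF s] by (simp only: fun_eq_iff o_apply) simp
    have "supertab E (?h ` X) (ext T)"
    proof (rule supertabI)
      show "0 < ext T c" if "c \<in> ?h ` X" for c
        using that ext[OF s] supertab_pos[OF s] by auto
      show "ext T c = 0" if "c \<notin> ?h ` X" for c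
        using that by (simp add: ext_def)
      show "row_le E (ext T (i, j)) (ext T (i, j'))"
        if mem: "(i, j) \<in> ?h ` X" "(i, j') \<in> ?h ` X" "j < j'" for i j j'
      proof -
        obtain k l where 1: "(k, l) \<in> X" "(i, j) = ?h (k, l)"
          using mem(1) by (metis imageE surj_pair)
        obtain k' l' where 2: "(k', l') \<in> X" "(i, j') = ?h (k', l')"
          using mem(2) by (metis imageE surj_pair)
        note k = 1(1) 2(1) 1(2) 2(2)
        have "k' = k" "l < l'" using 1(2) 2(2) mem(3) fl gl by auto
        then show ?thesis using supertab_row[OF s] k(1,2) unfolding k(3,4) ext[OF s] by simp
      qed
      show "col_le E (ext T (i, j)) (ext T (i', j))"
        if mem: "(i, j) \<in> ?h ` X" "(i', j) \<in> ?h ` X" "i < i'" for i i' j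
      proof -
        obtain k l where 1: "(k, l) \<in> X" "(i, j) = ?h (k, l)"
          using mem(1) by (metis imageE surj_pair)
        obtain k' l' where 2: "(k', l') \<in> X" "(i', j) = ?h (k', l')"
          using mem(2) by (metis imageE surj_pair)
        note k = 1(1) 2(1) 1(2) 2(2)
        have "l' = l" "k < k'" using 1(2) 2(2) mem(3) fl gl by auto
        then show ?thesis using supertab_col[OF s] k(1,2) unfolding k(3,4) ext[OF s] by simp
      qed
    qed
    then show "ext T \<in> tabs E L (?h ` X)"
      using T ext[OF s] by (auto simp: tabs_def)
  qed
qed

lemma ev_map:
  assumes "strict_mono f" "strict_mono g"
  shows "ev E L x (map_prod f g ` X) = ev E L x X"
  using sum_tabs_map[OF assms, where F = "\<lambda>_. 1" and E = E and L = L and x = x and X = X] by (simp add: ev_def)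

lemma evat_map:
  assumes "strict_mono f" "strict_mono g"
  shows "evat E L x (map_prod f g ` X) (f i, g j) v = evat E L x X (i, j) v"
  using sum_tabs_map[OF assms, where F = "\<lambda>T. of_bool (T (i, j) = v)" and E = E and L = L and x = x and X = X]
  by (simp add: evat_def of_bool_def if_distrib cong: if_cong)

section \<open>The ribbon recursion\<close>

fun rib :: "(nat \<Rightarrow> 'a :: comm_ring_1) \<Rightarrow> nat list \<Rightarrow> 'a" where
  "rib H [] = 1"
| "rib H [n] = H n"
| "rib H (n # m # \<gamma>) = H n * rib H (m # \<gamma>) - rib H ((n + m) # \<gamma>)"

lemma finite_ribbon [simp]: "finite (ribbon_diagram \<gamma>)"
  by (induction \<gamma>) (auto simp: ribbon_diagram_Cons)

lemma ribbon_first_row: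
  fixes \<gamma> :: "nat list"
  assumes "n > 0"
  defines "e \<equiv> (\<Sum>k\<leftarrow>n # \<gamma>. k - 1)"
  shows "(0, e) \<in> ribbon_diagram (n # \<gamma>)" and "(i, j) \<in> ribbon_diagram (n # \<gamma>) \<Longrightarrow> j \<le> e"
proof -
  show "(0, e) \<in> ribbon_diagram (n # \<gamma>)"
    using assms(1) by (auto simp: ribbon_diagram_Cons e_def)
  have "\<forall>i j. (i, j) \<in> ribbon_diagram \<delta> \<longrightarrow> j \<le> (\<Sum>k\<leftarrow>\<delta>. k - 1)" for \<delta>
  proof (induction \<delta>)
    case (Cons a \<delta>)
    then show ?case by (fastforce simp: ribbon_diagram_Cons)
  qed simp
  then show "(i, j) \<in> ribbon_diagram (n # \<gamma>) \<Longrightarrow> j \<le> e"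
    unfolding e_def by blast
qed

text \<open>The new row and \<open>Z\<close> share only the column \<open>e\<close>. By
  transitivity, comparing with the top cell \<open>(1, e)\<close> of that column is enough.\<close>

lemma supertab_glue_col:
  assumes Z: "\<And>i j. (i, j) \<in> Z \<Longrightarrow> 1 \<le> i \<and> j \<le> e" "(1, e) \<in> Z" and m: "m > 0"
    and T: "supertab E ({0} \<times> {e..<e + m}) T1" "supertab E Z T2"
  shows "supertab E ({0} \<times> {e..<e + m} \<union> Z) (\<lambda>c. T1 c + T2 c) \<longleftrightarrow> col_le E (T1 (0, e)) (T2 (1, e))"
proof -
  have disj: "{0} \<times> {e..<e + m} \<inter> Z = {}" using Z(1) by fastforce
  have below: "col_le E (T1 (0, e)) (T2 (i, e))" if "col_le E (T1 (0, e)) (T2 (1, e))" "(i, e) \<in> Z" for i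
  proof (cases "i = 1")
    case False
    then have "1 < i" using Z(1)[OF that(2)] by simp
    then show ?thesis
      using supertab_col[OF T(2) Z(2) that(2)] that(1) col_le_trans by blast
  qed (use that in simp)
  show ?thesis
    unfolding supertab_union_iff[OF disj T]
  proof (intro iffI conjI allI impI, goal_cases)
    case 1
    then show ?case using Z(2) m by fastforce
  next
    case (4 i i' j)
    then have "j = e" using Z(1)[of i' j] by auto
    then show ?case using below 4 by auto
  qed (use Z(1) in fastforce)+
qed

lemma supertab_glue_row:
  assumes Y: "\<And>i j. (i, j) \<in> Y \<Longrightarrow> j \<le> e" "(0, e) \<in> Y" and m: "m > 0"
    and T: "supertab E ({0} \<times> {Suc e..<Suc e + m}) T1" "supertab E Y T2"
  shows "supertab E ({0} \<times> {Suc e..<Suc e + m} \<union> Y) (\<lambda>c. T1 c + T2 c) \<longleftrightarrow>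
    row_le E (T2 (0, e)) (T1 (0, Suc e))"
proof -
  have disj: "{0} \<times> {Suc e..<Suc e + m} \<inter> Y = {}" using Y(1) by fastforce
  have left: "row_le E (T2 (0, j)) (T1 (0, j'))"
    if "row_le E (T2 (0, e)) (T1 (0, Suc e))" "(0, j) \<in> Y" "j' \<in> {Suc e..<Suc e + m}" for j j'
  proof -
    have "j = e \<or> row_le E (T2 (0, j)) (T2 (0, e))"
      using supertab_row[OF T(2) that(2) Y(2)] Y(1)[OF that(2)] by linarith
    moreover have "j' = Suc e \<or> row_le E (T1 (0, Suc e)) (T1 (0, j'))"
      using supertab_row[OF T(1), of 0 "Suc e" j'] that(3) by (cases "j' = Suc e") auto
    ultimately show ?thesis using that(1) row_le_trans by blast
  qed
  show ?thesis
    unfolding supertab_union_iff[OF disj T]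
  proof (intro iffI conjI allI impI, goal_cases)
    case 1
    then show ?case using Y(2) m by fastforce
  next
    case (3 i j j')
    then show ?case using left by auto
  qed (use Y(1) in fastforce)+
qed

text \<open>The left end of the row of \<open>m\<close> cells is put either above the last cell of
  the next row or to the right of it. For each pair of tableaux of the two parts exactly one of
  these gluings is admissible by \<open>not_row_le\<close>, so together they count all
  pairs.\<close>

lemma ev_ribbon_step:
  fixes x :: "nat \<Rightarrow> 'a :: comm_ring_1"
  assumes L: "finite L" and mn: "m > 0" "n > 0"
  shows "ev E L x (ribbon_diagram (m # n # \<gamma>)) + ev E L x (ribbon_diagram ((m + n) # \<gamma>)) =
    ev E L x ({0} \<times> {0..<m}) * ev E L x (ribbon_diagram (n # \<gamma>))"
proof -
  let ?R = "{0 :: nat} \<times> {0..<m}"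
  let ?Y = "ribbon_diagram (n # \<gamma>)"
  define s where "s = (\<Sum>k\<leftarrow>\<gamma>. k - 1)"
  define e where "e = (\<Sum>k\<leftarrow>n # \<gamma>. k - 1)"
  have e: "Suc e = s + n" using mn by (simp add: e_def s_def)
  let ?Z = "map_prod Suc id ` ?Y"
  have q: "(0, e) \<in> ?Y" and le: "(i, j) \<in> ?Y \<Longrightarrow> j \<le> e" for i j
    using ribbon_first_row[OF mn(2)] unfolding e_def by blast+
  have qZ: "(1, e) \<in> ?Z" using q by force
  have leZ: "1 \<le> i \<and> j \<le> e" if "(i, j) \<in> ?Z" for i j using that le by auto
  have shift: "{0} \<times> {k..<k + m} = map_prod id (\<lambda>j. j + k) ` ?R" for k
    by (simp add: map_prod_Times add.commute)
  have mono: "strict_mono (\<lambda>j :: nat. j + k)" "strict_mono Suc" "strict_mono (id :: nat \<Rightarrow> nat)" for k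
    by (auto simp: strict_mono_def)
  have at: "evat E L x ({0} \<times> {k..<k + m}) (0, k) v = evat E L x ?R (0, 0) v" for k v
    using evat_map[OF mono(3) mono(1), of E L x k ?R 0 0 v] unfolding shift by simp
  have atZ: "evat E L x ?Z (1, e) v = evat E L x ?Y (0, e) v" for v
    using evat_map[OF mono(2,3), of E L x ?Y 0 e v] by simp
  have A: "ribbon_diagram (m # n # \<gamma>) = {0} \<times> {e..<e + m} \<union> ?Z"
    unfolding ribbon_diagram_Cons[of m] e_def ..
  have B: "ribbon_diagram ((m + n) # \<gamma>) = {0} \<times> {Suc e..<Suc e + m} \<union> ?Y"
    unfolding ribbon_diagram_Cons s_def[symmetric] e by auto
  let ?g = "\<lambda>v v'. evat E L x ?R (0, 0) v * evat E L x ?Y (0, e) v'"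
  have disjA: "{0} \<times> {e..<e + m} \<inter> ?Z = {}" by auto
  have disjB: "{0} \<times> {Suc e..<Suc e + m} \<inter> ?Y = {}" using le by fastforce
  have "(\<Sum>T\<in>tabs E L ({0} \<times> {e..<e + m} \<union> ?Z). wt x ({0} \<times> {e..<e + m} \<union> ?Z) T * 1) =
      (\<Sum>v\<in>L. \<Sum>v'\<in>L. if col_le E v v'
        then evat E L x ({0} \<times> {e..<e + m}) (0, e) v * evat E L x ?Z (1, e) v' * 1 else 0)"
    using L qZ mn by (intro sum_tabs_glue[OF _ _ _ disjA] supertab_glue_col[OF leZ qZ mn(1)]) simp_all
  then have "ev E L x (ribbon_diagram (m # n # \<gamma>)) = (\<Sum>v\<in>L. \<Sum>v'\<in>L. if col_le E v v' then ?g v v' else 0)"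
    unfolding A ev_def at atZ mult_1_right .
  moreover have "(\<Sum>T\<in>tabs E L ({0} \<times> {Suc e..<Suc e + m} \<union> ?Y). wt x ({0} \<times> {Suc e..<Suc e + m} \<union> ?Y) T * 1) =
      (\<Sum>v\<in>L. \<Sum>v'\<in>L. if row_le E v' v
        then evat E L x ({0} \<times> {Suc e..<Suc e + m}) (0, Suc e) v * evat E L x ?Y (0, e) v' * 1 else 0)"
    using L q mn
    by (intro sum_tabs_glue[OF _ _ _ disjB, where R = "\<lambda>v v'. row_le E v' v"]
        supertab_glue_row[OF le q mn(1)]) simp_all
  then have "ev E L x (ribbon_diagram ((m + n) # \<gamma>)) = (\<Sum>v\<in>L. \<Sum>v'\<in>L. if row_le E v' v then ?g v v' else 0)"
    unfolding B ev_def at mult_1_right .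
  moreover have "ev E L x ?R = (\<Sum>v\<in>L. evat E L x ?R (0, 0) v)"
    using L mn by (intro ev_evat) auto
  moreover have "ev E L x ?Y = (\<Sum>v\<in>L. evat E L x ?Y (0, e) v)"
    using L q by (intro ev_evat) auto
  ultimately show ?thesis
    by (simp add: sum_product not_row_le[symmetric] if_distrib flip: sum.distrib cong: if_cong)
qed

lemma ev_ribbon:
  assumes "finite L" "composition \<alpha>" "\<alpha> \<noteq> []"
  shows "ev E L x (ribbon_diagram \<alpha>) = rib (\<lambda>n. ev E L x ({0} \<times> {0..<n})) \<alpha>"
  using assms(2,3)
proof (induction "length \<alpha>" arbitrary: \<alpha> rule: less_induct)
  case less
  consider n where "\<alpha> = [n]" | m n \<gamma> where "\<alpha> = m # n # \<gamma>"
    using less(3) by (metis neq_Nil_conv)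
  then show ?case
  proof cases
    case (2 m n \<gamma>)
    then have pos: "m > 0" "n > 0" "composition (n # \<gamma>)" "composition ((m + n) # \<gamma>)"
      using less(2) by (auto simp: composition_def)
    show ?thesis
      using ev_ribbon_step[OF assms(1) pos(1,2), of E x \<gamma>] less(1)[OF _ pos(3)] less(1)[OF _ pos(4)]
      by (simp add: 2 eq_diff_eq)
  qed (simp add: ribbon_diagram_Cons)
qed

section \<open>The alphabet with two odd and two even letters\<close>

text \<open>The odd letters 1 and 2 precede the even ones 3 and 4. This order confines the letter 1
  to the first column of a partition shape, as it may not repeat in a row.\<close>

definition even_letter :: "nat \<Rightarrow> bool" where
  "even_letter l \<longleftrightarrow> 3 \<le> l"

definition weights :: "'a \<Rightarrow> 'a \<Rightarrow> nat \<Rightarrow> 'a :: comm_ring_1" where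
  "weights u w l = (if l = 1 then u else if l = 2 then w else if l = 3 then 1 else 2)"

lemma weights_simps [simp]:
  "weights u w 1 = u" "weights u w (Suc 0) = u" "weights u w 2 = w" "weights u w 3 = 1" "weights u w 4 = 2"
  by (simp_all add: weights_def)

lemma row_le_even_letter [simp]:
  "row_le even_letter v v' \<longleftrightarrow> v < v' \<or> v = v' \<and> 3 \<le> v"
  "col_le even_letter v v' \<longleftrightarrow> v < v' \<or> v = v' \<and> v < 3"
  by (auto simp: row_le_def col_le_def even_letter_def)

lemma ev_cong:
  assumes "\<And>l. l \<in> L \<Longrightarrow> x l = y l"
  shows "ev E L x X = ev E L y X"
proof -
  have "wt x X T = wt y X T" if "T \<in> tabs E L X" for T
    using that assms unfolding wt_def tabs_def by (intro prod.cong) auto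
  then show ?thesis by (simp add: ev_def)
qed

text \<open>Weight 0 is how the smaller alphabets arise from the one with four letters, so that rows
  have to be evaluated only once.\<close>

lemma ev_drop_letter:
  assumes "finite X" "finite L" "x l = 0"
  shows "ev E L x X = ev E (L - {l}) x X"
  unfolding ev_def
proof (rule sum.mono_neutral_right)
  show "finite (tabs E L X)" using assms by (simp add: finite_tabs)
  show "tabs E (L - {l}) X \<subseteq> tabs E L X" by (auto simp: tabs_def)
  show "\<forall>T\<in>tabs E L X - tabs E (L - {l}) X. wt x X T = 0"
  proof
    fix T assume "T \<in> tabs E L X - tabs E (L - {l}) X"
    then obtain c where "c \<in> X" "T c = l" by (auto simp: tabs_def)
    then show "wt x X T = 0" using assms unfolding wt_def by (intro prod_zero) auto
  qed
qed

lemma ev_empty [simp]: "ev E L x {} = 1"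
proof -
  have "tabs E L {} = {\<lambda>_. 0}" by (auto simp: tabs_def supertab_def)
  then show ?thesis by (simp add: ev_def wt_def)
qed

lemma evat_single:
  assumes "finite L" "v \<in> L" "v > 0"
  shows "evat E L x {c} c v = x v"
proof -
  let ?t = "\<lambda>b. if b = c then v else 0"
  have t: "?t \<in> tabs E L {c}"
    using assms unfolding tabs_def supertab_def by auto
  have "T c = v \<longleftrightarrow> T = ?t" if "T \<in> tabs E L {c}" for T
  proof
    assume "T c = v"
    moreover have "T b = 0" if "b \<noteq> c" for b
      using that \<open>T \<in> tabs E L {c}\<close> supertab_outside[of E "{c}" T b] by (simp add: tabs_def)
    ultimately show "T = ?t" by auto
  qed simp
  then have "evat E L x {c} c v = (\<Sum>T\<in>tabs E L {c}. if T = ?t then wt x {c} T else 0)"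
    unfolding evat_def by (intro sum.cong) auto
  also have "\<dots> = wt x {c} ?t"
    using t assms(1) by (simp add: finite_tabs sum.delta)
  finally show ?thesis by (simp add: wt_def)
qed

abbreviation letters :: "nat set" where "letters \<equiv> {1, 2, 3, 4}"

text \<open>A row starting with 3 consists of 3s followed by 4s, whence a geometric sum; after an
  odd letter only larger letters can follow. The induction attaches one cell on the left.\<close>

lemma evat_row:
  "evat even_letter letters (weights u w) ({0} \<times> {0..<Suc n}) (0, 0) 4 = 2 ^ Suc n \<and>
   evat even_letter letters (weights u w) ({0} \<times> {0..<Suc n}) (0, 0) 3 = 2 ^ Suc n - 1 \<and>
   evat even_letter letters (weights u w) ({0} \<times> {0..<Suc n}) (0, 0) 2 = w * (2 ^ Suc n - 1) \<and>
   evat even_letter letters (weights u w) ({0} \<times> {0..<Suc n}) (0, 0) 1 = u * (w * (2 ^ n - 1) + 2 ^ Suc n - 1)"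
proof (induction n)
  case 0
  have "{0 :: nat} \<times> {0 :: nat..<Suc 0} = {(0, 0)}" by auto
  then show ?case by (simp add: evat_single)
next
  case (Suc n)
  let ?R = "{0 :: nat} \<times> {0 :: nat..<Suc n}"
  let ?X = "{0 :: nat} \<times> {Suc 0..<Suc 0 + Suc n}"
  let ?at = "evat even_letter letters (weights u w)"
  have R: "{0 :: nat} \<times> {0 :: nat..<Suc (Suc n)} = ?X \<union> {(0, 0)}" by auto
  have "strict_mono (id :: nat \<Rightarrow> nat)" by (simp add: strict_mono_def)
  moreover have "?X = map_prod id Suc ` ?R"
    by (simp add: map_prod_Times)
  ultimately have at: "?at ?X (0, Suc 0) v = ?at ?R (0, 0) v" for v
    using evat_map[of id Suc even_letter letters "weights u w" ?R 0 0 v] by (simp add: strict_mono_def)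
  have step: "?at ({0} \<times> {0..<Suc (Suc n)}) (0, 0) k =
      (\<Sum>v\<in>letters. if row_le even_letter k v then ?at ?R (0, 0) v * weights u w k else 0)"
    if k: "k \<in> letters" for k
  proof -
    let ?G = "\<lambda>v. if v = k then 1 else 0 :: 'a"
    have "?at ({0} \<times> {0..<Suc (Suc n)}) (0, 0) k =
        (\<Sum>T\<in>tabs even_letter letters (?X \<union> {(0, 0)}). wt (weights u w) (?X \<union> {(0, 0)}) T * ?G (T (0, 0)))"
      unfolding evat_def R by (intro sum.cong refl) simp
    also have "\<dots> = (\<Sum>v\<in>letters. \<Sum>v'\<in>letters. if row_le even_letter v' v
        then ?at ?X (0, Suc 0) v * ?at {(0, 0)} (0, 0) v' * ?G v' else 0)"
      by (intro sum_tabs_glue[where R = "\<lambda>v v'. row_le even_letter v' v"] supertab_glue_row) auto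
    also have "\<dots> = (\<Sum>v\<in>letters. \<Sum>v'\<in>letters. if v' = k then
        (if row_le even_letter k v then ?at ?R (0, 0) v * weights u w k else 0) else 0)"
      using k by (intro sum.cong refl) (auto simp only: at evat_single if_True if_False mult_1_right mult_zero_right, auto simp: evat_single)
    also have "\<dots> = (\<Sum>v\<in>letters. if row_le even_letter k v then ?at ?R (0, 0) v * weights u w k else 0)"
      using k by (intro sum.cong refl) (subst sum.delta, auto)
    finally show ?thesis .
  qed
  define b where "b = ?at ?R (0, 0)"
  have L: "(\<Sum>v\<in>letters. f v) = f 1 + f 2 + f 3 + f 4" for f :: "nat \<Rightarrow> 'a"
    by (simp add: add.assoc)
  have IH: "b 4 = 2 ^ Suc n" "b 3 = 2 ^ Suc n - 1" "b 2 = w * (2 ^ Suc n - 1)"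
    using Suc.IH unfolding b_def by blast+
  have "?at ({0} \<times> {0..<Suc (Suc n)}) (0, 0) 4 = b 4 * 2"
       "?at ({0} \<times> {0..<Suc (Suc n)}) (0, 0) 3 = b 3 + b 4"
       "?at ({0} \<times> {0..<Suc (Suc n)}) (0, 0) 2 = (b 3 + b 4) * w"
       "?at ({0} \<times> {0..<Suc (Suc n)}) (0, 0) 1 = (b 2 + b 3 + b 4) * u"
    by ((subst step, simp), simp only: L b_def[symmetric], simp add: algebra_simps)+
  then show ?case
    unfolding IH by (simp only:, simp add: algebra_simps)
qed

text \<open>This is the coefficient of \<open>t^(n + 1)\<close> in
  \<open>(1 + u t) (1 + w t) / ((1 - t) (1 - 2 t))\<close>. The partial fraction decomposition has a
  constant part besides the two poles, so the formula is one for nonempty rows.\<close>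

lemma ev_row:
  "ev even_letter letters (weights u w) ({0} \<times> {0..<Suc n}) = (2 + u) * (2 + w) * 2 ^ n - (1 + u) * (1 + w)"
proof -
  have L: "(\<Sum>v\<in>letters. f v) = f 1 + f 2 + f 3 + f 4" for f :: "nat \<Rightarrow> 'a"
    by (simp add: add.assoc)
  have "ev even_letter letters (weights u w) ({0} \<times> {0..<Suc n}) =
      (\<Sum>v\<in>letters. evat even_letter letters (weights u w) ({0} \<times> {0..<Suc n}) (0, 0) v)"
    by (rule ev_evat) auto
  also have "\<dots> = (2 + u) * (2 + w) * 2 ^ n - (1 + u) * (1 + w)"
    unfolding L evat_row[THEN conjunct1] evat_row[THEN conjunct2, THEN conjunct1]
      evat_row[THEN conjunct2, THEN conjunct2, THEN conjunct1]
      evat_row[THEN conjunct2, THEN conjunct2, THEN conjunct2]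
    by (simp add: algebra_simps)
  finally show ?thesis .
qed

text \<open>The induction rests on the factorization of
  \<open>H m * (2^k - 1) - (2^(m + k) - 1)\<close> into \<open>2^m - 1\<close> and
  \<open>y * (2^k - 1) - 1\<close>: the new first row gets the factor of an end row, and the old one
  turns into an inner row.\<close>

lemma rib_product:
  fixes y :: "'a :: comm_ring_1"
  assumes H: "\<And>n. n > 0 \<Longrightarrow> H n = (1 + y) * 2 ^ n - y" and pos: "m > 0" "n > 0" "\<forall>k\<in>set \<gamma>. k > 0"
  shows "rib H (m # \<gamma> @ [n]) =
    y * (1 + y) * (2 ^ m - 1) * (2 ^ n - 1) * (\<Prod>k\<leftarrow>\<gamma>. y * (2 ^ k - 1) - 1)"
  using pos
proof (induction \<gamma> arbitrary: m)
  case Nil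
  then show ?case by (simp add: H algebra_simps power_add)
next
  case (Cons k \<gamma>)
  define c where "c = y * (1 + y) * (2 ^ n - 1) * (\<Prod>k\<leftarrow>\<gamma>. y * (2 ^ k - 1) - 1)"
  have "rib H (m # (k # \<gamma>) @ [n]) = H m * rib H (k # \<gamma> @ [n]) - rib H ((m + k) # \<gamma> @ [n])"
    by simp
  also have "rib H (k # \<gamma> @ [n]) = (2 ^ k - 1) * c"
    using Cons.IH[of k] Cons.prems by (simp add: c_def mult_ac)
  also have "rib H ((m + k) # \<gamma> @ [n]) = (2 ^ (m + k) - 1) * c"
    using Cons.IH[of "m + k"] Cons.prems by (simp add: c_def mult_ac)
  also have "H m * ((2 ^ k - 1) * c) - (2 ^ (m + k) - 1) * c = (2 ^ m - 1) * (y * (2 ^ k - 1) - 1) * c"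
    using Cons by (simp add: H power_add algebra_simps)
  finally show ?case by (simp add: c_def algebra_simps)
qed

section \<open>Near-hook shapes\<close>

lemma tabs_letter: "T \<in> tabs E L X \<Longrightarrow> c \<in> X \<Longrightarrow> T c \<in> L"
  by (auto simp: tabs_def)

lemma tabsI:
  assumes "supertab E X T" "\<And>i j. (i, j) \<in> X \<Longrightarrow> T (i, j) \<in> L"
  shows "T \<in> tabs E L X"
proof -
  have "T c \<in> L" if "c \<in> X" for c using assms(2)[of "fst c" "snd c"] that by simp
  then show ?thesis using assms(1) by (auto simp: tabs_def)
qed

lemma ev_three_letters:
  fixes x :: "nat \<Rightarrow> 'a :: comm_ring_1"
  assumes "finite X" "x 3 = 1" "x 4 = 2"
  shows "ev even_letter {1, 3, 4} x X = ev even_letter letters (weights (x 1) 0) X"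
    and "ev even_letter {2, 3, 4} x X = ev even_letter letters (weights 0 (x 2)) X"
    and "ev even_letter {3, 4} x X = ev even_letter letters (weights 0 0) X"
proof -
  have "ev even_letter letters (weights (x 1) 0) X = ev even_letter (letters - {2}) (weights (x 1) 0) X"
    by (rule ev_drop_letter) (use assms in auto)
  also have "letters - {2} = {1, 3, 4}" by auto
  also have "ev even_letter {1, 3, 4} (weights (x 1) 0) X = ev even_letter {1, 3, 4} x X"
    by (rule ev_cong) (use assms in auto)
  finally show "ev even_letter {1, 3, 4} x X = ev even_letter letters (weights (x 1) 0) X" ..
  have one: "ev even_letter letters (weights 0 w) X = ev even_letter {2, 3, 4} (weights 0 w) X" for w :: 'a
  proof -
    have "ev even_letter letters (weights 0 w) X = ev even_letter (letters - {1}) (weights 0 w) X"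
      by (rule ev_drop_letter) (use assms in auto)
    also have "letters - {1} = {2, 3, 4}" by auto
    finally show ?thesis .
  qed
  have "ev even_letter {2, 3, 4} (weights 0 (x 2)) X = ev even_letter {2, 3, 4} x X"
    by (rule ev_cong) (use assms in auto)
  then show "ev even_letter {2, 3, 4} x X = ev even_letter letters (weights 0 (x 2)) X"
    using one by simp
  have "ev even_letter letters (weights 0 0 :: nat \<Rightarrow> 'a) X = ev even_letter {2, 3, 4} (weights 0 0 :: nat \<Rightarrow> 'a) X"
    by (rule one)
  also have "\<dots> = ev even_letter ({2, 3, 4} - {2}) (weights 0 0 :: nat \<Rightarrow> 'a) X"
    by (rule ev_drop_letter) (use assms in auto)
  also have "{2, 3, 4} - {2} = {3, 4 :: nat}" by auto
  also have "ev even_letter {3, 4} (weights 0 0 :: nat \<Rightarrow> 'a) X = ev even_letter {3, 4} x X"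
    by (rule ev_cong) (use assms in auto)
  finally show "ev even_letter {3, 4} x X = ev even_letter letters (weights 0 0 :: nat \<Rightarrow> 'a) X" ..
qed

lemma ev_row_three_letters:
  assumes "n > 0" "x 3 = 1" "x 4 = 2" "k \<in> {1, 2}"
  shows "ev even_letter {k, 3, 4} x ({0} \<times> {0..<n}) = (2 + x k) * 2 ^ n - (1 + x k)"
proof -
  obtain m where n: "n = Suc m" using assms(1) by (cases n) auto
  show ?thesis
    using assms(4) ev_three_letters(1,2)[of "{0} \<times> {0..<n}" x, OF _ assms(2,3)]
    by (auto simp: n ev_row[of _ _ m, simplified] algebra_simps)
qed

lemma ev_row_two_letters:
  assumes "x 3 = 1" "x 4 = 2"
  shows "ev even_letter {3, 4} x ({0} \<times> {0..<n}) = 2 ^ Suc n - 1"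
proof (cases n)
  case (Suc m)
  then show ?thesis
    using ev_three_letters(3)[of "{0} \<times> {0..<n}" x, OF _ assms] by (simp add: ev_row[of _ _ m, simplified])
qed simp

lemma ev_union:
  assumes "finite X" "finite Y" "finite L" "X \<inter> Y = {}"
  shows "ev E L x (X \<union> Y) = (\<Sum>T1\<in>tabs E L X. \<Sum>T2\<in>tabs E L Y.
    if supertab E (X \<union> Y) (\<lambda>c. T1 c + T2 c) then wt x X T1 * wt x Y T2 else 0)"
  using sum_tabs_union[OF assms, where F = "\<lambda>_. 1" and x = x and E = E]
  unfolding ev_def mult_1_right .

lemma ev_union_free:
  assumes "finite X" "finite Y" "finite L" "X \<inter> Y = {}"
    and "\<And>T1 T2. T1 \<in> tabs E L X \<Longrightarrow> T2 \<in> tabs E L Y \<Longrightarrow> supertab E (X \<union> Y) (\<lambda>c. T1 c + T2 c)"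
  shows "ev E L x (X \<union> Y) = ev E L x X * ev E L x Y"
  unfolding ev_union[OF assms(1-4)] unfolding ev_def sum_product
  by (intro sum.cong refl) (simp add: assms(5))

lemma column_ribbon: "{0..<m} \<times> {0} = ribbon_diagram (replicate m 1)"
  using ribbon_diagram_append_ones[of "[]" m] by simp

text \<open>The cut separates the first column, the only place for the smallest odd letter, from a
  remainder of at most two rows.\<close>

lemma young_near_hook:
  assumes "a > 0" "b > 0"
  shows "young_diagram ([a, b] @ replicate d 1) =
    {0..<d + 2} \<times> {0} \<union> ({0} \<times> {1..<a} \<union> {1} \<times> {1..<b})"
proof -
  have "(i, j) \<in> young_diagram ([a, b] @ replicate d 1) \<longleftrightarrow>
      (i, j) \<in> {0..<d + 2} \<times> {0} \<union> ({0} \<times> {1..<a} \<union> {1} \<times> {1..<b})" for i j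
  proof -
    consider "i = 0" | "i = 1" | k where "i = Suc (Suc k)"
      by (cases i; cases "i - 1") auto
    then show ?thesis
    proof cases
      case 3
      have "(i, j) \<in> young_diagram ([a, b] @ replicate d 1) \<longleftrightarrow> k < d \<and> j < replicate d 1 ! k"
        by (simp add: young_diagram_def 3)
      also have "\<dots> \<longleftrightarrow> k < d \<and> j = 0" by auto
      finally show ?thesis by (auto simp: 3)
    qed (use assms in \<open>auto simp: young_diagram_def\<close>)
  qed
  then show ?thesis by (intro set_eqI) (metis surj_pair)
qed

text \<open>The \<open>b - 1\<close> columns of height two are forced to be 3 above 4. The remaining
  \<open>a - b\<close> cells of the first row are free, because only 3s stand to their left. This
  gives \<open>2^(b - 1)\<close> times \<open>2^(a - b + 1) - 1\<close>.\<close>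

lemma ev_two_rows:
  fixes x :: "nat \<Rightarrow> 'a :: comm_ring_1"
  assumes ab: "b \<le> a" "b > 0" and x: "x 3 = 1" "x 4 = 2"
  shows "ev even_letter {3, 4} x ({0} \<times> {1..<a} \<union> {1} \<times> {1..<b}) = 2 ^ a - 2 ^ (b - 1)"
proof -
  let ?X = "{0, 1 :: nat} \<times> {1..<b}"
  let ?Y = "{0 :: nat} \<times> {b..<a}"
  let ?t = "\<lambda>c. if c \<in> ?X then 3 + fst c else 0"
  have XY: "{0} \<times> {1..<a} \<union> {1} \<times> {1..<b} = ?X \<union> ?Y" using ab by auto
  have disj: "?X \<inter> ?Y = {}" by auto
  have t: "?t \<in> tabs even_letter {3, 4} ?X"
    unfolding tabs_def supertab_def by (auto split: if_splits)
  have t': "T = ?t" if T: "T \<in> tabs even_letter {3, 4} ?X" for T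
  proof
    fix c
    have s: "supertab even_letter ?X T" using T by (auto simp: tabs_def)
    show "T c = ?t c"
    proof (cases "c \<in> ?X")
      case True
      then obtain i j where c: "c = (i, j)" "i \<in> {0, 1}" "j \<in> {1..<b}" by auto
      have "col_le even_letter (T (0, j)) (T (1, j))"
        using supertab_col[OF s, of 0 j 1] c(3) by auto
      moreover have "T (0, j) \<in> {3, 4}" "T (1, j) \<in> {3, 4}"
        using tabs_letter[OF T, of "(0, j)"] tabs_letter[OF T, of "(1, j)"] c(3) by auto
      ultimately have "T (0, j) = 3" "T (1, j) = 4" by auto
      then show ?thesis using c True by auto
    qed (simp add: supertab_outside[OF s])
  qed
  have "tabs even_letter {3, 4} ?X = {?t}" using t t' by blast
  moreover have "wt x ?X ?t = 2 ^ (b - 1)"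
  proof -
    have "wt x ?X ?t = (\<Prod>c\<in>?X. if fst c = 1 then 2 else 1)"
      unfolding wt_def using x by (intro prod.cong) auto
    also have "\<dots> = (\<Prod>(i, j)\<in>?X. if i = 1 then 2 else 1)"
      by (simp add: case_prod_unfold)
    also have "\<dots> = (\<Prod>i\<in>{0, 1 :: nat}. \<Prod>j\<in>{1..<b}. if i = 1 then 2 else 1)"
      by (rule prod.cartesian_product[symmetric])
    also have "\<dots> = 2 ^ (b - 1)" by simp
    finally show ?thesis .
  qed
  ultimately have evX: "ev even_letter {3, 4} x ?X = 2 ^ (b - 1)" by (simp add: ev_def)
  have Y: "?Y = map_prod id (\<lambda>j. j + b) ` ({0} \<times> {0..<a - b})"
    using ab by (simp add: map_prod_Times)
  have evY: "ev even_letter {3, 4} x ?Y = 2 ^ Suc (a - b) - 1"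
    unfolding Y using ev_map[of id "\<lambda>j. j + b" even_letter "{3, 4}" x] ev_row_two_letters[where x = x and n = "a - b", OF x]
    by (simp add: strict_mono_def)
  have "ev even_letter {3, 4} x (?X \<union> ?Y) = ev even_letter {3, 4} x ?X * ev even_letter {3, 4} x ?Y"
  proof (rule ev_union_free[OF _ _ _ disj])
    fix T1 T2 assume T: "T1 \<in> tabs even_letter {3, 4} ?X" "T2 \<in> tabs even_letter {3, 4} ?Y"
    have s: "supertab even_letter ?X T1" "supertab even_letter ?Y T2" using T by (auto simp: tabs_def)
    show "supertab even_letter (?X \<union> ?Y) (\<lambda>c. T1 c + T2 c)"
      unfolding supertab_union_iff[OF disj s]
    proof (intro conjI allI impI)
      fix i j j' assume c: "(i, j) \<in> ?X" "(i, j') \<in> ?Y"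
      then have "T1 (i, j) = 3" using t'[OF T(1)] by auto
      then show "row_le even_letter (T1 (i, j)) (T2 (i, j'))"
        using tabs_letter[OF T(2) c(2)] by auto
    qed auto
  qed auto
  also have "\<dots> = 2 ^ (b - 1) * (2 ^ Suc (a - b) - 1)"
    unfolding evX evY ..
  also have "\<dots> = 2 ^ a - 2 ^ (b - 1)"
  proof -
    have "b - 1 + Suc (a - b) = a" using ab by simp
    then show ?thesis by (metis mult_1_right power_add right_diff_distrib)
  qed
  finally show ?thesis unfolding XY .
qed

lemma supertab_column_rows:
  fixes a b d :: nat
  defines "C \<equiv> {0..<d + 2} \<times> {0}" and "B \<equiv> {0} \<times> {1..<a} \<union> {1} \<times> {1..<b}"
  assumes "supertab E C T1" "supertab E B T2"
  shows "supertab E (C \<union> B) (\<lambda>c. T1 c + T2 c) \<longleftrightarrow>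
    (\<forall>i j. (i, j) \<in> B \<longrightarrow> row_le E (T1 (i, 0)) (T2 (i, j)))"
proof -
  have disj: "C \<inter> B = {}" by (auto simp: C_def B_def)
  show ?thesis
    unfolding supertab_union_iff[OF disj assms(3,4)] by (auto simp: C_def B_def)
qed

text \<open>The first column and the remainder do not interact. An odd letter in the remainder would
  have to exceed its left neighbour, yet it is the smallest letter. Conversely, any filling of the
  remainder by 3 and 4 fits any column: the top cell of the column is at most 3, since another cell
  lies below it, and the second row of the remainder contains only 4s.\<close>

lemma ev_near_hook:
  fixes x :: "nat \<Rightarrow> 'a :: comm_ring_1"
  assumes ab: "b \<le> a" "b > 0" and x: "x 3 = 1" "x 4 = 2" and k: "k \<in> {1, 2}"
  shows "ev even_letter {k, 3, 4} x (young_diagram ([a, b] @ replicate d 1)) =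
    (1 + x k) * (2 + x k) * x k ^ d * (2 ^ a - 2 ^ (b - 1))"
proof -
  let ?C = "{0..<d + 2} \<times> {0 :: nat}"
  let ?B = "{0 :: nat} \<times> {1..<a} \<union> {1} \<times> {1..<b}"
  let ?L = "{k, 3, 4}"
  have disj: "?C \<inter> ?B = {}" by auto
  have ok: "supertab even_letter (?C \<union> ?B) (\<lambda>c. T1 c + T2 c) \<longleftrightarrow> T2 \<in> tabs even_letter {3, 4} ?B"
    if T: "T1 \<in> tabs even_letter ?L ?C" "T2 \<in> tabs even_letter ?L ?B" for T1 T2
  proof -
    have s: "supertab even_letter ?C T1" "supertab even_letter ?B T2" using T by (auto simp: tabs_def)
    have L: "T1 c \<in> ?L" if "c \<in> ?C" for c using tabs_letter[OF T(1) that] .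
    have L': "T2 c \<in> ?L" if "c \<in> ?B" for c using tabs_letter[OF T(2) that] .
    have C: "(i, 0) \<in> ?C" if "(i, j) \<in> ?B" for i j using that by auto
    show ?thesis
      unfolding supertab_column_rows[OF s]
    proof
      assume r: "\<forall>i j. (i, j) \<in> ?B \<longrightarrow> row_le even_letter (T1 (i, 0)) (T2 (i, j))"
      have "T2 (i, j) \<in> {3, 4}" if "(i, j) \<in> ?B" for i j
        using L[OF C[OF that]] L'[OF that] r that k by fastforce
      then show "T2 \<in> tabs even_letter {3, 4} ?B" by (rule tabsI[OF s(2)])
    next
      assume "T2 \<in> tabs even_letter {3, 4} ?B"
      then have T2: "T2 c \<in> {3, 4}" if "c \<in> ?B" for c using tabs_letter that by blast
      have col: "col_le even_letter (T1 (0, 0)) (T1 (1, 0))"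
        using supertab_col[OF s(1), of 0 0 1] by simp
      show "\<forall>i j. (i, j) \<in> ?B \<longrightarrow> row_le even_letter (T1 (i, 0)) (T2 (i, j))"
      proof (intro allI impI)
        fix i j assume ij: "(i, j) \<in> ?B"
        consider "i = 0" | "i = 1" using ij by auto
        then show "row_le even_letter (T1 (i, 0)) (T2 (i, j))"
        proof cases
          case 1
          then show ?thesis using col L[of "(0, 0)"] L[of "(1, 0)"] T2[OF ij] k by auto
        next
          case 2
          then have j: "j \<in> {1..<b}" using ij by auto
          have "col_le even_letter (T2 (0, j)) (T2 (1, j))"
            using supertab_col[OF s(2), of 0 j 1] j ab by simp
          then have "T2 (1, j) = 4" using T2[of "(0, j)"] T2[of "(1, j)"] j ab by auto
          then show ?thesis using 2 L[of "(1, 0)"] k by auto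
        qed
      qed
    qed
  qed
  have sub: "tabs even_letter {3, 4} ?B \<subseteq> tabs even_letter ?L ?B" by (auto simp: tabs_def)
  have fin: "finite (tabs even_letter ?L ?B)" by (rule finite_tabs) auto
  have "ev even_letter ?L x (?C \<union> ?B) =
      (\<Sum>T1\<in>tabs even_letter ?L ?C. \<Sum>T2\<in>tabs even_letter ?L ?B.
        if T2 \<in> tabs even_letter {3, 4} ?B then wt x ?C T1 * wt x ?B T2 else 0)"
    by (subst ev_union[OF _ _ _ disj]) (simp_all only: ok finite_SigmaI finite_atLeastLessThan finite.intros finite_UnI cong: sum.cong)
  also have "\<dots> = (\<Sum>T1\<in>tabs even_letter ?L ?C. \<Sum>T2\<in>tabs even_letter {3, 4} ?B. wt x ?C T1 * wt x ?B T2)"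
    by (rule sum.cong[OF refl]) (simp only: sum.inter_restrict[OF fin, symmetric] Int_absorb1[OF sub])
  also have "\<dots> = ev even_letter ?L x ?C * ev even_letter {3, 4} x ?B"
    by (simp add: ev_def sum_product)
  also have "ev even_letter ?L x ?C = (1 + x k) * (2 + x k) * x k ^ d"
  proof -
    let ?H = "\<lambda>n. ev even_letter ?L x ({0} \<times> {0..<n})"
    have "ev even_letter ?L x ?C = rib ?H (replicate (d + 2) 1)"
      unfolding column_ribbon by (rule ev_ribbon) (auto simp: composition_def)
    also have "replicate (d + 2) 1 = (1 :: nat) # replicate d 1 @ [1]"
      by (simp add: replicate_append_same)
    also have "rib ?H \<dots> = (1 + x k) * (1 + (1 + x k)) * (2 ^ 1 - 1) * (2 ^ 1 - 1) *
        (\<Prod>n\<leftarrow>replicate d 1. (1 + x k) * (2 ^ n - 1) - 1)"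
      by (rule rib_product) (use ev_row_three_letters[where x = x, OF _ x k] in \<open>auto simp: algebra_simps\<close>)
    also have "\<dots> = (1 + x k) * (2 + x k) * x k ^ d"
      by (simp add: prod_list_replicate algebra_simps)
    finally show ?thesis .
  qed
  finally show ?thesis
    using ab by (simp only: young_near_hook[OF _ ab(2)] ev_two_rows[OF ab x] less_le_trans)
qed

text \<open>The odd letter cannot enter the second column, and two even letters cannot fill three
  cells of a column.\<close>

lemma ev_tall_block:
  assumes "{0, 1, 2} \<times> {0, 1} \<subseteq> X"
  shows "ev even_letter {1, 3, 4} x X = 0"
proof -
  have False if T: "T \<in> tabs even_letter {1, 3, 4} X" for T
  proof -
    have s: "supertab even_letter X T" using T by (simp add: tabs_def)
    have v: "T (i, j) \<in> {1, 3, 4}" if "i \<in> {0, 1, 2}" "j \<in> {0, 1}" for i j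
      using T assms that unfolding tabs_def by blast
    have "row_le even_letter (T (i, 0)) (T (i, 1))" if "i \<in> {0, 1, 2}" for i
    proof -
      have "(i, 0) \<in> X" "(i, 1) \<in> X" using that assms by auto
      then show ?thesis using supertab_row[OF s, of i 0 1] by simp
    qed
    then have w: "T (i, 1) = 3 \<or> T (i, 1) = 4" if "i \<in> {0, 1, 2}" for i
      using v[of i 0] v[of i 1] that by force
    have "(0, 1) \<in> X" "(1, 1) \<in> X" "(2, 1) \<in> X" using assms by auto
    then have "col_le even_letter (T (0, 1)) (T (1, 1))" "col_le even_letter (T (1, 1)) (T (2, 1))"
      using supertab_col[OF s, of 0 1 1] supertab_col[OF s, of 1 1 2] by simp_all
    then show False using w[of 0] w[of 1] w[of 2] by auto
  qed
  then have "tabs even_letter {1, 3, 4} X = {}" by blast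
  then show ?thesis by (simp add: ev_def)
qed

text \<open>Tableaux in which the odd letter 1 occurs at least twice start with it in both long rows,
  so the first column and the rest of the diagram do not interact.\<close>

lemma coeff_ev_near_hook:
  assumes ab: "b \<le> a" "b \<ge> 2" and r: "r \<ge> 2"
  defines "x \<equiv> weights [:0, 1:] 1 :: nat \<Rightarrow> real poly"
  shows "coeff (ev even_letter letters x (young_diagram ([a, b] @ replicate d 1))) r =
    coeff (ev even_letter letters x (ribbon_diagram (replicate (d + 2) 1))) r *
      (6 * (2 ^ (a - 1) - 2 ^ (b - 2)))"
proof -
  let ?C = "{0..<d + 2} \<times> {0 :: nat}"
  let ?B = "{0 :: nat} \<times> {1..<a} \<union> {1} \<times> {1..<b}"
  let ?L = letters
  let ?s = "\<lambda>T1 T2. supertab even_letter (?C \<union> ?B) (\<lambda>c. T1 c + T2 c)"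
  have disj: "?C \<inter> ?B = {}" by auto
  have sub: "tabs even_letter {2, 3, 4} ?B \<subseteq> tabs even_letter ?L ?B" by (auto simp: tabs_def)
  have fin: "finite (tabs even_letter ?L ?B)" by (rule finite_tabs) auto
  have ok: "T2 \<in> tabs even_letter {2, 3, 4} ?B"
    if T: "T1 \<in> tabs even_letter ?L ?C" "T2 \<in> tabs even_letter ?L ?B" "?s T1 T2" for T1 T2
  proof -
    have s: "supertab even_letter ?C T1" "supertab even_letter ?B T2" using T by (auto simp: tabs_def)
    have "T2 (i, j) \<in> {2, 3, 4}" if "(i, j) \<in> ?B" for i j
    proof -
      have "row_le even_letter (T1 (i, 0)) (T2 (i, j))"
        using T(3) that unfolding supertab_column_rows[OF s] by blast
      moreover have "T1 (i, 0) \<in> ?L" using tabs_letter[OF T(1), of "(i, 0)"] that by auto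
      moreover have "T2 (i, j) \<in> ?L" using tabs_letter[OF T(2) that] .
      ultimately show ?thesis by auto
    qed
    then show ?thesis by (rule tabsI[OF s(2)])
  qed
  \<comment> \<open>Only the letter 1 has a nonconstant weight, so the degree in \<open>u\<close> is
    bounded by the number of its occurrences.\<close>
  have deg: "degree (wt x W T) \<le> card {c \<in> W. T c = 1}" if "finite W" for W T
  proof -
    have "degree (wt x W T) \<le> (\<Sum>c\<in>W. degree (x (T c)))"
      unfolding wt_def using degree_prod_sum_le[OF that, of "\<lambda>c. x (T c)"] by (simp add: o_def)
    also have "\<dots> \<le> (\<Sum>c\<in>W. if T c = 1 then 1 else 0)"
    proof (rule sum_mono)
      have "degree (2 :: real poly) = 0"
        using degree_of_nat[of 2, where 'a = real] by simp
      then show "degree (x (T c)) \<le> (if T c = 1 then 1 else 0)" for c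
        by (simp add: x_def weights_def)
    qed
    also have "\<dots> = card {c \<in> W. T c = 1}"
      using that by (simp add: sum.If_cases Int_def)
    finally show ?thesis .
  qed
  have degB: "degree (wt x ?B T2) = 0" if "T2 \<in> tabs even_letter {2, 3, 4} ?B" for T2
  proof -
    have "{c \<in> ?B. T2 c = 1} = {}" using that unfolding tabs_def by fastforce
    then show ?thesis using deg[of ?B T2] by (metis (no_types, lifting) card.empty finite_SigmaI finite_UnI finite_atLeastLessThan finite.emptyI finite_insert le_zero_eq)
  qed
  \<comment> \<open>If the second cell of the column is not 1, no later one is. Such columns have at
    most one 1 and do not reach the coefficient of \<open>u^r\<close>, as \<open>r\<close> is at
    least 2.\<close>
  have deg1: "degree (wt x ?C T1) \<le> 1"
    if T: "T1 \<in> tabs even_letter ?L ?C" "T1 (1, 0) \<noteq> 1" for T1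
  proof -
    have s: "supertab even_letter ?C T1" using T by (simp add: tabs_def)
    have v: "T1 (i, 0) \<in> ?L" if "i < d + 2" for i using tabs_letter[OF T(1), of "(i, 0)"] that by auto
    have "T1 (i, 0) \<noteq> 1" if "1 < i" "i < d + 2" for i
      using supertab_col[OF s, of 1 0 i] v[of 1] T(2) that by auto
    then have "{c \<in> ?C. T1 c = 1} \<subseteq> {(0, 0)}"
      using T(2) by auto (metis One_nat_def less_antisym less_one nat_neq_iff not_less_eq)
    then have "card {c \<in> ?C. T1 c = 1} \<le> card {(0 :: nat, 0 :: nat)}" by (intro card_mono) auto
    then show ?thesis using deg[of ?C T1] by simp
  qed
  have inner: "coeff (\<Sum>T2\<in>tabs even_letter ?L ?B. if ?s T1 T2 then wt x ?C T1 * wt x ?B T2 else 0) r =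
      coeff (wt x ?C T1 * ev even_letter {2, 3, 4} x ?B) r"
    if T1: "T1 \<in> tabs even_letter ?L ?C" for T1
  proof (cases "T1 (1, 0) = 1")
    case True
    have s1: "supertab even_letter ?C T1" using T1 by (simp add: tabs_def)
    have "T1 (0, 0) \<in> ?L" using tabs_letter[OF T1, of "(0, 0)"] by auto
    then have T0: "T1 (0, 0) = 1" using supertab_col[OF s1, of 0 0 1] True by auto
    have "?s T1 T2 \<longleftrightarrow> T2 \<in> tabs even_letter {2, 3, 4} ?B" if T2: "T2 \<in> tabs even_letter ?L ?B" for T2
    proof
      assume "T2 \<in> tabs even_letter {2, 3, 4} ?B"
      then have s2: "supertab even_letter ?B T2" and v: "\<And>c. c \<in> ?B \<Longrightarrow> T2 c \<in> {2, 3, 4}"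
        unfolding tabs_def by blast+
      show "?s T1 T2"
        unfolding supertab_column_rows[OF s1 s2]
      proof (intro allI impI)
        fix i j assume ij: "(i, j) \<in> ?B"
        then have "T1 (i, 0) = 1" using T0 True by auto
        then show "row_le even_letter (T1 (i, 0)) (T2 (i, j))" using v[OF ij] by auto
      qed
    qed (use ok[OF T1 T2] in blast)
    then have "(\<Sum>T2\<in>tabs even_letter ?L ?B. if ?s T1 T2 then wt x ?C T1 * wt x ?B T2 else 0) =
        (\<Sum>T2\<in>tabs even_letter ?L ?B. if T2 \<in> tabs even_letter {2, 3, 4} ?B then wt x ?C T1 * wt x ?B T2 else 0)"
      by (intro sum.cong) auto
    also have "\<dots> = wt x ?C T1 * ev even_letter {2, 3, 4} x ?B"
      using fin sub by (simp add: sum.inter_restrict[symmetric] Int_absorb1 ev_def sum_distrib_left)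
    finally show ?thesis by simp
  next
    case False
    have small: "coeff (wt x ?C T1 * p) r = 0" if "degree p = 0" for p
    proof (rule coeff_eq_0)
      have "degree (wt x ?C T1 * p) \<le> degree (wt x ?C T1) + degree p" by (rule degree_mult_le)
      then show "degree (wt x ?C T1 * p) < r" using deg1[OF T1 False] that r by linarith
    qed
    have "coeff (if ?s T1 T2 then wt x ?C T1 * wt x ?B T2 else 0) r = 0"
      if "T2 \<in> tabs even_letter ?L ?B" for T2
      using small[OF degB[OF ok[OF T1 that]]] by simp
    moreover have "coeff (wt x ?C T1 * ev even_letter {2, 3, 4} x ?B) r = 0"
      unfolding ev_def sum_distrib_left coeff_sum using small degB by (intro sum.neutral) blast
    ultimately show ?thesis by (simp add: coeff_sum)
  qed
  have "young_diagram ([a - 1, b - 1] @ replicate 0 1) = {0} \<times> {0..<a - 1} \<union> {1} \<times> {0..<b - 1}"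
  proof -
    have ab': "a - 1 > 0" "b - 1 > 0" using ab by auto
    show ?thesis unfolding young_near_hook[OF ab'] using ab' by auto
  qed
  moreover have "Suc ` {0..<n - 1} = {1..<n}" if "n > 0" for n using that by simp
  ultimately have B: "?B = map_prod id Suc ` young_diagram ([a - 1, b - 1] @ replicate 0 1)"
    using ab by (simp add: image_Un map_prod_Times)
  have x34: "x 3 = 1" "x 4 = 2" "x 2 = 1" by (simp_all add: x_def)
  \<comment> \<open>Without its first column the diagram has shape \<open>[a - 1, b - 1]\<close>,
    which is again of the known kind, now with 2 as its only odd letter. The constant 6 is
    \<open>(1 + w) * (2 + w)\<close> for \<open>w = 1\<close>.\<close>
  have "ev even_letter {2, 3, 4} x ?B = ev even_letter {2, 3, 4} x (young_diagram ([a - 1, b - 1] @ replicate 0 1))"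
    unfolding B by (intro ev_map) (auto simp: strict_mono_def)
  also have "\<dots> = (1 + x 2) * (2 + x 2) * x 2 ^ 0 * (2 ^ (a - 1) - 2 ^ (b - 1 - 1))"
    by (rule ev_near_hook) (use ab x34 in auto)
  also have "\<dots> = [:6 * (2 ^ (a - 1) - 2 ^ (b - 2)):]"
  proof -
    have "(2 :: real poly) ^ n = [:2 ^ n:]" for n
      by (induction n) (simp_all add: numeral_poly)
    moreover have "(1 + x 2) * (2 + x 2) = [:6:]" by (simp add: x34 numeral_poly one_pCons)
    ultimately show ?thesis by (simp add: x34 numeral_2_eq_2)
  qed
  finally have evB: "ev even_letter {2, 3, 4} x ?B = [:6 * (2 ^ (a - 1) - 2 ^ (b - 2)):]" .
  have "coeff (ev even_letter letters x (?C \<union> ?B)) r =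
      (\<Sum>T1\<in>tabs even_letter ?L ?C. coeff (wt x ?C T1 * ev even_letter {2, 3, 4} x ?B) r)"
    by (subst ev_union[OF _ _ _ disj])
      (simp_all only: coeff_sum[of _ "tabs even_letter letters ?C"] inner finite_SigmaI
        finite_atLeastLessThan finite.intros finite_UnI cong: sum.cong)
  also have "\<dots> = coeff (ev even_letter ?L x ?C * ev even_letter {2, 3, 4} x ?B) r"
    unfolding ev_def[of even_letter ?L x ?C] sum_distrib_right coeff_sum ..
  also have "\<dots> = coeff (ev even_letter ?L x ?C) r * (6 * (2 ^ (a - 1) - 2 ^ (b - 2)))"
    unfolding evB by (simp add: mult.commute[of _ "[:_:]"])
  finally show ?thesis
    unfolding column_ribbon[symmetric] by (subst young_near_hook) (use ab in auto)
qed

section \<open>The equation for the end rows\<close>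

lemma odd_part_unique:
  fixes m n :: int
  assumes "2 ^ s * m = 2 ^ t * n" "odd m" "odd n"
  shows "s = t \<and> m = n"
proof -
  have *: False if "2 ^ s * m = 2 ^ t * n" "odd m" "s < t" for s t and m n :: int
  proof -
    have "2 ^ t = (2 ^ s * 2 ^ (t - s) :: int)" using that(3) by (simp flip: power_add)
    then have "m = 2 ^ (t - s) * n" using that(1) by simp
    then show False using that(2,3) by simp
  qed
  have "s = t"
    using *[of s m t n] *[of t n s m] assms by (metis linorder_neqE_nat)
  then show ?thesis using assms(1) by simp
qed

text \<open>If both exponents are at least 2, both factors are -1 modulo 4, so \<open>2^c\<close> is
  2 modulo 4 and \<open>c = 1\<close>; but the product is at least 9.\<close>

lemma mersenne_product:
  fixes x z c :: nat
  assumes "(2 ^ x - 1) * (2 ^ z - 1) = (2 ^ c - 1 :: int)" "x > 0" "z > 0" "c > 0"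
  shows "x = 1 \<and> z = c \<or> z = 1 \<and> x = c"
proof -
  consider "x = 1" | "z = 1" | "x \<ge> 2" "z \<ge> 2" using assms(2,3) by linarith
  then show ?thesis
  proof cases
    case 3
    obtain x' z' where xz: "x = x' + 2" "z = z' + 2"
      using 3 by (metis add.commute le_Suc_ex)
    have eq: "2 ^ c = 4 * (4 * 2 ^ x' * 2 ^ z' - 2 ^ x' - 2 ^ z') + (2 :: int)"
      using assms(1) by (simp add: xz power_add algebra_simps)
    have "c = 1"
    proof (rule ccontr)
      assume "c \<noteq> 1"
      then obtain c' where "c = c' + 2" using assms(4) by (metis Suc_eq_plus1 add_2_eq_Suc' not0_implies_Suc not_gr0 One_nat_def)
      then have "4 * 2 ^ c' = 4 * (4 * 2 ^ x' * 2 ^ z' - 2 ^ x' - 2 ^ z') + (2 :: int)"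
        using eq by (simp add: power_add)
      then show False by presburger
    qed
    moreover have "(2 ^ x - 1 :: int) \<ge> 3" "(2 ^ z - 1 :: int) \<ge> 3"
    proof -
      have "(2 :: int) ^ (n + 2) = 4 * 2 ^ n" "(1 :: int) \<le> 2 ^ n" for n by simp_all
      then show "(2 ^ x - 1 :: int) \<ge> 3" "(2 ^ z - 1 :: int) \<ge> 3"
        unfolding xz by (smt (verit))+
    qed
    then have "(2 ^ x - 1) * (2 ^ z - 1) \<ge> (3 * 3 :: int)" by (intro mult_mono) auto
    ultimately show ?thesis using assms(1) by simp
  qed (use assms in auto)
qed

text \<open>Comparing the powers of 2 gives \<open>s = b - 1\<close>. The odd parts then express
  \<open>2^(a - b + 1) - 1\<close> as a product of two numbers of the same form.\<close>

lemma mersenne_difference: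
  fixes x w s a b :: nat
  assumes eq: "(2 ^ x - 1) * (2 ^ w - 2 ^ s) = (2 ^ a - 2 ^ (b - 1) :: real)"
    and pos: "x > 0" "s > 0" "b \<le> a" "b > 0"
  shows "s = b - 1 \<and> s < w \<and> (x = 1 \<and> w = a \<or> x = a - b + 1 \<and> w = b)"
proof -
  have "real_of_int ((2 ^ x - 1) * (2 ^ w - 2 ^ s)) = real_of_int (2 ^ a - 2 ^ (b - 1))"
    using eq by simp
  then have int: "(2 ^ x - 1) * (2 ^ w - 2 ^ s) = (2 ^ a - 2 ^ (b - 1) :: int)"
    unfolding of_int_eq_iff .
  have "(2 ^ (b - 1) :: int) < 2 ^ a" using pos by (intro power_strict_increasing) auto
  moreover have "(2 ^ x - 1 :: int) \<ge> 0" by simp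
  ultimately have "(2 ^ s :: int) < 2 ^ w"
    using int by (smt (verit) mult_nonneg_nonpos)
  then have sw: "s < w" by (rule power_less_imp_less_exp[rotated]) simp
  define z where "z = w - s"
  define c where "c = a - b + 1"
  have z: "z > 0" "w = s + z" and c: "c > 0" "a = b - 1 + c" using sw pos by (auto simp: z_def c_def)
  have "2 ^ s * ((2 ^ x - 1) * (2 ^ z - 1)) = 2 ^ (b - 1) * (2 ^ c - 1 :: int)"
    using int unfolding z(2) c(2) by (simp add: power_add algebra_simps)
  then have "s = b - 1 \<and> (2 ^ x - 1) * (2 ^ z - 1) = (2 ^ c - 1 :: int)"
    by (rule odd_part_unique) (use pos z c in auto)
  then have s: "s = b - 1" and "x = 1 \<and> z = c \<or> z = 1 \<and> x = c"
    using mersenne_product[OF _ pos(1) z(1) c(1)] by blast+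
  moreover have "w = b" if "z = 1" using s z(2) that pos(4) by simp
  moreover have "w = a" if "z = c" using s z(2) c(2) that by simp
  ultimately show ?thesis using sw unfolding c_def by blast
qed

text \<open>With the same rows in total, whatever leaves the ends must enter the interior. Different
  pairs of ends share one row or none, so one or two rows are exchanged.\<close>

lemma two_exchange:
  assumes eq: "M + {#p, q#} = M' + {#p', q'#}" and ne: "{#p, q#} \<noteq> {#p', q'#}"
  obtains x s w K where "{#p, q#} = {#x, s#}" "{#p', q'#} = {#x, w#}" "s \<noteq> w"
      "M = add_mset w K" "M' = add_mset s K"
  | K where "p \<noteq> p'" "p \<noteq> q'" "q \<noteq> p'" "q \<noteq> q'" "M = K + {#p', q'#}" "M' = K + {#p, q#}"
proof (cases "\<exists>x s w. {#p, q#} = {#x, s#} \<and> {#p', q'#} = {#x, w#}")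
  case True
  then obtain x s w where 1: "{#p, q#} = {#x, s#}" "{#p', q'#} = {#x, w#}" by blast
  then have "s \<noteq> w" using ne by auto
  moreover have "add_mset s M = add_mset w M'" using eq unfolding 1 by simp
  ultimately obtain K where "M = add_mset w K" "M' = add_mset s K"
    by (auto simp: add_eq_conv_ex)
  then show ?thesis using that(1) 1 \<open>s \<noteq> w\<close> by blast
next
  case False
  then have d: "p \<noteq> p'" "p \<noteq> q'" "q \<noteq> p'" "q \<noteq> q'"
    by (metis add_mset_commute)+
  have "{#p, q#} \<subseteq># M'"
  proof (rule mset_subset_eqI)
    fix k
    show "count {#p, q#} k \<le> count M' k"
      using arg_cong[OF eq, of "\<lambda>M. count M k"] d
      by (auto split: if_splits simp flip: count_greater_zero_iff)
  qed
  then have M': "M' = (M' - {#p, q#}) + {#p, q#}"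
    by (rule subset_mset.diff_add[symmetric])
  then have "M + {#p, q#} = ((M' - {#p, q#}) + {#p', q'#}) + {#p, q#}"
    using eq by (metis add.assoc add.commute)
  then have "M = (M' - {#p, q#}) + {#p', q'#}"
    by (rule add_right_imp_eq)
  then show ?thesis using that(2) d M' by blast
qed

text \<open>The discrete convexity of \<open>k \<mapsto> 1 / (2^k - 1)\<close>: the pair containing the smallest element
  dominates.\<close>

lemma mersenne_pairs:
  fixes p q p' q' :: nat
  defines "e \<equiv> \<lambda>k :: nat. 2 ^ k - 1 :: real"
  assumes pos: "p > 0" "q > 0" "p' > 0" "q' > 0"
    and d: "p \<noteq> p'" "p \<noteq> q'" "q \<noteq> p'" "q \<noteq> q'"
  shows "e p' * e q' * (e p + e q) \<noteq> e p * e q * (e p' + e q')"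
    and "e p * e q * ((e p' - 1) * (e q' - 1)) \<noteq> e p' * e q' * ((e p - 1) * (e q - 1))"
proof -
  have e1: "e k \<ge> 1" if "k > 0" for k
  proof -
    have "(2 :: real) ^ 1 \<le> 2 ^ k" using that by (intro power_increasing) auto
    then show ?thesis by (simp add: e_def)
  qed
  have e2: "e k' \<ge> 2 * e k + 1" if "k < k'" for k k'
  proof -
    have "(2 :: real) ^ Suc k \<le> 2 ^ k'" using that by (intro power_increasing) auto
    then show ?thesis by (simp add: e_def)
  qed
  have main: "e r' * e t' * (e r + e t) > e r * e t * (e r' + e t') \<and>
      e r * e t * ((e r' - 1) * (e t' - 1)) > e r' * e t' * ((e r - 1) * (e t - 1))"
    if "r < r'" "r < t'" "r > 0" "t > 0" for r t r' t' :: nat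
  proof -
    define A B X Y where "A = e r" and "B = e t" and "X = e r'" and "Y = e t'"
    have AB: "A \<ge> 1" "B \<ge> 1" using e1 that by (auto simp: A_def B_def)
    have XY: "X \<ge> 2 * A + 1" "Y \<ge> 2 * A + 1" using e2 that by (auto simp: A_def X_def Y_def)
    \<comment> \<open>As \<open>X\<close> and \<open>Y\<close> exceed \<open>2 * A\<close>, their
      reciprocals are less than half of that of \<open>A\<close>. So \<open>key\<close> says
      \<open>1/A > 1/X + 1/Y\<close>: the smallest element alone outweighs the other pair, and both
      inequalities follow.\<close>
    have "(X - A) * (Y - A) \<ge> (A + 1) * (A + 1)" using XY AB by (intro mult_mono) auto
    then have key: "X * Y - A * X - A * Y > 0" using AB by (simp add: algebra_simps)
    have "X * Y * (A + B) - A * B * (X + Y) = B * (X * Y - A * X - A * Y) + X * Y * A"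
      by (simp add: algebra_simps)
    moreover have "B * (X * Y - A * X - A * Y) > 0" "X * Y * A > 0" using key AB XY by simp_all
    ultimately have "X * Y * (A + B) > A * B * (X + Y)" by linarith
    moreover have "A * B * ((X - 1) * (Y - 1)) - X * Y * ((A - 1) * (B - 1)) =
        B * (X * Y - A * X - A * Y) + A * B + X * Y * (A - 1)"
      by (simp add: algebra_simps)
    then have "A * B * ((X - 1) * (Y - 1)) > X * Y * ((A - 1) * (B - 1))"
      using \<open>B * (X * Y - A * X - A * Y) > 0\<close> AB XY by (smt (verit) mult_nonneg_nonneg)
    ultimately show ?thesis by (simp add: A_def B_def X_def Y_def)
  qed
  consider "p < p'" "p < q'" | "q < p'" "q < q'" | "p' < p" "p' < q" | "q' < p" "q' < q"
    using d by linarith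
  then have "e p' * e q' * (e p + e q) \<noteq> e p * e q * (e p' + e q') \<and>
      e p * e q * ((e p' - 1) * (e q' - 1)) \<noteq> e p' * e q' * ((e p - 1) * (e q - 1))"
  proof cases
    case 1 show ?thesis using main[OF 1 pos(1,2)] by simp
  next
    case 2 show ?thesis using main[OF 2(1,2) pos(2,1)] by (simp add: mult_ac add.commute)
  next
    case 3 show ?thesis using main[OF 3 pos(3,4)] by simp
  next
    case 4 show ?thesis using main[OF 4 pos(4,3)] by (simp add: mult_ac add.commute)
  qed
  then show "e p' * e q' * (e p + e q) \<noteq> e p * e q * (e p' + e q')"
    and "e p * e q * ((e p' - 1) * (e q' - 1)) \<noteq> e p' * e q' * ((e p - 1) * (e q - 1))" by auto
qed

text \<open>The contribution of the inner rows to the evaluation with one odd letter. It takes a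
  multiset because their order does not matter there.\<close>

definition eprod :: "real \<Rightarrow> nat multiset \<Rightarrow> real" where
  "eprod y K = (\<Prod>k\<in>#K. y * (2 ^ k - 1) - 1)"

lemma eprod_add [simp]:
  "eprod y {#} = 1" "eprod y (add_mset k K) = (y * (2 ^ k - 1) - 1) * eprod y K"
  "eprod y (K + K') = eprod y K * eprod y K'"
  by (simp_all add: eprod_def)

lemma eprod_pos:
  assumes "y \<ge> 2" "\<forall>k\<in>#K. k > 0"
  shows "eprod y K > 0"
  using assms(2)
proof (induction K)
  case (add k K)
  have "(2 :: real) ^ 1 \<le> 2 ^ k" using add.prems by (intro power_increasing) auto
  then have "2 * 1 \<le> y * (2 ^ k - 1)" using assms(1) by (intro mult_mono) auto
  then show ?case using add by simp
qed simp

text \<open>A row \<open>k\<close> of length at least 2 would give the left side the root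
  \<open>1 / (2^k - 1)\<close>. It is positive and different from 1, so it is not a root of the
  right side.\<close>

lemma all_ones_of_eprod:
  assumes eq: "\<And>y. y > 0 \<Longrightarrow> eprod y K * L y = \<kappa> * (y - 1) ^ d" and \<kappa>: "\<kappa> \<noteq> 0"
    and pos: "\<forall>k\<in>#K. k > 0"
  shows "K = replicate_mset (size K) 1"
proof -
  have "k = 1" if k: "k \<in># K" for k
  proof (rule ccontr)
    assume "k \<noteq> 1"
    then have "k \<ge> 2" using k pos by (metis One_nat_def Suc_leI less_one nat_neq_iff numeral_2_eq_2)
    then have "(2 :: real) ^ 2 \<le> 2 ^ k" by (intro power_increasing) auto
    then have e: "(2 ^ k - 1 :: real) \<ge> 3" by simp
    define y where "y = 1 / (2 ^ k - 1 :: real)"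
    have y: "y > 0" "y \<noteq> 1" "y * (2 ^ k - 1) - 1 = 0" using e by (auto simp: y_def field_simps)
    obtain K' where "K = add_mset k K'" using k by (metis multi_member_split)
    then have "eprod y K = 0" using y(3) by simp
    then show False using eq[OF y(1)] \<kappa> y(2) by simp
  qed
  then show ?thesis by (intro set_mset_subset_singletonD) blast
qed

lemma eprod_ones: "eprod y (replicate_mset n 1) = (y - 1) ^ n"
  by (induction n) auto

text \<open>For \<open>y\<close> at least 2 the factor of the common inner rows is positive and
  cancels. If one row is exchanged, \<open>y = 2\<close> already gives a contradiction. If two are,
  the quadratic terms cancel, and the values 2 and 3 force the slope of the linear rest to vanish,
  against \<open>mersenne_pairs\<close>.\<close>

lemma ends_of_equal_products:
  assumes pos: "p > 0" "q > 0" "p' > 0" "q' > 0" "\<forall>k\<in>#M. k > 0" "\<forall>k\<in>#M'. k > 0"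
    and M: "M + {#p, q#} = M' + {#p', q'#}"
    and eq: "\<And>y. y > 0 \<Longrightarrow> (2 ^ p - 1) * (2 ^ q - 1) * eprod y M = (2 ^ p' - 1) * (2 ^ q' - 1) * eprod y M'"
  shows "{#p, q#} = {#p', q'#}"
proof (rule ccontr)
  assume ne: "{#p, q#} \<noteq> {#p', q'#}"
  have e1: "(2 ^ k - 1 :: real) > 0" if "k > 0" for k :: nat
    using one_less_power[of "2 :: real" k] that by simp
  show False
  proof (rule two_exchange[OF M ne])
    fix x s w K
    assume *: "{#p, q#} = {#x, s#}" "{#p', q'#} = {#x, w#}" "s \<noteq> w" "M = add_mset w K" "M' = add_mset s K"
    have "x \<in># {#p, q#}" unfolding *(1) by simp
    then have x: "x \<in> {p, q}" by simp
    have K: "eprod 2 K > 0" using pos(5) *(4) by (intro eprod_pos) auto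
    have pq: "(2 ^ p - 1) * (2 ^ q - 1) = (2 ^ x - 1) * (2 ^ s - 1 :: real)"
      using arg_cong[OF *(1), of "\<lambda>M. \<Prod>k\<in>#M. 2 ^ k - 1 :: real"] by simp
    have pq': "(2 ^ p' - 1) * (2 ^ q' - 1) = (2 ^ x - 1) * (2 ^ w - 1 :: real)"
      using arg_cong[OF *(2), of "\<lambda>M. \<Prod>k\<in>#M. 2 ^ k - 1 :: real"] by simp
    have "(2 ^ x - 1) * eprod 2 K * ((2 ^ s - 1) * (2 * (2 ^ w - 1) - 1)) =
        (2 ^ x - 1) * eprod 2 K * ((2 ^ w - 1) * (2 * (2 ^ s - 1) - 1 :: real))"
      using eq[of 2] unfolding pq pq' *(4,5) by (simp add: mult_ac)
    moreover have "(2 ^ x - 1) * eprod 2 K > 0"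
      using K e1[of x] x pos(1,2) by auto
    ultimately have "(2 ^ s - 1) * (2 * (2 ^ w - 1) - 1) = (2 ^ w - 1) * (2 * (2 ^ s - 1) - 1 :: real)"
      by (metis less_irrefl mult_left_cancel)
    then have "(2 :: real) ^ s = 2 ^ w" by (simp add: algebra_simps)
    then show False using *(3) by simp
  next
    fix K assume *: "p \<noteq> p'" "p \<noteq> q'" "q \<noteq> p'" "q \<noteq> q'" "M = K + {#p', q'#}" "M' = K + {#p, q#}"
    define A B X Y where "A = (2 ^ p - 1 :: real)" and "B = (2 ^ q - 1 :: real)"
      and "X = (2 ^ p' - 1 :: real)" and "Y = (2 ^ q' - 1 :: real)"
    have K: "eprod y K > 0" if "y \<ge> 2" for y using pos(5) *(5) that by (intro eprod_pos) auto
    have "A * B * ((y * X - 1) * (y * Y - 1)) = X * Y * ((y * A - 1) * (y * B - 1))" if "y \<ge> 2" for y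
      using eq[of y] K[OF that] that by (simp add: *(5,6) A_def B_def X_def Y_def mult_ac)
    from this[of 2] this[of 3] have "X * Y * (A + B) = A * B * (X + Y)"
      by (simp add: algebra_simps)
    then show False
      using mersenne_pairs(1)[OF pos(1-4) *(1-4)] by (simp add: A_def B_def X_def Y_def)
  qed
qed

lemma ends_classification:
  assumes pos: "p > 0" "q > 0" "p' > 0" "q' > 0" "\<forall>k\<in>#M. k > 0" "\<forall>k\<in>#M'. k > 0"
    and M: "M + {#p, q#} = M' + {#p', q'#}" and ne: "{#p, q#} \<noteq> {#p', q'#}"
    and ab: "b \<le> a" "b > 0"
    and eq: "\<And>y. y > 0 \<Longrightarrow>
      (2 ^ p - 1) * (2 ^ q - 1) * eprod y M - (2 ^ p' - 1) * (2 ^ q' - 1) * eprod y M' =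
      (2 ^ a - 2 ^ (b - 1)) * (y - 1) ^ d"
  shows "\<exists>x w. {#p, q#} = {#x, b - 1#} \<and> {#p', q'#} = {#x, w#} \<and> b - 1 < w \<and> 2 \<le> b \<and>
    M = add_mset w (replicate_mset d 1) \<and> M' = add_mset (b - 1) (replicate_mset d 1) \<and>
    (x = 1 \<and> w = a \<or> x = a - b + 1 \<and> w = b)"
proof -
  define \<kappa> where "\<kappa> = (2 ^ a - 2 ^ (b - 1) :: real)"
  have "(2 :: real) ^ (b - 1) < 2 ^ a" using ab by (intro power_strict_increasing) auto
  then have \<kappa>: "\<kappa> > 0" by (simp add: \<kappa>_def)
  show ?thesis
  proof (rule two_exchange[OF M ne])
    fix x s w K
    assume *: "{#p, q#} = {#x, s#}" "{#p', q'#} = {#x, w#}" "s \<noteq> w" "M = add_mset w K" "M' = add_mset s K"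
    have x: "x > 0" "s > 0"
    proof -
      have "x \<in># {#p, q#}" "s \<in># {#p, q#}" unfolding *(1) by auto
      then show "x > 0" "s > 0" using pos(1,2) by auto
    qed
    have pq: "(2 ^ p - 1) * (2 ^ q - 1) = (2 ^ x - 1) * (2 ^ s - 1 :: real)"
      using arg_cong[OF *(1), of "\<lambda>M. \<Prod>k\<in>#M. 2 ^ k - 1 :: real"] by simp
    have pq': "(2 ^ p' - 1) * (2 ^ q' - 1) = (2 ^ x - 1) * (2 ^ w - 1 :: real)"
      using arg_cong[OF *(2), of "\<lambda>M. \<Prod>k\<in>#M. 2 ^ k - 1 :: real"] by simp
    \<comment> \<open>The terms with \<open>y\<close> in the two linear factors cancel, so after one
      exchange the common inner rows carry the whole dependence on \<open>y\<close>.\<close>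
    have eq': "eprod y K * ((2 ^ x - 1) * (2 ^ w - 2 ^ s)) = \<kappa> * (y - 1) ^ d" if "y > 0" for y
      using eq[OF that] unfolding pq pq' *(4,5) \<kappa>_def by (simp add: algebra_simps)
    have K: "K = replicate_mset (size K) 1"
      by (rule all_ones_of_eprod[OF eq']) (use \<kappa> pos *(4) in auto)
    have K': "eprod y K = (y - 1) ^ size K" for y
      by (metis K eprod_ones)
    have two: "(2 ^ x - 1) * (2 ^ w - 2 ^ s) = \<kappa>" using eq'[of 2] by (simp add: K')
    have "2 ^ size K * \<kappa> = \<kappa> * (2 :: real) ^ d" using eq'[of 3] by (simp add: K' two)
    then have "size K = d" using \<kappa> by simp
    then have Kd: "K = replicate_mset d 1" using K by simp
    have "s = b - 1 \<and> s < w \<and> (x = 1 \<and> w = a \<or> x = a - b + 1 \<and> w = b)"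
      using mersenne_difference[OF _ x ab] two unfolding \<kappa>_def by blast
    moreover from this have "2 \<le> b" using x(2) by linarith
    ultimately show ?thesis using * Kd by blast
  next
    fix K assume *: "p \<noteq> p'" "p \<noteq> q'" "q \<noteq> p'" "q \<noteq> q'" "M = K + {#p', q'#}" "M' = K + {#p, q#}"
    define A B X Y where "A = (2 ^ p - 1 :: real)" and "B = (2 ^ q - 1 :: real)"
      and "X = (2 ^ p' - 1 :: real)" and "Y = (2 ^ q' - 1 :: real)"
    define L where "L y = A * B * ((y * X - 1) * (y * Y - 1)) - X * Y * ((y * A - 1) * (y * B - 1))" for y
    have eq': "eprod y K * L y = \<kappa> * (y - 1) ^ d" if "y > 0" for y
      using eq[OF that] unfolding *(5,6) \<kappa>_def L_def A_def B_def X_def Y_def by (simp add: algebra_simps)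
    have K: "K = replicate_mset (size K) 1"
      by (rule all_ones_of_eprod[OF eq']) (use \<kappa> pos *(5) in auto)
    have K': "eprod y K = (y - 1) ^ size K" for y
      by (metis K eprod_ones)
    define c1 c0 where "c1 = X * Y * (A + B) - A * B * (X + Y)" and "c0 = A * B - X * Y"
    have L: "L y = c1 * y + c0" for y by (simp add: L_def c1_def c0_def algebra_simps)
    \<comment> \<open>The points 2, 3, 5 turn \<open>y - 1\<close> into 1, 2, 4, so \<open>L\<close>
      takes the values \<open>\<kappa>\<close>, \<open>\<kappa> * r\<close>,
      \<open>\<kappa> * r^2\<close> there. As \<open>L\<close> is linear,
      \<open>r^2 - 1 = 3 * (r - 1)\<close>, hence \<open>r\<close> is 1 or 2: then \<open>L\<close>
      is constant or vanishes at 1. The two parts of \<open>mersenne_pairs\<close> exclude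
      these.\<close>
    define r where "r = (2 :: real) ^ d / 2 ^ size K"
    have L2: "L 2 = \<kappa>" using eq'[of 2] by (simp add: K')
    have L3: "L 3 = \<kappa> * r" using eq'[of 3] by (simp add: K' r_def field_simps)
    have L5: "L 5 = \<kappa> * r\<^sup>2"
    proof -
      have "4 ^ size K * L 5 = \<kappa> * 4 ^ d" using eq'[of 5] by (simp add: K')
      moreover have "(4 :: real) ^ n = (2 ^ n)\<^sup>2" for n by (simp flip: power_mult power_mult_distrib add: power2_eq_square)
      ultimately show ?thesis by (simp add: r_def power_divide field_simps)
    qed
    have c1: "c1 = \<kappa> * (r - 1)" using L2 L3 by (simp add: L algebra_simps)
    have "3 * c1 = \<kappa> * (r\<^sup>2 - 1)" using L2 L5 by (simp add: L algebra_simps)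
    then have "\<kappa> * ((r - 1) * (r - 2)) = 0" unfolding c1 by (simp add: algebra_simps power2_eq_square)
    then have "r = 1 \<or> r = 2" using \<kappa> by simp
    then have "c1 = 0 \<or> c1 + c0 = 0" using c1 L2 by (auto simp: L)
    moreover have "c1 \<noteq> 0"
      using mersenne_pairs(1)[OF pos(1-4) *(1-4)] by (simp add: c1_def A_def B_def X_def Y_def)
    moreover have "c1 + c0 \<noteq> 0"
      using mersenne_pairs(2)[OF pos(1-4) *(1-4)] L_def[of 1] L[of 1] by (simp add: A_def B_def X_def Y_def)
    ultimately show ?thesis by blast
  qed
qed

section \<open>Reduction to explicit ribbons\<close>

lemma finite_young [simp]: "finite (young_diagram \<nu>)"
proof -
  have "young_diagram \<nu> = (\<Union>i<length \<nu>. {i} \<times> {..<\<nu> ! i})"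
    by (auto simp: young_diagram_def)
  then show ?thesis by simp
qed

lemma ev_ribbon_three_letters:
  fixes y :: real
  assumes "composition (p # \<gamma> @ [q])"
  shows "ev even_letter {1, 3, 4} (weights (y - 1) 0) (ribbon_diagram (p # \<gamma> @ [q])) =
    y * (1 + y) * ((2 ^ p - 1) * (2 ^ q - 1) * eprod y (mset \<gamma>))"
proof -
  let ?H = "\<lambda>n. ev even_letter {1, 3, 4} (weights (y - 1) 0) ({0} \<times> {0..<n})"
  have "?H n = (1 + y) * 2 ^ n - y" if "n > 0" for n
    using ev_row_three_letters[OF that, of "weights (y - 1) 0" 1] by (simp add: algebra_simps)
  then have "rib ?H (p # \<gamma> @ [q]) = y * (1 + y) * (2 ^ p - 1) * (2 ^ q - 1) * (\<Prod>k\<leftarrow>\<gamma>. y * (2 ^ k - 1) - 1)"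
    by (rule rib_product) (use assms in \<open>auto simp: composition_def\<close>)
  moreover have "(\<Prod>k\<leftarrow>\<gamma>. y * (2 ^ k - 1) - 1) = eprod y (mset \<gamma>)"
    by (simp add: eprod_def flip: prod_mset_prod_list)
  ultimately show ?thesis
    using ev_ribbon[OF _ assms, of "{1, 3, 4}" even_letter "weights (y - 1) 0"] by (simp add: mult_ac)
qed

text \<open>Everything depends on whether the third part exceeds 1. The third alternative includes
  the hooks, \<open>b = 1\<close>; they drop out later, when \<open>b - 1\<close> turns out to be
  the length of a row.\<close>

lemma partition_cases:
  assumes "is_partition \<nu>"
  obtains "\<nu> = []" | a where "\<nu> = [a]" "a > 0" | a b d where "\<nu> = [a, b] @ replicate d 1" "b \<le> a" "b > 0"
    | "{0, 1, 2} \<times> {0, 1} \<subseteq> young_diagram \<nu>"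
proof -
  consider "\<nu> = []" | a where "\<nu> = [a]" | a b \<mu> where "\<nu> = a # b # \<mu>"
    by (metis neq_Nil_conv)
  then show ?thesis
  proof cases
    case (3 a b \<mu>)
    have ab: "b \<le> a" "b > 0" and \<mu>: "\<forall>k\<in>set \<mu>. 0 < k \<and> k \<le> b" "sorted_wrt (\<ge>) \<mu>"
      using assms by (auto simp: 3 is_partition_def composition_def)
    show ?thesis
    proof (cases "\<forall>k\<in>set \<mu>. k = 1")
      case True
      then have "\<mu> = replicate (length \<mu>) 1" by (simp add: replicate_length_same)
      then show ?thesis using that(3)[of a b "length \<mu>"] 3 ab by simp
    next
      case False
      then obtain c \<mu>' where c: "\<mu> = c # \<mu>'" by (cases \<mu>) auto
      have "c \<ge> 2"
      proof (rule ccontr)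
        assume "\<not> c \<ge> 2"
        then have "\<forall>k\<in>set \<mu>. k = 1" using \<mu> unfolding c by (auto simp: le_Suc_eq) (metis One_nat_def Suc_leI le_antisym le_trans less_2_cases_iff not_le)+
        then show False using False by blast
      qed
      moreover have "c \<le> b" using \<mu>(1) c by simp
      ultimately have "{0, 1, 2} \<times> {0, 1} \<subseteq> young_diagram \<nu>"
        using ab by (auto simp: young_diagram_def 3 c)
      then show ?thesis by (rule that(4))
    qed
  qed (use that assms in \<open>auto simp: is_partition_def composition_def\<close>)
qed

lemma near_hook_of_schur:
  assumes comp: "composition (p # \<gamma> @ [q])" "composition (p' # \<gamma>' @ [q'])"
    and M: "mset (p # \<gamma> @ [q]) = mset (p' # \<gamma>' @ [q'])"
    and ne: "{#p, q#} \<noteq> {#p', q'#}" and \<nu>: "is_partition \<nu>"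
    and diff: "\<And>M. tableau_series (ribbon_diagram (p # \<gamma> @ [q])) M -
      tableau_series (ribbon_diagram (p' # \<gamma>' @ [q'])) M = tableau_series (young_diagram \<nu>) M"
  shows "\<exists>a b d x w. \<nu> = [a, b] @ replicate d 1 \<and> b \<le> a \<and> 2 \<le> b \<and> b - 1 < w \<and>
    {#p, q#} = {#x, b - 1#} \<and> {#p', q'#} = {#x, w#} \<and>
    mset \<gamma> = add_mset w (replicate_mset d 1) \<and> mset \<gamma>' = add_mset (b - 1) (replicate_mset d 1) \<and>
    (x = 1 \<and> w = a \<or> x = a - b + 1 \<and> w = b)"
proof -
  define D where "D y = (2 ^ p - 1) * (2 ^ q - 1) * eprod y (mset \<gamma>) -
    (2 ^ p' - 1) * (2 ^ q' - 1) * eprod y (mset \<gamma>')" for y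
  have D: "y * (1 + y) * D y = ev even_letter {1, 3, 4} (weights (y - 1) 0) (young_diagram \<nu>)" for y :: real
    using ev_transfer[OF _ _ _ _ diff, of "{1, 3, 4}" even_letter "weights (y - 1) 0"]
    unfolding ev_ribbon_three_letters[OF comp(1)] ev_ribbon_three_letters[OF comp(2)] D_def
    by (simp add: algebra_simps)
  have pos: "p > 0" "q > 0" "p' > 0" "q' > 0" "\<forall>k\<in>#mset \<gamma>. k > 0" "\<forall>k\<in>#mset \<gamma>'. k > 0"
    using comp by (auto simp: composition_def)
  have M': "mset \<gamma> + {#p, q#} = mset \<gamma>' + {#p', q'#}" using M by simp
  show ?thesis
  proof (cases rule: partition_cases[OF \<nu>])
    case 1
    \<comment> \<open>At \<open>y = 0\<close> the difference of the ribbons vanishes through its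
      factor \<open>y\<close>, while the empty diagram evaluates to 1; in the next case a single row
      evaluates to \<open>2^a\<close>.\<close>
    then show ?thesis using D[of 0] by (simp add: young_diagram_def)
  next
    case (2 a)
    have "young_diagram \<nu> = {0} \<times> {0..<a}" by (auto simp: 2 young_diagram_def)
    then show ?thesis
      using D[of 0] ev_row_three_letters[OF 2(2), of "weights (- 1 :: real) 0" 1] by simp
  next
    case (3 a b d)
    have "D y = (2 ^ a - 2 ^ (b - 1)) * (y - 1) ^ d" if "y > 0" for y
    proof -
      have "y * (1 + y) * D y = y * (1 + y) * ((2 ^ a - 2 ^ (b - 1)) * (y - 1) ^ d)"
        unfolding D 3(1) using ev_near_hook[OF 3(2,3), of "weights (y - 1) 0" 1 d]
        by (simp add: mult_ac add.commute)
      moreover have "y * (1 + y) \<noteq> 0" using that by simp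
      ultimately show ?thesis by (metis mult_left_cancel)
    qed
    then show ?thesis
      using ends_classification[OF pos M' ne 3(2,3), of d] 3 unfolding D_def by blast
  next
    case 4
    have "D y = 0" if "y > 0" for y
    proof -
      have "y * (1 + y) * D y = 0" unfolding D by (rule ev_tall_block[OF 4])
      then show ?thesis using that by simp
    qed
    then have "{#p, q#} = {#p', q'#}"
      by (intro ends_of_equal_products[OF pos M']) (simp add: D_def)
    then show ?thesis using ne by blast
  qed
qed

text \<open>A relational form of the transpose that supports recursion over the rows. It records the
  number of columns, which locates the last column when a row is added on top.\<close>

definition transposed :: "nat list \<Rightarrow> nat list \<Rightarrow> bool" where
  "transposed \<alpha> \<gamma> \<longleftrightarrow> composition \<gamma> \<and> length \<gamma> = Suc (\<Sum>x\<leftarrow>\<alpha>. x - 1) \<and>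
    ribbon_diagram \<gamma> = prod.swap ` ribbon_diagram \<alpha>"

lemma comp_transpose_eq:
  assumes "composition \<alpha>" "transposed \<alpha> \<gamma>"
  shows "comp_transpose \<alpha> = \<gamma>"
  unfolding comp_transpose_def
  by (rule the1_equality[OF ex1_transpose[OF assms(1)]]) (use assms(2) in \<open>simp add: transposed_def\<close>)

lemma transposed_single:
  assumes "a > 0"
  shows "transposed [a] (replicate (a - 1) 1 @ [1])"
proof -
  have "replicate (a - 1) 1 @ [1 :: nat] = replicate a 1"
    using assms by (metis Suc_pred' replicate_Suc replicate_append_same)
  moreover have "ribbon_diagram (replicate a 1) = {0..<a} \<times> {0}" by (rule column_ribbon[symmetric])
  moreover have "ribbon_diagram [a] = {0} \<times> {0..<a}" by (simp add: ribbon_diagram_Cons)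
  ultimately show ?thesis
    using assms by (simp add: transposed_def composition_def product_swap)
qed

text \<open>The leftmost cell of the new top row lies above the last column, which grows by one; the
  other \<open>a - 1\<close> cells are new columns of length 1.\<close>

lemma transposed_Cons:
  assumes "transposed \<alpha> (\<delta> @ [c])" "a > 0"
  shows "transposed (a # \<alpha>) (\<delta> @ [Suc c] @ replicate (a - 1) 1)"
proof -
  let ?s = "\<Sum>x\<leftarrow>\<alpha>. x - 1"
  have \<alpha>: "composition (\<delta> @ [c])" "length \<delta> = ?s" "ribbon_diagram (\<delta> @ [c]) = prod.swap ` ribbon_diagram \<alpha>"
    using assms(1) by (auto simp: transposed_def)
  then have c: "c > 0" by (simp add: composition_def)
  have "ribbon_diagram ((\<delta> @ [Suc c]) @ replicate (a - 1) 1) =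
      map_prod id Suc ` ribbon_diagram (\<delta> @ [c]) \<union> {?s..<?s + a} \<times> {0}"
    unfolding ribbon_diagram_append_ones ribbon_diagram_grow_last[OF c] using \<alpha>(2) assms(2) by auto
  also have "\<dots> = prod.swap ` ribbon_diagram (a # \<alpha>)"
  proof -
    have "map_prod id Suc ` prod.swap ` X = prod.swap ` map_prod Suc id ` X" for X :: diagram
      by (simp add: image_image map_prod_def split_beta)
    then show ?thesis
      unfolding ribbon_diagram_Cons \<alpha>(3) image_Un product_swap by auto
  qed
  finally show ?thesis
    using \<alpha>(1,2) by (auto simp: transposed_def composition_def)
qed

lemma transposed_ones:
  assumes "transposed \<alpha> (\<delta> @ [c])"
  shows "transposed (replicate n 1 @ \<alpha>) (\<delta> @ [c + n])"
proof (induction n)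
  case (Suc n)
  then show ?case using transposed_Cons[OF Suc, of 1] by simp
qed (simp add: assms)

text \<open>Each run of ones is a column that also takes one cell from the row before and one from
  the row behind it. A row \<open>w\<close> of length 1 would fuse the two columns into one.\<close>

lemma transpose_two_runs:
  assumes "p > 0" "w \<ge> 2" "x > 0"
  shows "filter_mset ((<) 1) (mset (comp_transpose (p # replicate i 1 @ w # replicate j 1 @ [x]))) = {#i + 2, j + 2#}"
proof -
  have "transposed (replicate j 1 @ [x]) (replicate (x - 1) 1 @ [1 + j])"
    by (intro transposed_ones transposed_single assms)
  then have "transposed (w # replicate j 1 @ [x]) (replicate (x - 1) 1 @ [Suc (1 + j)] @ replicate (w - 1) 1)"
    using assms by (intro transposed_Cons) auto
  also have "replicate (x - 1) 1 @ [Suc (1 + j)] @ replicate (w - 1) 1 =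
      (replicate (x - 1) 1 @ [j + 2] @ replicate (w - 2) 1) @ [1 :: nat]"
  proof -
    obtain w' where "w = w' + 2" using assms(2) by (metis add.commute le_Suc_ex)
    then show ?thesis by (simp add: replicate_append_same)
  qed
  finally have "transposed (replicate i 1 @ w # replicate j 1 @ [x])
      ((replicate (x - 1) 1 @ [j + 2] @ replicate (w - 2) 1) @ [1 + i])"
    by (rule transposed_ones)
  then have "transposed (p # replicate i 1 @ w # replicate j 1 @ [x])
      ((replicate (x - 1) 1 @ [j + 2] @ replicate (w - 2) 1) @ [Suc (1 + i)] @ replicate (p - 1) 1)"
    using assms by (intro transposed_Cons) auto
  then have "comp_transpose (p # replicate i 1 @ w # replicate j 1 @ [x]) =
      (replicate (x - 1) 1 @ [j + 2] @ replicate (w - 2) 1) @ [Suc (1 + i)] @ replicate (p - 1) 1"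
    using assms by (intro comp_transpose_eq) (auto simp: composition_def)
  then show ?thesis by (simp add: filter_replicate_mset)
qed

lemma transpose_one_run:
  assumes "p > 0" "x > 0"
  shows "filter_mset ((<) 1) (mset (comp_transpose (p # replicate n 1 @ [x]))) = {#n + 2#}"
proof -
  have "transposed (replicate n 1 @ [x]) (replicate (x - 1) 1 @ [1 + n])"
    by (intro transposed_ones transposed_single assms)
  then have "transposed (p # replicate n 1 @ [x]) (replicate (x - 1) 1 @ [Suc (1 + n)] @ replicate (p - 1) 1)"
    using assms by (intro transposed_Cons) auto
  then have "comp_transpose (p # replicate n 1 @ [x]) =
      replicate (x - 1) 1 @ [Suc (1 + n)] @ replicate (p - 1) 1"
    using assms by (intro comp_transpose_eq) (auto simp: composition_def)
  then show ?thesis by (simp add: filter_replicate_mset)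
qed

lemma single_among_ones:
  assumes "mset \<gamma> = add_mset w (replicate_mset d 1)"
  obtains i j where "i + j = d" "\<gamma> = replicate i 1 @ w # replicate j 1"
proof -
  have "w \<in> set \<gamma>" using assms by (metis set_mset_mset union_single_eq_member)
  then obtain ys zs where s: "\<gamma> = ys @ w # zs" by (meson split_list)
  have "mset ys + mset zs = replicate_mset d 1" using assms by (simp add: s)
  from arg_cong[OF this, of set_mset] arg_cong[OF this, of size]
  have m: "set ys \<union> set zs \<subseteq> {1}" "length ys + length zs = d"
    by (simp_all split: if_splits)
  then have "ys = replicate (length ys) 1" "zs = replicate (length zs) 1"
    by (auto intro!: replicate_length_same[symmetric])
  then show ?thesis using that[of "length ys" "length zs"] s m(2) by simp
qed

lemma oriented_ends:
  assumes "{#p, q#} = {#x, s#}"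
  obtains \<gamma>' where "s # \<gamma>' @ [x] \<in> {p # \<gamma> @ [q], rev (p # \<gamma> @ [q])}" "mset \<gamma>' = mset \<gamma>"
proof -
  have "p = s \<and> q = x \<or> p = x \<and> q = s" using assms by (auto simp: add_eq_conv_ex)
  then show ?thesis
  proof
    assume "p = s \<and> q = x"
    then show ?thesis using that[of \<gamma>] by simp
  next
    assume "p = x \<and> q = s"
    then show ?thesis using that[of "rev \<gamma>"] by simp
  qed
qed

lemma rev_two_runs:
  "rev (p # replicate i 1 @ w # replicate j 1 @ [x]) = x # replicate j 1 @ w # replicate i 1 @ [p]"
  by simp

lemma shapes_of_schur:
  fixes \<alpha> \<beta> \<nu> :: "nat list"
  assumes comp: "composition \<alpha>" "composition \<beta>" and len: "length \<alpha> = length \<beta>"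
    and ms: "mset \<alpha> = mset \<beta>" and tr: "mset (comp_transpose \<alpha>) = mset (comp_transpose \<beta>)"
    and ne: "ends \<alpha> \<noteq> ends \<beta>" and \<nu>: "is_partition \<nu>"
    and diff: "\<And>M. tableau_series (ribbon_diagram \<alpha>) M - tableau_series (ribbon_diagram \<beta>) M =
      tableau_series (young_diagram \<nu>) M"
  shows "\<exists>a b d x w i j i' j'. \<nu> = [a, b] @ replicate d 1 \<and> b \<le> a \<and> 3 \<le> b \<and> b - 1 < w \<and> x > 0 \<and>
    (b - 1) # replicate i 1 @ w # replicate j 1 @ [x] \<in> {\<alpha>, rev \<alpha>} \<and>
    w # replicate i' 1 @ (b - 1) # replicate j' 1 @ [x] \<in> {\<beta>, rev \<beta>} \<and>
    (x = 1 \<and> w = a \<or> x = a - b + 1 \<and> w = b) \<and> i + j = d \<and>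
    (i' = i \<and> j' = j \<or> i' = j \<and> j' = i)"
proof -
  have long: "length \<alpha> \<ge> 2"
  proof (rule ccontr)
    assume "\<not> length \<alpha> \<ge> 2"
    then consider "length \<alpha> = 0" | "length \<alpha> = 1" by linarith
    then have "\<alpha> = \<beta>"
    proof cases
      case 2
      then obtain k where "\<alpha> = [k]" by (metis One_nat_def length_0_conv length_Suc_conv)
      moreover obtain l where "\<beta> = [l]" using 2 len by (metis One_nat_def length_0_conv length_Suc_conv)
      ultimately show ?thesis using ms by simp
    qed (use len in simp)
    then show False using ne by simp
  qed
  have split: "\<exists>p \<gamma> q. \<delta> = p # \<gamma> @ [q]" if "length \<delta> \<ge> 2" for \<delta> :: "nat list"
    using that by (cases \<delta>; cases "tl \<delta>" rule: rev_cases) auto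
  obtain p \<gamma> q where \<alpha>: "\<alpha> = p # \<gamma> @ [q]" using split[OF long] by blast
  obtain p' \<gamma>' q' where \<beta>: "\<beta> = p' # \<gamma>' @ [q']" using split[of \<beta>] long len by auto
  have ne': "{#p, q#} \<noteq> {#p', q'#}" using ne by (simp add: \<alpha> \<beta> ends_def)
  obtain a b d x w where 1: "\<nu> = [a, b] @ replicate d 1" "b \<le> a" "2 \<le> b" "b - 1 < w"
    "{#p, q#} = {#x, b - 1#}" "{#p', q'#} = {#x, w#}"
    "mset \<gamma> = add_mset w (replicate_mset d 1)" "mset \<gamma>' = add_mset (b - 1) (replicate_mset d 1)"
    "x = 1 \<and> w = a \<or> x = a - b + 1 \<and> w = b"
    using near_hook_of_schur[OF comp[unfolded \<alpha> \<beta>] ms[unfolded \<alpha> \<beta>] ne' \<nu> diff[unfolded \<alpha> \<beta>]] by blast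
  have x: "x > 0" using 1(9) by auto
  obtain \<gamma>1 where g1: "(b - 1) # \<gamma>1 @ [x] \<in> {\<alpha>, rev \<alpha>}" "mset \<gamma>1 = mset \<gamma>"
    using oriented_ends[OF 1(5), of \<gamma>] unfolding \<alpha> by blast
  obtain \<gamma>2 where g2: "w # \<gamma>2 @ [x] \<in> {\<beta>, rev \<beta>}" "mset \<gamma>2 = mset \<gamma>'"
    using oriented_ends[OF 1(6), of \<gamma>'] unfolding \<beta> by blast
  obtain i j where ij: "i + j = d" "\<gamma>1 = replicate i 1 @ w # replicate j 1"
    using single_among_ones[of \<gamma>1 w d] g1(2) 1(7) by metis
  obtain i' j' where ij': "i' + j' = d" "\<gamma>2 = replicate i' 1 @ (b - 1) # replicate j' 1"
    using single_among_ones[of \<gamma>2 "b - 1" d] g2(2) 1(8) by metis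
  have in1: "(b - 1) # replicate i 1 @ w # replicate j 1 @ [x] \<in> {\<alpha>, rev \<alpha>}" using g1(1) by (simp add: ij)
  have in2: "w # replicate i' 1 @ (b - 1) # replicate j' 1 @ [x] \<in> {\<beta>, rev \<beta>}" using g2(1) by (simp add: ij')
  let ?t = "\<lambda>\<delta>. filter_mset ((<) 1) (mset (comp_transpose \<delta>))"
  have ta: "?t \<alpha> = {#i + 2, j + 2#}"
  proof -
    have "\<alpha> = (b - 1) # replicate i 1 @ w # replicate j 1 @ [x] \<or> \<alpha> = x # replicate j 1 @ w # replicate i 1 @ [b - 1]"
      using in1 rev_two_runs[of "b - 1" i w j x] by (metis insertE rev_rev_ident singletonD)
    then show ?thesis
      using transpose_two_runs[of "b - 1" w x i j] transpose_two_runs[of x w "b - 1" j i] 1(3,4) x by auto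
  qed
  \<comment> \<open>For \<open>b = 2\<close> the inner row \<open>b - 1\<close> of \<beta> is itself
    a 1, so \<beta> has a single long column, of \<open>d + 3\<close> cells. But \<alpha> has two of
    them, since \<open>w > 1\<close>.\<close>
  have b: "3 \<le> b"
  proof (rule ccontr)
    assume "\<not> 3 \<le> b"
    then have "b - 1 = 1" using 1(3) by simp
    moreover have run: "replicate i' 1 @ 1 # replicate j' (1 :: nat) @ [y] = replicate (d + 1) 1 @ [y]"
        "replicate j' 1 @ 1 # replicate i' (1 :: nat) @ [y] = replicate (d + 1) 1 @ [y]" for y
      using ij'(1) by (simp_all add: replicate_add[symmetric] flip: replicate_Suc append_assoc add_Suc_right)
    moreover have "\<beta> = w # replicate i' 1 @ (b - 1) # replicate j' 1 @ [x] \<or>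
        \<beta> = x # replicate j' 1 @ (b - 1) # replicate i' 1 @ [w]"
      using in2 rev_two_runs[of w i' "b - 1" j' x] by (metis insertE rev_rev_ident singletonD)
    ultimately have "\<beta> = w # replicate (d + 1) 1 @ [x] \<or> \<beta> = x # replicate (d + 1) 1 @ [w]"
      by metis
    then have "?t \<beta> = {#d + 3#}"
      using transpose_one_run[of w x "d + 1"] transpose_one_run[of x w "d + 1"] x 1(4) by auto
    then show False using ta tr by (metis add_mset_eq_single empty_not_add_mset)
  qed
  have "?t \<beta> = {#i' + 2, j' + 2#}"
  proof -
    have "\<beta> = w # replicate i' 1 @ (b - 1) # replicate j' 1 @ [x] \<or>
        \<beta> = x # replicate j' 1 @ (b - 1) # replicate i' 1 @ [w]"
      using in2 rev_two_runs[of w i' "b - 1" j' x] by (metis insertE rev_rev_ident singletonD)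
    then show ?thesis
      using transpose_two_runs[of w "b - 1" x i' j'] transpose_two_runs[of x "b - 1" w j' i'] b 1(4) x by auto
  qed
  \<comment> \<open>Both ribbons have two long inner stretches of columns accounted for by their
    runs, so equal column lengths leave the run lengths equal up to order.\<close>
  then have "{#i + 2, j + 2#} = {#i' + 2, j' + 2#}" using ta tr by simp
  then have ij'': "i' = i \<and> j' = j \<or> i' = j \<and> j' = i" by (auto simp: add_eq_conv_ex)
  show ?thesis
    by (rule exI[of _ a], rule exI[of _ b], rule exI[of _ d], rule exI[of _ x],
        rule exI[of _ w], rule exI[of _ i], rule exI[of _ j], rule exI[of _ i'],
        rule exI[of _ j'], intro conjI 1(1,2,4,9) b x in1 in2 ij(1) ij'')
qed

section \<open>The arrangement of the inner rows\<close>

text \<open>The recursion at the other end. Combined with the defining one it makes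
  \<open>rib\<close> invariant under reversal, which is needed because the ribbons are known only up
  to orientation.\<close>

lemma rib_snoc: "rib H (\<gamma> @ [m, n]) = rib H (\<gamma> @ [m]) * H n - rib H (\<gamma> @ [m + n])"
proof (induction "length \<gamma>" arbitrary: \<gamma> m n rule: less_induct)
  case less
  consider "\<gamma> = []" | a where "\<gamma> = [a]" | a b \<delta> where "\<gamma> = a # b # \<delta>"
    by (metis neq_Nil_conv)
  then show ?case
  proof cases
    case (3 a b \<delta>)
    have eqs: "rib H ((b # \<delta>) @ [m, n]) = rib H ((b # \<delta>) @ [m]) * H n - rib H ((b # \<delta>) @ [m + n])"
      "rib H (((a + b) # \<delta>) @ [m, n]) = rib H (((a + b) # \<delta>) @ [m]) * H n - rib H (((a + b) # \<delta>) @ [m + n])"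
      by (rule less; simp add: 3)+
    show ?thesis by (simp add: 3 eqs[simplified] algebra_simps)
  qed (auto simp: algebra_simps)
qed

lemma rib_rev: "rib H (rev \<alpha>) = rib H \<alpha>"
proof (induction "length \<alpha>" arbitrary: \<alpha> rule: less_induct)
  case less
  consider "\<alpha> = []" | a where "\<alpha> = [a]" | n m \<gamma> where "\<alpha> = n # m # \<gamma>"
    by (metis neq_Nil_conv)
  then show ?case
  proof cases
    case (3 n m \<gamma>)
    have "rib H (rev (m # \<gamma>)) = rib H (m # \<gamma>)" "rib H (rev ((n + m) # \<gamma>)) = rib H ((n + m) # \<gamma>)"
      by (rule less; simp add: 3)+
    then show ?thesis using rib_snoc[of H "rev \<gamma>" m n] by (simp add: 3 add.commute mult.commute)
  qed auto
qed

text \<open>For \<open>w = 1\<close> a row of length \<open>n > 0\<close> evaluates to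
  \<open>hcoeff n * u + hcoeff (n + 1)\<close>, so one function yields both coefficients. As
  \<open>hcoeff 1 = 1\<close>, rows of length 1 leave the leading coefficient of a ribbon
  unchanged.\<close>

definition hcoeff :: "nat \<Rightarrow> real" where
  "hcoeff m = 3 / 2 * 2 ^ m - 2"

lemma hcoeff_Suc: "hcoeff (m + 1) = 2 * hcoeff m + 2" "hcoeff (Suc m) = 2 * hcoeff m + 2"
  and hcoeff_0_1 [simp]: "hcoeff 0 = - 1 / 2" "hcoeff (Suc 0) = 1" "hcoeff 1 = 1"
  by (simp_all add: hcoeff_def)

lemma hcoeff_add: "3 * hcoeff (m + n) = 2 * hcoeff m * hcoeff n + 4 * hcoeff m + 4 * hcoeff n + 2"
  by (simp add: hcoeff_def power_add algebra_simps)

lemma hcoeff_less_iff: "hcoeff m < hcoeff n \<longleftrightarrow> m < n" and hcoeff_eq_iff: "hcoeff m = hcoeff n \<longleftrightarrow> m = n"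
  by (simp_all add: hcoeff_def)

section \<open>The three top coefficients of a ribbon evaluation in \<open>u\<close>\<close>

definition top_coeff :: "nat list \<Rightarrow> real" where
  "top_coeff \<alpha> = (\<Prod>k\<leftarrow>\<alpha>. hcoeff k)"

fun second_coeff :: "nat list \<Rightarrow> real" where
  "second_coeff [] = 0"
| "second_coeff [n] = hcoeff (n + 1)"
| "second_coeff (n # m # \<gamma>) = hcoeff (n + 1) * top_coeff (m # \<gamma>) + hcoeff n * second_coeff (m # \<gamma>) - top_coeff ((n + m) # \<gamma>)"

text \<open>For one row the value 0 stands for the coefficient of \<open>u^(-1)\<close>; with it the
  recursion is correct already for two rows.\<close>

fun third_coeff :: "nat list \<Rightarrow> real" where
  "third_coeff [] = 0"
| "third_coeff [n] = 0"
| "third_coeff (n # m # \<gamma>) = hcoeff (n + 1) * second_coeff (m # \<gamma>) + hcoeff n * third_coeff (m # \<gamma>) - second_coeff ((n + m) # \<gamma>)"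

lemma top_coeff_simps [simp]: "top_coeff [] = 1" "top_coeff (n # \<gamma>) = hcoeff n * top_coeff \<gamma>" "top_coeff (\<gamma> @ \<delta>) = top_coeff \<gamma> * top_coeff \<delta>"
    "top_coeff (replicate k (Suc 0)) = 1" "top_coeff (replicate k 1) = 1"
  by (simp_all add: top_coeff_def)

text \<open>Each row contributes one degree in \<open>u\<close>. The merged ribbon has one row less,
  so it enters the coefficients one place later than the product does.\<close>

lemma coeff_rib:
  assumes H: "\<And>n. n > 0 \<Longrightarrow> H n = [:hcoeff (n + 1), hcoeff n:]" and "composition \<alpha>" "\<alpha> \<noteq> []"
  shows "(\<forall>k > length \<alpha>. coeff (rib H \<alpha>) k = 0) \<and> coeff (rib H \<alpha>) (length \<alpha>) = top_coeff \<alpha> \<and>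
    coeff (rib H \<alpha>) (length \<alpha> - 1) = second_coeff \<alpha> \<and> (length \<alpha> \<ge> 2 \<longrightarrow> coeff (rib H \<alpha>) (length \<alpha> - 2) = third_coeff \<alpha>)"
  using assms(2,3)
proof (induction "length \<alpha>" arbitrary: \<alpha> rule: less_induct)
  case less
  consider n where "\<alpha> = [n]" | n m \<gamma> where "\<alpha> = n # m # \<gamma>"
    using less(3) by (metis neq_Nil_conv)
  then show ?case
  proof cases
    case (1 n)
    then have "H n = [:hcoeff (n + 1), hcoeff n:]" using less(2) by (intro H) (simp add: composition_def)
    then show ?thesis by (auto simp: 1 coeff_pCons split: nat.splits)
  next
    case (2 n m \<gamma>)
    let ?f = "rib H (m # \<gamma>)" and ?g = "rib H ((n + m) # \<gamma>)"
    define l where "l = length \<gamma>"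
    have c: "composition (m # \<gamma>)" "composition ((n + m) # \<gamma>)" "n > 0"
      using less(2) by (auto simp: 2 composition_def)
    have f: "\<forall>k > Suc l. coeff ?f k = 0" "coeff ?f (Suc l) = top_coeff (m # \<gamma>)" "coeff ?f l = second_coeff (m # \<gamma>)"
      "l \<ge> 1 \<Longrightarrow> coeff ?f (l - 1) = third_coeff (m # \<gamma>)"
      using less(1)[OF _ c(1)] by (auto simp: 2 l_def Suc_le_eq numeral_2_eq_2)
    have g: "\<forall>k > Suc l. coeff ?g k = 0" "coeff ?g (Suc l) = top_coeff ((n + m) # \<gamma>)" "coeff ?g l = second_coeff ((n + m) # \<gamma>)"
      using less(1)[OF _ c(2)] by (auto simp: 2 l_def)
    have S: "coeff (rib H \<alpha>) (Suc k) = hcoeff (n + 1) * coeff ?f (Suc k) + hcoeff n * coeff ?f k - coeff ?g (Suc k)" for k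
      by (simp add: 2 H[OF c(3)])
    have Z: "coeff (rib H \<alpha>) 0 = hcoeff (n + 1) * coeff ?f 0 - coeff ?g 0"
      by (simp add: 2 H[OF c(3)])
    have rec: "top_coeff \<alpha> = hcoeff n * top_coeff (m # \<gamma>)" "length \<alpha> = Suc (Suc l)"
      "second_coeff \<alpha> = hcoeff (n + 1) * top_coeff (m # \<gamma>) + hcoeff n * second_coeff (m # \<gamma>) - top_coeff ((n + m) # \<gamma>)"
      "third_coeff \<alpha> = hcoeff (n + 1) * second_coeff (m # \<gamma>) + hcoeff n * third_coeff (m # \<gamma>) - second_coeff ((n + m) # \<gamma>)"
      by (simp_all only: 2 second_coeff.simps third_coeff.simps top_coeff_simps l_def length_Cons)
    have "coeff (rib H \<alpha>) k = 0" if k: "k > Suc (Suc l)" for k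
    proof -
      obtain k' where "k = Suc k'" "k' > Suc l" using k by (cases k) auto
      then show ?thesis using f(1) g(1) by (simp add: S del: rib.simps)
    qed
    moreover have "coeff (rib H \<alpha>) (Suc (Suc l)) = top_coeff \<alpha>"
      unfolding S rec using f(1,2) g(1) by simp
    moreover have "coeff (rib H \<alpha>) (Suc l) = second_coeff \<alpha>"
      unfolding S rec f(2,3) g(2) ..
    moreover have "coeff (rib H \<alpha>) l = third_coeff \<alpha>"
    proof (cases l)
      case 0
      then have "third_coeff (m # \<gamma>) = 0" by (simp add: l_def)
      then show ?thesis using f(3) g(3) Z unfolding rec 0 by simp
    next
      case (Suc l')
      then show ?thesis using f(3,4) g(3) S[of l'] unfolding rec by simp
    qed
    ultimately show ?thesis unfolding rec(2) by simp
  qed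
qed

text \<open>The correction caused by a row \<open>m\<close> that is followed, after \<open>i\<close>
  ones, by a row \<open>w\<close>. It depends on \<open>i\<close> only through \<open>i = 0\<close>;
  this is all that the second coefficient can detect.\<close>

definition run_term :: "nat \<Rightarrow> nat \<Rightarrow> nat \<Rightarrow> real" where
  "run_term m i w = (if i = 0 then 2 / 3 * (2 * hcoeff m + 1) * (hcoeff w - 1) else 2 * hcoeff m * (hcoeff w - 1))"

text \<open>The interaction of two adjacent rows,
  \<open>hcoeff (m + 1) * hcoeff n - hcoeff (m + n)\<close>, factors by \<open>hcoeff_add\<close>
  and vanishes for \<open>n = 1\<close>. Hence only the last 1 of a run interacts with the row
  behind the run.\<close>

lemma second_coeff_Cons: "second_coeff (m # n # \<gamma>) = hcoeff m * second_coeff (n # \<gamma>) + 2 / 3 * (2 * hcoeff m + 1) * (hcoeff n - 1) * top_coeff \<gamma>"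
proof -
  have "hcoeff (m + 1) * hcoeff n - hcoeff (m + n) = 2 / 3 * (2 * hcoeff m + 1) * (hcoeff n - 1)"
  proof -
    have "hcoeff (m + n) = (2 * hcoeff m * hcoeff n + 4 * hcoeff m + 4 * hcoeff n + 2) / 3" using hcoeff_add[of m n] by simp
    then show ?thesis by (simp add: hcoeff_Suc field_simps)
  qed
  then have "hcoeff (m + 1) * hcoeff n * top_coeff \<gamma> - hcoeff (m + n) * top_coeff \<gamma> = 2 / 3 * (2 * hcoeff m + 1) * (hcoeff n - 1) * top_coeff \<gamma>"
    by (metis left_diff_distrib)
  then show ?thesis by (simp add: algebra_simps)
qed

lemma second_coeff_Cons_1: "second_coeff (m # Suc 0 # \<gamma>) = hcoeff m * second_coeff (Suc 0 # \<gamma>)"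
  by (simp only: second_coeff_Cons) simp

lemma second_coeff_ones_Cons: "second_coeff (replicate (Suc i) (Suc 0) @ w # \<gamma>) = second_coeff (w # \<gamma>) + 2 * (hcoeff w - 1) * top_coeff \<gamma>"
proof (induction i)
  case 0
  show ?case by (simp only: replicate.simps append.simps second_coeff_Cons) simp
next
  case (Suc i)
  then show ?case using second_coeff_Cons_1[of "Suc 0" "replicate i (Suc 0) @ w # \<gamma>"] by simp
qed

lemma second_coeff_run: "second_coeff (m # replicate i (Suc 0) @ w # \<gamma>) = hcoeff m * second_coeff (w # \<gamma>) + run_term m i w * top_coeff \<gamma>"
proof (cases i)
  case 0
  then show ?thesis by (simp only: replicate.simps append.simps second_coeff_Cons run_term_def) simp
next
  case (Suc i')
  then have "second_coeff (m # replicate i (Suc 0) @ w # \<gamma>) = hcoeff m * second_coeff (replicate (Suc i') (Suc 0) @ w # \<gamma>)"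
    using second_coeff_Cons_1[of m "replicate i' (Suc 0) @ w # \<gamma>"] by simp
  then show ?thesis unfolding second_coeff_ones_Cons by (simp add: run_term_def Suc algebra_simps)
qed

lemma second_coeff_two_runs:
  "second_coeff (p # replicate i (Suc 0) @ w # replicate j (Suc 0) @ [x]) =
    hcoeff p * (hcoeff w * (2 * hcoeff x + 2) + run_term w j x) + run_term p i w * hcoeff x"
  by (simp add: second_coeff_run hcoeff_Suc)

text \<open>A column of \<open>n\<close> cells evaluates to the coefficient of \<open>t^n\<close> in
  \<open>(1 + t) (1 + 2 t) / ((1 - u t) (1 - t))\<close>. Without the factor \<open>1 - u t\<close>
  this series starts 1, 4, 6, the origin of the 4 here and of the 6 for the third
  coefficient.\<close>

lemma second_coeff_ones: "second_coeff (replicate (Suc k) (Suc 0)) = 4"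
proof (induction k)
  case 0
  then show ?case by (simp add: hcoeff_def)
next
  case (Suc k)
  then show ?case using second_coeff_Cons_1[of "Suc 0" "replicate k (Suc 0)"] by simp
qed

lemma third_coeff_ones: "third_coeff (replicate (Suc (Suc k)) (Suc 0)) = 6"
proof (induction k)
  case 0
  then show ?case by (simp add: hcoeff_def)
next
  case (Suc k)
  have "third_coeff (replicate (Suc (Suc (Suc k))) (Suc 0)) = 4 * second_coeff (replicate (Suc (Suc k)) (Suc 0)) + 6 -
      second_coeff (Suc (Suc 0) # replicate (Suc k) (Suc 0))"
    using Suc by (simp add: hcoeff_def)
  then show ?case
    using second_coeff_Cons_1[of "Suc (Suc 0)" "replicate k (Suc 0)"] second_coeff_ones[of "Suc k"] second_coeff_ones[of k]
    by (simp add: hcoeff_def)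
qed

lemma second_coeff_Cons_ones: "second_coeff (n # replicate (Suc k) (Suc 0)) = 4 * hcoeff n"
  using second_coeff_Cons_1[of n "replicate k (Suc 0)"] second_coeff_ones[of k] by simp

lemma third_coeff_Cons_ones: "third_coeff (n # replicate (Suc (Suc k)) (Suc 0)) = 6 * hcoeff n"
proof -
  have "third_coeff (n # replicate (Suc (Suc k)) (Suc 0)) =
      hcoeff (n + 1) * second_coeff (replicate (Suc (Suc k)) (Suc 0)) + hcoeff n * third_coeff (replicate (Suc (Suc k)) (Suc 0)) -
      second_coeff ((n + 1) # replicate (Suc k) (Suc 0))"
    by simp
  then show ?thesis unfolding second_coeff_ones third_coeff_ones second_coeff_Cons_ones by simp
qed

text \<open>This covers the arrangement that the second coefficient leaves open: end row 1 and both
  runs nonempty, so only ones follow \<open>n\<close>. The value still tells a run of a single 1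
  from a longer one, and is stationary from two ones on.\<close>

lemma third_coeff_run:
  fixes m i n k :: nat
  shows "third_coeff (m # replicate (Suc i) (Suc 0) @ n # replicate (Suc (Suc k)) (Suc 0)) =
    (if i = 0 then 46 / 3 * hcoeff m * hcoeff n - 28 / 3 * hcoeff m + 2 / 3 * hcoeff n - 2 / 3 else hcoeff m * (16 * hcoeff n - 10))"
proof -
  let ?G = "n # replicate (Suc (Suc k)) (Suc 0)"
  let ?R = "\<lambda>i. replicate i (Suc 0) @ ?G"
  have G: "second_coeff ?G = 4 * hcoeff n" "third_coeff ?G = 6 * hcoeff n" "top_coeff (replicate (Suc (Suc k)) (Suc 0)) = 1"
    by (rule second_coeff_Cons_ones third_coeff_Cons_ones top_coeff_simps)+
  have step: "third_coeff (m # ?R (Suc i)) = hcoeff (m + 1) * second_coeff (?R (Suc i)) + hcoeff m * third_coeff (?R (Suc i)) - second_coeff ((m + 1) # ?R i)" for m i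
    by simp
  have s: "second_coeff (?R (Suc i)) = 6 * hcoeff n - 2" for i
    unfolding second_coeff_ones_Cons G by simp
  have s': "second_coeff (m # ?R i) = hcoeff m * (4 * hcoeff n) + run_term m i n" for m i
    unfolding second_coeff_run G by simp
  have u1: "third_coeff (?R 1) = 14 * hcoeff n - 8"
  proof -
    have "third_coeff (?R 1) = third_coeff (Suc 0 # ?G)" by simp
    also have "\<dots> = hcoeff (Suc 0 + 1) * second_coeff ?G + hcoeff (Suc 0) * third_coeff ?G - second_coeff ((Suc 0 + n) # replicate (Suc (Suc k)) (Suc 0))"
      by (rule third_coeff.simps(3))
    also have "\<dots> = 14 * hcoeff n - 8" unfolding G second_coeff_Cons_ones by (simp add: hcoeff_Suc)
    finally show ?thesis .
  qed
  have u: "third_coeff (?R (Suc (Suc i))) = 16 * hcoeff n - 10" for i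
  proof (induction i)
    case 0
    have "third_coeff (?R (Suc (Suc 0))) = third_coeff (1 # ?R (Suc 0))" by simp
    then show ?case
      unfolding step s s' unfolding u1[unfolded One_nat_def] by (simp add: run_term_def hcoeff_Suc field_simps)
  next
    case (Suc i)
    have "third_coeff (?R (Suc (Suc (Suc i)))) = third_coeff (1 # ?R (Suc (Suc i)))" by simp
    then show ?case unfolding step s s' using Suc by (simp add: run_term_def hcoeff_Suc algebra_simps)
  qed
  show ?thesis
  proof (cases i)
    case 0
    show ?thesis
      unfolding step s s' unfolding 0 u1[unfolded One_nat_def] by (simp add: run_term_def hcoeff_Suc field_simps)
  next
    case (Suc i')
    then show ?thesis unfolding step s s' Suc u by (simp add: run_term_def hcoeff_Suc algebra_simps)
  qed
qed

text \<open>The column of \<open>d + 2\<close> cells has top coefficients 1 and 4, which gives the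
  factors 6 and \<open>4 * 6\<close>. The ribbons have \<open>d + 3\<close> rows, so the
  coefficients in question belong to \<open>u^(d + 2)\<close> and \<open>u^(d + 1)\<close>; the
  latter exponent is at least 2 only for \<open>d > 0\<close>, as \<open>coeff_ev_near_hook\<close>
  requires.\<close>

lemma top_coefficients_of_schur:
  fixes \<alpha>' \<beta>' :: "nat list"
  assumes comp: "composition \<alpha>" "composition \<beta>" and ab: "b \<le> a" "b \<ge> 2"
    and diff: "\<And>M. tableau_series (ribbon_diagram \<alpha>) M - tableau_series (ribbon_diagram \<beta>) M =
      tableau_series (young_diagram ([a, b] @ replicate d 1)) M"
    and \<alpha>': "\<alpha>' \<in> {\<alpha>, rev \<alpha>}" "length \<alpha>' = d + 3" and \<beta>': "\<beta>' \<in> {\<beta>, rev \<beta>}" "length \<beta>' = d + 3"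
  shows "second_coeff \<alpha>' - second_coeff \<beta>' = 6 * (2 ^ (a - 1) - 2 ^ (b - 2))"
    and "d > 0 \<Longrightarrow> third_coeff \<alpha>' - third_coeff \<beta>' = 24 * (2 ^ (a - 1) - 2 ^ (b - 2))"
proof -
  define x where "x = (weights [:0, 1:] 1 :: nat \<Rightarrow> real poly)"
  define H where "H n = ev even_letter letters x ({0} \<times> {0..<n})" for n
  have H: "H n = [:hcoeff (n + 1), hcoeff n:]" if n: "n > 0" for n
  proof -
    obtain m where m: "n = Suc m" using n by (cases n) auto
    have "(2 :: real poly) ^ k = [:2 ^ k:]" for k
      by (induction k) (simp_all add: numeral_poly)
    then show ?thesis
      unfolding H_def x_def m ev_row by (simp add: hcoeff_def numeral_poly one_pCons)
  qed
  have rib: "ev even_letter letters x (ribbon_diagram \<delta>) = rib H \<delta>" if "composition \<delta>" "\<delta> \<noteq> []" for \<delta>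
    unfolding H_def by (rule ev_ribbon) (use that in auto)
  have ne: "\<alpha> \<noteq> []" "\<beta> \<noteq> []" using \<alpha>' \<beta>' by auto
  have comp': "composition \<alpha>'" "composition \<beta>'" "\<alpha>' \<noteq> []" "\<beta>' \<noteq> []"
    using comp \<alpha>' \<beta>' by (auto simp: composition_def)
  have one: "composition (replicate (d + 2) 1)" "replicate (d + 2) (1 :: nat) \<noteq> []"
    by (auto simp: composition_def)
  have "rib H \<alpha>' - rib H \<beta>' = rib H \<alpha> - rib H \<beta>" using \<alpha>'(1) \<beta>'(1) by (auto simp: rib_rev)
  also have "\<dots> = ev even_letter letters x (young_diagram ([a, b] @ replicate d 1))"
    using ev_transfer[OF _ _ _ _ diff, of letters even_letter x]
    unfolding rib[OF comp(1) ne(1)] rib[OF comp(2) ne(2)] by simp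
  finally have eq0: "rib H \<alpha>' - rib H \<beta>' = ev even_letter letters x (young_diagram ([a, b] @ replicate d 1))" .
  have eq: "coeff (rib H \<alpha>') r - coeff (rib H \<beta>') r =
      coeff (rib H (replicate (d + 2) 1)) r * (6 * (2 ^ (a - 1) - 2 ^ (b - 2)))" if "r \<ge> 2" for r
    using coeff_ev_near_hook[OF ab that, of d]
    unfolding x_def[symmetric] rib[OF one] coeff_diff[symmetric] eq0 .
  have "coeff (rib H (replicate (d + 2) 1)) (d + 2) = 1"
    using coeff_rib[OF H one] by simp
  then show "second_coeff \<alpha>' - second_coeff \<beta>' = 6 * (2 ^ (a - 1) - 2 ^ (b - 2))"
    using eq[of "d + 2"] coeff_rib[OF H comp'(1,3)] coeff_rib[OF H comp'(2,4)] \<alpha>'(2) \<beta>'(2) by simp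
  assume "d > 0"
  have "coeff (rib H (replicate (d + 2) 1)) (d + 1) = 4"
    using coeff_rib[OF H one] second_coeff_ones[of "d + 1"] by simp
  then show "third_coeff \<alpha>' - third_coeff \<beta>' = 24 * (2 ^ (a - 1) - 2 ^ (b - 2))"
    using eq[of "d + 1"] coeff_rib[OF H comp'(1,3)] coeff_rib[OF H comp'(2,4)] \<alpha>'(2) \<beta>'(2) \<open>d > 0\<close> by simp
qed

text \<open>The equation sees only which runs are empty. If the runs keep their places and the last
  one is empty, it holds identically. If both last runs are nonempty and the first ones are alike in
  emptiness, it says \<open>x = 1\<close>. If an empty run changes sides, it makes \<open>x\<close>
  equal to \<open>p\<close> or \<open>w\<close>, and then reversing one ribbon restores the first
  case.\<close>

lemma run_constraints:
  fixes p w x i j i' j' :: nat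
  assumes pw: "2 \<le> p" "p < w" and x: "x > 0"
    and ij: "i' = i \<and> j' = j \<or> i' = j \<and> j' = i"
    and S: "second_coeff (p # replicate i (Suc 0) @ w # replicate j (Suc 0) @ [x]) -
      second_coeff (w # replicate i' (Suc 0) @ p # replicate j' (Suc 0) @ [x]) = 2 / 3 * (hcoeff w - hcoeff p) * (2 * hcoeff x + 1)"
  shows "i' = i \<and> j' = j \<and> j = 0 \<or> x = 1 \<and> i' = i \<and> j' = j \<and> i = 0 \<or>
    x = 1 \<and> i > 0 \<and> j > 0 \<and> i' > 0 \<and> j' > 0 \<or>
    x = p \<and> i = 0 \<and> j' = 0 \<and> i' = j \<or> x = w \<and> j = 0 \<and> i' = 0 \<and> j' = i"
proof -
  define P W X where "P = hcoeff p" and "W = hcoeff w" and "X = hcoeff x"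
  have ne: "W \<noteq> P" "W > 1" "P > 1"
    using pw hcoeff_less_iff[of 1 p] hcoeff_less_iff[of 1 w] by (auto simp: P_def W_def hcoeff_eq_iff)
  have S': "P * (W * (2 * X + 2) + run_term w j x) + run_term p i w * X - (W * (P * (2 * X + 2) + run_term p j' x) + run_term w i' p * X) =
      2 / 3 * (W - P) * (2 * X + 1)"
    using S unfolding second_coeff_two_runs P_def W_def X_def .
  have X1: "x = 1" if "X = 1" using that hcoeff_eq_iff[of x 1] by (simp add: X_def)
  have Xp: "x = p" if "X = P" using that by (simp add: X_def P_def hcoeff_eq_iff)
  have Xw: "x = w" if "X = W" using that by (simp add: X_def W_def hcoeff_eq_iff)
  have same: "X = 1" if "j > 0" "j' > 0" "i = 0 \<longleftrightarrow> i' = 0"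
  proof -
    have "2 * (W - P) * (X - 1) = 0"
      using S' that
      by (cases "i = 0") (simp_all add: run_term_def P_def[symmetric] W_def[symmetric] X_def[symmetric] field_simps)
    then show ?thesis using ne by simp
  qed
  have front: "X = P" if "i = 0" "j > 0" "i' > 0" "j' = 0"
  proof -
    have "(X - P) * (W - 1) = 0"
      using S' that by (simp add: run_term_def P_def[symmetric] W_def[symmetric] X_def[symmetric] field_simps)
    then show ?thesis using ne by simp
  qed
  have rear: "X = W" if "i > 0" "j = 0" "i' = 0" "j' > 0"
  proof -
    have "(W - X) * (P - 1) = 0"
      using S' that by (simp add: run_term_def P_def[symmetric] W_def[symmetric] X_def[symmetric] field_simps)
    then show ?thesis using ne by simp
  qed
  show ?thesis using ij same front rear X1 Xp Xw by (metis gr0I)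
qed

theorem theorem3p11:
  fixes \<alpha> \<beta> \<nu> :: "nat list" and R N :: nat
  assumes "composition \<alpha>" and "composition \<beta>"
    and "length \<alpha> = R" and "length \<beta> = R"
    and "sum_list \<alpha> = N" and "sum_list \<beta> = N"
    and "\<alpha> \<noteq> replicate R 1"
    and "is_partition \<nu>" and "sum_list \<nu> = N"
    and "ribbon_schur \<alpha> - ribbon_schur \<beta> = schur \<nu>"
    and "part_sort \<alpha> = part_sort \<beta>"
    and "part_sort (comp_transpose \<alpha>) = part_sort (comp_transpose \<beta>)"
    and "ends \<alpha> \<noteq> ends \<beta>"
  shows "\<exists>a b d. \<nu> = [a, b] @ replicate d 1 \<and> b \<ge> 3 \<and>
    (\<exists>\<alpha>' \<in> {\<alpha>, rev \<alpha>}. \<exists>\<beta>' \<in> {\<beta>, rev \<beta>}.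
        \<alpha>' = replicate (d + 1) 1 @ [a, b - 1] \<and> \<beta>' = replicate (d + 1) 1 @ [b - 1, a]
      \<or> \<alpha>' = [1, a] @ replicate d 1 @ [b - 1] \<and> \<beta>' = [1, b - 1] @ replicate d 1 @ [a]
      \<or> \<alpha>' = [b - 1] @ replicate d 1 @ [b, a - b + 1] \<and>
        \<beta>' = [b] @ replicate d 1 @ [b - 1, a - b + 1])"
proof -
  have diff: "tableau_series (ribbon_diagram \<alpha>) M - tableau_series (ribbon_diagram \<beta>) M =
      tableau_series (young_diagram \<nu>) M" for M
    using fun_cong[OF assms(10), of M] by (simp add: ribbon_schur_def schur_def)
  have ms: "mset \<delta> = mset \<delta>'" if "part_sort \<delta> = part_sort \<delta>'" for \<delta> \<delta>'
    using arg_cong[OF that, of mset] by (simp add: part_sort_def)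
  obtain a b d x w i j i' j' where \<nu>: "\<nu> = [a, b] @ replicate d 1" and ab: "b \<le> a" "3 \<le> b" and w: "b - 1 < w"
    and x: "x > 0" and A: "(b - 1) # replicate i 1 @ w # replicate j 1 @ [x] \<in> {\<alpha>, rev \<alpha>}"
    and B: "w # replicate i' 1 @ (b - 1) # replicate j' 1 @ [x] \<in> {\<beta>, rev \<beta>}"
    and xw: "x = 1 \<and> w = a \<or> x = a - b + 1 \<and> w = b" and ij: "i + j = d"
    and ij': "i' = i \<and> j' = j \<or> i' = j \<and> j' = i"
    using shapes_of_schur[OF assms(1,2) trans[OF assms(3) assms(4)[symmetric]] ms[OF assms(11)]
        ms[OF assms(12)] assms(13,8) diff]
    by (elim exE conjE) (rule that)
  have rA: "rev ((b - 1) # replicate i 1 @ w # replicate j 1 @ [x]) \<in> {\<alpha>, rev \<alpha>}"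
    and rB: "rev (w # replicate i' 1 @ (b - 1) # replicate j' 1 @ [x]) \<in> {\<beta>, rev \<beta>}"
    using A B by (metis insertE insertI1 insertI2 rev_rev_ident singletonD)+
  have b2: "b \<ge> 2" using ab by simp
  have len: "length ((b - 1) # replicate i 1 @ w # replicate j 1 @ [x]) = d + 3"
    "length (w # replicate i' 1 @ (b - 1) # replicate j' 1 @ [x]) = d + 3"
    using ij ij' by auto
  note top = top_coefficients_of_schur[OF assms(1,2) ab(1) b2 diff[unfolded \<nu>] A len(1) B len(2)]
  \<comment> \<open>Since \<open>2 * hcoeff x + 1\<close> is \<open>3 * (2^x - 1)\<close>, this is
    the equation \<open>(2^x - 1) * (2^w - 2^(b - 1)) = 2^a - 2^(b - 1)\<close> of the end rows,
    multiplied by 3.\<close>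
  have rhs: "6 * (2 ^ (a - 1) - 2 ^ (b - 2)) = 2 / 3 * (hcoeff w - hcoeff (b - 1)) * (2 * hcoeff x + 1)"
  proof -
    obtain b' where b': "b = b' + 2" using b2 by (metis add.commute le_Suc_ex)
    obtain c where c: "a = b + c" using ab(1) by (metis le_Suc_ex)
    show ?thesis
      using xw by (auto simp: hcoeff_def b' c power_add algebra_simps)
  qed
  have S: "i' = i \<and> j' = j \<and> j = 0 \<or> x = 1 \<and> i' = i \<and> j' = j \<and> i = 0 \<or>
      x = 1 \<and> i > 0 \<and> j > 0 \<and> i' > 0 \<and> j' > 0 \<or>
      x = b - 1 \<and> i = 0 \<and> j' = 0 \<and> i' = j \<or> x = w \<and> j = 0 \<and> i' = 0 \<and> j' = i"
    using run_constraints[OF _ w x ij'] top(1) ab(2) unfolding rhs by simp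
  have no: False if z: "x = 1" "i > 0" "j > 0" "i' > 0" "j' > 0"
  proof -
    define P W where "P = hcoeff (b - 1)" and "W = hcoeff w"
    have PW: "P \<ge> 4" "P < W"
    proof -
      have "\<not> hcoeff (b - 1) < hcoeff 2" unfolding hcoeff_less_iff using ab(2) by linarith
      then show "P \<ge> 4" by (simp add: P_def hcoeff_def[of 2])
      show "P < W" using w by (simp add: P_def W_def hcoeff_less_iff)
    qed
    obtain i1 j1 i1' j1' where s: "i = Suc i1" "j = Suc j1" "i' = Suc i1'" "j' = Suc j1'"
      using z(2-5) by (metis gr0_implies_Suc)
    have run: "replicate (Suc k) (1 :: nat) @ [1] = replicate (Suc (Suc k)) (Suc 0)" for k
      by (simp add: replicate_append_same)
    have "third_coeff ((b - 1) # replicate (Suc i1) (Suc 0) @ w # replicate (Suc (Suc j1)) (Suc 0)) -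
        third_coeff (w # replicate (Suc i1') (Suc 0) @ (b - 1) # replicate (Suc (Suc j1')) (Suc 0)) = 8 * (W - P)"
      using top(2) rhs ij z unfolding s z(1) run by (simp add: P_def W_def)
    then have U: "(if i1 = 0 then 46 / 3 * P * W - 28 / 3 * P + 2 / 3 * W - 2 / 3 else P * (16 * W - 10)) -
        (if i1' = 0 then 46 / 3 * W * P - 28 / 3 * W + 2 / 3 * P - 2 / 3 else W * (16 * P - 10)) = 8 * (W - P)"
      unfolding third_coeff_run P_def W_def .
    \<comment> \<open>If both first runs are single ones, or both are longer, the left side is
      \<open>10 * (W - P)\<close> instead of \<open>8 * (W - P)\<close>. In the mixed cases
      \<open>V\<close> would be less than \<open>4 * W\<close>, contrary to
      \<open>P \<ge> 4\<close>, which comes from \<open>b \<ge> 3\<close>.\<close>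
    define V where "V = P * W"
    have "V \<ge> 4 * W" unfolding V_def using PW by (intro mult_right_mono) auto
    moreover have "(if i1 = 0 then 46 / 3 * V - 28 / 3 * P + 2 / 3 * W - 2 / 3 else 16 * V - 10 * P) -
        (if i1' = 0 then 46 / 3 * V - 28 / 3 * W + 2 / 3 * P - 2 / 3 else 16 * V - 10 * W) = 8 * (W - P)"
      using U by (cases "i1 = 0"; cases "i1' = 0") (simp_all add: V_def algebra_simps)
    ultimately show False using PW by (auto split: if_splits)
  qed
  \<comment> \<open>For \<open>x = 1\<close> the second alternative means \<open>a = b\<close>, so
    \<open>w = a\<close> holds in both.\<close>
  have x1: "w = a" if "x = 1" using that xw ab(1) by auto
  have xne: "x = a - b + 1" "w = b" if "x \<noteq> 1" using that xw by auto
  have nb: "x \<noteq> 1" if "x = b - 1 \<or> x = w" using that ab w by auto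
  consider (4) "x = 1" "w = a" "i' = i" "j' = j" "j = 0" | (5) "x = a - b + 1" "w = b" "i' = i" "j' = j" "j = 0"
    | (3) "x = 1" "w = a" "i' = i" "j' = j" "i = 0"
    | (sq) "x = a - b + 1" "w = b" "x = b - 1" "i = 0" "j' = 0" "i' = j"
    | (sw) "x = a - b + 1" "w = b" "x = w" "j = 0" "i' = 0" "j' = i"
    using S no x1 xne nb by metis
  then show ?thesis
  proof cases
    case 3
    have "rev ((b - 1) # replicate i 1 @ w # replicate j 1 @ [x]) = replicate (d + 1) 1 @ [a, b - 1]"
      "rev (w # replicate i' 1 @ (b - 1) # replicate j' 1 @ [x]) = replicate (d + 1) 1 @ [b - 1, a]"
      using 3 ij by simp_all
    then show ?thesis using rA rB \<nu> ab(2) by (metis (no_types, lifting))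
  next
    case 4
    have "rev ((b - 1) # replicate i 1 @ w # replicate j 1 @ [x]) = [1, a] @ replicate d 1 @ [b - 1]"
      "rev (w # replicate i' 1 @ (b - 1) # replicate j' 1 @ [x]) = [1, b - 1] @ replicate d 1 @ [a]"
      using 4 ij by simp_all
    then show ?thesis using rA rB \<nu> ab(2) by (metis (no_types, lifting))
  next
    case 5
    have "(b - 1) # replicate i 1 @ w # replicate j 1 @ [x] = [b - 1] @ replicate d 1 @ [b, a - b + 1]"
      "w # replicate i' 1 @ (b - 1) # replicate j' 1 @ [x] = [b] @ replicate d 1 @ [b - 1, a - b + 1]"
      using 5 ij by simp_all
    then show ?thesis using A B \<nu> ab(2) by (metis (no_types, lifting))
  next
    \<comment> \<open>Both end rows of \<alpha> have length \<open>b - 1\<close>, so reading it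
      backwards moves the run in front of the row \<open>b\<close>. In the last case the same
      happens to \<beta> with end rows \<open>b\<close>.\<close>
    case sq
    have "rev ((b - 1) # replicate i 1 @ w # replicate j 1 @ [x]) = [b - 1] @ replicate d 1 @ [b, a - b + 1]"
      "w # replicate i' 1 @ (b - 1) # replicate j' 1 @ [x] = [b] @ replicate d 1 @ [b - 1, a - b + 1]"
      using sq ij by simp_all
    then show ?thesis using rA B \<nu> ab(2) by (metis (no_types, lifting))
  next
    case sw
    have "(b - 1) # replicate i 1 @ w # replicate j 1 @ [x] = [b - 1] @ replicate d 1 @ [b, a - b + 1]"
      "rev (w # replicate i' 1 @ (b - 1) # replicate j' 1 @ [x]) = [b] @ replicate d 1 @ [b - 1, a - b + 1]"
      using sw ij by simp_all
    then show ?thesis using A rB \<nu> ab(2) by (metis (no_types, lifting))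
  qed
qed

end
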